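(* Let $Q$ be a finite quiver, let $M\in\mathrm{rep}_{\mathbb{C}}(Q)$ be straight and $\mathbf{e}\in\mathbb{Z}^{Q_0}$. Let $B$ be a straightening basis of $M$ such that $Q(M,B)$ is aligned, let $\mathrm{wt}:B\to\mathbb{Z}$ be a compatible attractive grading, and let $\mathbb{C}^*$ act on $\mathrm{Gr}_{\mathbf e}(M)$ by the action induced by $\lambda.b:=\lambda^{\mathrm{wt}(b)}b$ for $b\in B$, $\lambda\in\mathbb{C}^*$. Then this action induces an affine paving of $\mathrm{Gr}_{\mathbf{e}}(M)$, i.e. the BB-decomposition of $\mathrm{Gr}_{\mathbf e}(M)$ into attracting sets of the $\mathbb{C}^*$-fixed points is an affine paving.
   Context: A quiver $Q$ has vertex set $Q_0$ and arrow set $Q_1$; an arrow $a$ has source $s_a$ and target $t_a$. $\mathrm{rep}_{\mathbb{C}}(Q)$ is the category of finite-dimensional complex representations $M=((M^{(i)})_{i\in Q_0},(M_a)_{a\in Q_1})$. The quiver Grassmannian $\mathrm{Gr}_{\mathbf e}(M)$ is the closed subvariety of $\prod_{i\in Q_0}\mathrm{Gr}_{e_i}(M^{(i)})$ of all subrepresentations $U\subseteq M$ with $\dim U^{(i)}=e_i$ for all $i$ (empty if some $e_i<0$). Let $B=\{b^{(i)}_k: i\in Q_0,\ 1\le k\le m_i\}$, $m_i=\dim M^{(i)}$, be an indexed basis of $\bigoplus_i M^{(i)}$ with $b^{(i)}_k\in M^{(i)}$. The coefficient quiver $Q(M,B)$ has vertex set $B$ and an arrow $b^{(i)}_k\to b^{(j)}_\ell$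 for each $(a:i\to j)\in Q_1$ such that the coefficient of $b^{(j)}_\ell$ in $M_ab^{(i)}_k$ is non-zero. $M$ is straight if for some $B$ all connected components of $Q(M,B)$ are equioriented strings $\bullet\to\cdots\to\bullet$; such $B$ is a straightening basis. Basis vectors are normalized so that each $M_ab$ ($b\in B$ over $s_a$) is either zero or an element of $B$. $Q(M,B)$ is aligned if over each $(a:i\to j)\in Q_1$: (1) if $M_ab^{(i)}_\ell=0$ and $M_ab^{(i)}_k\neq0$, then $\ell>k$; (2) if $M_ab^{(i)}_\ell=b^{(j)}_{\ell'}$ and $M_ab^{(i)}_k=b^{(j)}_{k'}$ with $\ell>k$, then $\ell'>k'$. A grading $\mathrm{wt}:B\to\mathbb{Z}$ is attractive if: (1) for every $i\in Q_0$, $\mathrm{wt}(b^{(i)}_k)>\mathrm{wt}(b^{(i)}_\ell)$ whenever $k>\ell$; (2) for every $a\in Q_1$ there is $\mathrm{wt}(a)\in\mathbb{Z}$ with $\mathrm{wt}(b^{(t_a)}_\ell)=\mathrm{wt}(b^{(s_a)}_k)+\mathrm{wt}(a)$ whenever $b^{(s_a)}_k\to b^{(t_a)}_\ell$ is an arrow of $Q(M,B)$ over $a$. Compatible means that the same indexing of $B$ is used for the alignment and the attractive grading. For a projective variety $X$ with a $\mathbb{C}^*$-action with finitely many fixed points $x_1,\dots,x_m$, the BB-decomposition is $X=\bigcup_i W_i$ with $W_i=\{x\in X:\lim_{z\to0}z.x=x_i\}$. It is an affine paving if it is an $\alpha$-partition (the pieces can be ordered so that $W_1\cup\dots\cup W_s$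 is closed in $X$ for every $s$) and each $W_i$ is isomorphic to an affine space. *)

theory Defs
  imports "HOL-Analysis.Analysis" "Graph_Theory.Digraph_Component"
begin

section \<open>Complex varieties as spaces with functions\<close>

text \<open>
  A variety over the complex numbers is given by its Zariski topology together with the set
  \<open>regular X D\<close> of regular functions on each open set \<open>D\<close>. Only the values on \<open>D\<close> of a member
  of \<open>regular X D\<close> matter.
\<close>

record 'p fspace =
  zariski :: "'p topology"
  regular :: "'p set \<Rightarrow> ('p \<Rightarrow> complex) set"

abbreviation points :: "'p fspace \<Rightarrow> 'p set" where
  "points X \<equiv> topspace (zariski X)"

definition fsubspace :: "'p fspace \<Rightarrow> 'p set \<Rightarrow> 'p fspace" where
  "fsubspace X S = \<lparr> zariski = subtopology (zariski X) S,
     regular = (\<lambda>D. {f. \<forall>x\<in>D. \<exists>N g. openin (zariski X) N \<and> x \<in> N \<and> g \<in> regular X N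
                              \<and> (\<forall>y\<in>N \<inter> D. f y = g y)}) \<rparr>"

definition fquotient :: "('p \<Rightarrow> 'q) \<Rightarrow> 'p fspace \<Rightarrow> 'q fspace" where
  "fquotient \<pi> X = \<lparr>
     zariski = topology (\<lambda>D. D \<subseteq> \<pi> ` points X \<and> openin (zariski X) {x \<in> points X. \<pi> x \<in> D}),
     regular = (\<lambda>D. {f. f \<circ> \<pi> \<in> regular X {x \<in> points X. \<pi> x \<in> D}}) \<rparr>"

lemma openin_fquotient:
  "openin (zariski (fquotient \<pi> X)) D \<longleftrightarrow>
     D \<subseteq> \<pi> ` points X \<and> openin (zariski X) {x \<in> points X. \<pi> x \<in> D}"
proof -
  define P where
    "P = (\<lambda>D. D \<subseteq> \<pi> ` points X \<and> openin (zariski X) {x \<in> points X. \<pi> x \<in> D})"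
  have "P (S \<inter> T)" if "P S" "P T" for S T
  proof -
    have "{x \<in> points X. \<pi> x \<in> S \<inter> T} =
        {x \<in> points X. \<pi> x \<in> S} \<inter> {x \<in> points X. \<pi> x \<in> T}" by blast
    moreover have "S \<inter> T \<subseteq> \<pi> ` points X" using that unfolding P_def by blast
    ultimately show ?thesis using that unfolding P_def by (simp add: openin_Int)
  qed
  moreover have "P (\<Union>\<K>)" if "\<forall>K\<in>\<K>. P K" for \<K>
  proof -
    have "{x \<in> points X. \<pi> x \<in> \<Union>\<K>} = (\<Union>K\<in>\<K>. {x \<in> points X. \<pi> x \<in> K})" by blast
    moreover have "openin (zariski X) (\<Union>K\<in>\<K>. {x \<in> points X. \<pi> x \<in> K})"
      using that unfolding P_def by (intro openin_Union) blast
    moreover have "\<Union>\<K> \<subseteq> \<pi> ` points X" using that unfolding P_def by blast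
    ultimately show ?thesis unfolding P_def by simp
  qed
  ultimately have "istopology P"
    unfolding istopology_def by simp
  moreover have "zariski (fquotient \<pi> X) = topology P"
    unfolding fquotient_def P_def by simp
  ultimately have "openin (zariski (fquotient \<pi> X)) = P"
    by (simp add: topology_inverse')
  then show ?thesis
    by (simp only: P_def)
qed

lemma points_fquotient: "points (fquotient \<pi> X) = \<pi> ` points X"
proof
  show "points (fquotient \<pi> X) \<subseteq> \<pi> ` points X"
    using openin_topspace[of "zariski (fquotient \<pi> X)"] unfolding openin_fquotient by blast
  have "{x \<in> points X. \<pi> x \<in> \<pi> ` points X} = points X" by auto
  then have "openin (zariski (fquotient \<pi> X)) (\<pi> ` points X)"
    unfolding openin_fquotient by simp
  then show "\<pi> ` points X \<subseteq> points (fquotient \<pi> X)"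
    by (rule openin_subset)
qed

definition variety_morphism :: "'p fspace \<Rightarrow> 'q fspace \<Rightarrow> ('p \<Rightarrow> 'q) \<Rightarrow> bool" where
  "variety_morphism X Y \<phi> \<longleftrightarrow>
     continuous_map (zariski X) (zariski Y) \<phi> \<and>
     (\<forall>D f. openin (zariski Y) D \<and> f \<in> regular Y D
        \<longrightarrow> f \<circ> \<phi> \<in> regular X {x \<in> points X. \<phi> x \<in> D})"

definition variety_isomorphic :: "'p fspace \<Rightarrow> 'q fspace \<Rightarrow> bool" where
  "variety_isomorphic X Y \<longleftrightarrow>
     (\<exists>\<phi> \<psi>. variety_morphism X Y \<phi> \<and> variety_morphism Y X \<psi> \<and>
        (\<forall>x\<in>points X. \<psi> (\<phi> x) = x) \<and> (\<forall>y\<in>points Y. \<phi> (\<psi> y) = y))"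

inductive_set polynomial_functions :: "('p \<Rightarrow> complex) set \<Rightarrow> ('p \<Rightarrow> complex) set"
  for C :: "('p \<Rightarrow> complex) set" where
  coordinate: "c \<in> C \<Longrightarrow> c \<in> polynomial_functions C"
| const: "(\<lambda>_. k) \<in> polynomial_functions C"
| add: "p \<in> polynomial_functions C \<Longrightarrow> q \<in> polynomial_functions C
          \<Longrightarrow> (\<lambda>x. p x + q x) \<in> polynomial_functions C"
| mult: "p \<in> polynomial_functions C \<Longrightarrow> q \<in> polynomial_functions C
          \<Longrightarrow> (\<lambda>x. p x * q x) \<in> polynomial_functions C"

text \<open>
  The point set \<open>A\<close>, a locally closed subset of an affine space with coordinate functions \<open>C\<close>:
  the basic open sets are the non-vanishing loci of polynomials, and a function is regular if it
  is locally a quotient of polynomials.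
\<close>

definition coordinate_space :: "'p set \<Rightarrow> ('p \<Rightarrow> complex) set \<Rightarrow> 'p fspace" where
  "coordinate_space A C = \<lparr>
     zariski = topology_generated_by {{x \<in> A. p x \<noteq> 0} | p. p \<in> polynomial_functions C},
     regular = (\<lambda>D. {f. \<forall>x\<in>D. \<exists>p\<in>polynomial_functions C. \<exists>q\<in>polynomial_functions C.
                           q x \<noteq> 0 \<and> (\<forall>y\<in>D. q y \<noteq> 0 \<longrightarrow> f y = p y / q y)}) \<rparr>"

lemma points_coordinate_space [simp]: "points (coordinate_space A C) = A"
proof -
  have "A \<in> {{x \<in> A. p x \<noteq> 0} | p. p \<in> polynomial_functions C}"
    using polynomial_functions.const[of 1 C] by (intro CollectI exI[of _ "\<lambda>_. 1"]) simp
  then have "\<Union>{{x \<in> A. p x \<noteq> 0} | p. p \<in> polynomial_functions C} = A"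
    by blast
  then show ?thesis
    unfolding coordinate_space_def by (simp only: fspace.simps topology_generated_by_topspace)
qed

definition affine_space :: "nat \<Rightarrow> (nat \<Rightarrow> complex) fspace" where
  "affine_space n = coordinate_space ({..<n} \<rightarrow>\<^sub>E UNIV) {(\<lambda>x. x k) | k. k < n}"

definition affine_line :: "complex fspace" where
  "affine_line = coordinate_space UNIV {\<lambda>z. z}"

section \<open>Bialynicki-Birula decompositions and affine pavings\<close>

definition cstar_action :: "'p set \<Rightarrow> (complex \<Rightarrow> 'p \<Rightarrow> 'p) \<Rightarrow> bool" where
  "cstar_action S act \<longleftrightarrow>
     (\<forall>x\<in>S. act 1 x = x \<and>
        (\<forall>z. z \<noteq> 0 \<longrightarrow> act z x \<in> S \<and> (\<forall>w. w \<noteq> 0 \<longrightarrow> act z (act w x) = act (z * w) x)))"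

definition fixed_points :: "'p fspace \<Rightarrow> (complex \<Rightarrow> 'p \<Rightarrow> 'p) \<Rightarrow> 'p set" where
  "fixed_points X act = {x \<in> points X. \<forall>z. z \<noteq> 0 \<longrightarrow> act z x = x}"

text \<open>
  The limit of \<open>z.x\<close> for \<open>z \<rightarrow> 0\<close> is the algebraic one: the value at \<open>0\<close> of the
  extension of the orbit map to a morphism from the affine line.
\<close>

definition limit_at_zero :: "'p fspace \<Rightarrow> (complex \<Rightarrow> 'p \<Rightarrow> 'p) \<Rightarrow> 'p \<Rightarrow> 'p \<Rightarrow> bool" where
  "limit_at_zero X act x y \<longleftrightarrow>
     variety_morphism affine_line X (\<lambda>z. if z = 0 then y else act z x)"

definition attracting_set :: "'p fspace \<Rightarrow> (complex \<Rightarrow> 'p \<Rightarrow> 'p) \<Rightarrow> 'p \<Rightarrow> 'p set" where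
  "attracting_set X act y = {x \<in> points X. limit_at_zero X act x y}"

definition alpha_partition :: "'p fspace \<Rightarrow> 'k set \<Rightarrow> ('k \<Rightarrow> 'p set) \<Rightarrow> bool" where
  "alpha_partition X I W \<longleftrightarrow>
     (\<Union>i\<in>I. W i) = points X \<and> disjoint_family_on W I \<and>
     (\<exists>xs. distinct xs \<and> set xs = I \<and>
        (\<forall>s\<le>length xs. closedin (zariski X) (\<Union>i\<in>set (take s xs). W i)))"

definition affine_paving :: "'p fspace \<Rightarrow> 'k set \<Rightarrow> ('k \<Rightarrow> 'p set) \<Rightarrow> bool" where
  "affine_paving X I W \<longleftrightarrow>
     alpha_partition X I W \<and>
     (\<forall>i\<in>I. \<exists>n. variety_isomorphic (fsubspace X (W i)) (affine_space n))"

section \<open>Quiver representations\<close>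

definition equioriented_string :: "('v, 'e) pre_digraph \<Rightarrow> bool" where
  "equioriented_string G \<longleftrightarrow>
     (\<exists>u p v. pre_digraph.apath G u p v \<and>
        verts G = set (pre_digraph.awalk_verts G u p) \<and> arcs G = set p)"

text \<open>
  The spaces \<open>V i\<close> of a representation are subspaces of a common ambient vector space of arbitrary
  dimension (for instance of their direct sum); they need not be independent of each other.
\<close>

locale quiver_representation = fin_digraph Q + vector_space scale
  for Q :: "('i, 'a) pre_digraph"
    and scale :: "complex \<Rightarrow> 'v::ab_group_add \<Rightarrow> 'v" +
  fixes V :: "'i \<Rightarrow> 'v set"
    and f :: "'a \<Rightarrow> 'v \<Rightarrow> 'v"
  assumes subspace_V: "i \<in> verts Q \<Longrightarrow> subspace (V i)"
    and finite_dim_V: "i \<in> verts Q \<Longrightarrow> \<exists>S. finite S \<and> span S = V i"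
    and map_in: "\<lbrakk>a \<in> arcs Q; x \<in> V (tail Q a)\<rbrakk> \<Longrightarrow> f a x \<in> V (head Q a)"
    and map_add: "\<lbrakk>a \<in> arcs Q; x \<in> V (tail Q a); y \<in> V (tail Q a)\<rbrakk>
                    \<Longrightarrow> f a (x + y) = f a x + f a y"
    and map_scale: "\<lbrakk>a \<in> arcs Q; x \<in> V (tail Q a)\<rbrakk> \<Longrightarrow> f a (scale c x) = scale c (f a x)"
begin

subsection \<open>Quiver Grassmannians\<close>

definition grassmannian_product :: "('i \<Rightarrow> int) \<Rightarrow> ('i \<Rightarrow> 'v set) set" where
  "grassmannian_product e =
     (\<Pi>\<^sub>E i\<in>verts Q. {U. subspace U \<and> U \<subseteq> V i \<and> int (dim U) = e i})"

definition subrepresentations :: "('i \<Rightarrow> int) \<Rightarrow> ('i \<Rightarrow> 'v set) set" where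
  "subrepresentations e =
     {U \<in> grassmannian_product e. \<forall>a\<in>arcs Q. f a ` U (tail Q a) \<subseteq> U (head Q a)}"

text \<open>
  The variety structure of a product of Grassmannians is that of a geometric quotient: tuples of
  linearly independent vectors, an open subset of an affine space, modulo change of basis.
\<close>

definition frame_index :: "('i \<Rightarrow> int) \<Rightarrow> ('i \<times> nat) set" where
  "frame_index e = (SIGMA i:verts Q. {..<nat (e i)})"

definition frames :: "('i \<Rightarrow> int) \<Rightarrow> ('i \<times> nat \<Rightarrow> 'v) set" where
  "frames e = {F \<in> (\<Pi>\<^sub>E j\<in>frame_index e. V (fst j)).
     \<forall>i\<in>verts Q. 0 \<le> e i \<and> inj_on (\<lambda>r. F (i, r)) {..<nat (e i)} \<and>
       independent ((\<lambda>r. F (i, r)) ` {..<nat (e i)})}"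

definition frame_variety :: "('i \<Rightarrow> int) \<Rightarrow> ('i \<times> nat \<Rightarrow> 'v) fspace" where
  "frame_variety e = coordinate_space (frames e)
     {(\<lambda>F. \<xi> (F j)) | \<xi> j. j \<in> frame_index e \<and> Vector_Spaces.linear scale (*) \<xi>}"

definition frame_span :: "('i \<Rightarrow> int) \<Rightarrow> ('i \<times> nat \<Rightarrow> 'v) \<Rightarrow> 'i \<Rightarrow> 'v set" where
  "frame_span e F = (\<lambda>i\<in>verts Q. span ((\<lambda>r. F (i, r)) ` {..<nat (e i)}))"

definition grassmannian_product_variety :: "('i \<Rightarrow> int) \<Rightarrow> ('i \<Rightarrow> 'v set) fspace" where
  "grassmannian_product_variety e = fquotient (frame_span e) (frame_variety e)"

definition quiver_grassmannian :: "('i \<Rightarrow> int) \<Rightarrow> ('i \<Rightarrow> 'v set) fspace" where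
  "quiver_grassmannian e = fsubspace (grassmannian_product_variety e) (subrepresentations e)"

subsection \<open>Coefficient quivers\<close>

definition basis_index :: "'i \<Rightarrow> nat set" where
  "basis_index i = {1..dim (V i)}"

definition indexed_basis :: "('i \<Rightarrow> nat \<Rightarrow> 'v) \<Rightarrow> bool" where
  "indexed_basis b \<longleftrightarrow>
     (\<forall>i\<in>verts Q. inj_on (b i) (basis_index i) \<and> independent (b i ` basis_index i) \<and>
        span (b i ` basis_index i) = V i)"

definition coefficient :: "('i \<Rightarrow> nat \<Rightarrow> 'v) \<Rightarrow> 'i \<Rightarrow> 'v \<Rightarrow> nat \<Rightarrow> complex" where
  "coefficient b i x k = representation (b i ` basis_index i) x (b i k)"

text \<open>
  The vertex \<open>(i, k)\<close> stands for the basis vector \<open>b i k\<close>. Each arrow records the arrow of the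
  quiver it lies over, so parallel arrows of the quiver yield distinct arrows.
\<close>

definition coefficient_quiver ::
    "('i \<Rightarrow> nat \<Rightarrow> 'v) \<Rightarrow> ('i \<times> nat, nat \<times> 'a \<times> nat) pre_digraph" where
  "coefficient_quiver b = \<lparr>
     verts = (SIGMA i:verts Q. basis_index i),
     arcs = {(k, a, l). a \<in> arcs Q \<and> k \<in> basis_index (tail Q a) \<and> l \<in> basis_index (head Q a) \<and>
               coefficient b (head Q a) (f a (b (tail Q a) k)) l \<noteq> 0},
     tail = (\<lambda>(k, a, l). (tail Q a, k)),
     head = (\<lambda>(k, a, l). (head Q a, l)) \<rparr>"

definition straightening_basis :: "('i \<Rightarrow> nat \<Rightarrow> 'v) \<Rightarrow> bool" where
  "straightening_basis b \<longleftrightarrow> indexed_basis b \<and>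
     (\<forall>H. pre_digraph.max_subgraph (coefficient_quiver b) Digraph_Component.connected H
        \<longrightarrow> equioriented_string H)"

definition straight :: bool where
  "straight \<longleftrightarrow> (\<exists>b. straightening_basis b)"

definition normalized :: "('i \<Rightarrow> nat \<Rightarrow> 'v) \<Rightarrow> bool" where
  "normalized b \<longleftrightarrow>
     (\<forall>a\<in>arcs Q. \<forall>k\<in>basis_index (tail Q a).
        f a (b (tail Q a) k) = 0 \<or> f a (b (tail Q a) k) \<in> b (head Q a) ` basis_index (head Q a))"

definition aligned :: "('i \<Rightarrow> nat \<Rightarrow> 'v) \<Rightarrow> bool" where
  "aligned b \<longleftrightarrow>
     (\<forall>a\<in>arcs Q. \<forall>k\<in>basis_index (tail Q a). \<forall>l\<in>basis_index (tail Q a).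
        (f a (b (tail Q a) l) = 0 \<and> f a (b (tail Q a) k) \<noteq> 0 \<longrightarrow> l > k) \<and>
        (\<forall>k'\<in>basis_index (head Q a). \<forall>l'\<in>basis_index (head Q a).
           f a (b (tail Q a) l) = b (head Q a) l' \<and> f a (b (tail Q a) k) = b (head Q a) k' \<and> l > k
           \<longrightarrow> l' > k'))"

definition attractive_grading :: "('i \<Rightarrow> nat \<Rightarrow> 'v) \<Rightarrow> ('i \<Rightarrow> nat \<Rightarrow> int) \<Rightarrow> bool" where
  "attractive_grading b wt \<longleftrightarrow>
     (\<forall>i\<in>verts Q. \<forall>k\<in>basis_index i. \<forall>l\<in>basis_index i. k > l \<longrightarrow> wt i k > wt i l) \<and>
     (\<forall>a\<in>arcs Q. \<exists>d::int. \<forall>k l. (k, a, l) \<in> arcs (coefficient_quiver b)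
        \<longrightarrow> wt (head Q a) l = wt (tail Q a) k + d)"

definition torus_vector ::
    "('i \<Rightarrow> nat \<Rightarrow> 'v) \<Rightarrow> ('i \<Rightarrow> nat \<Rightarrow> int) \<Rightarrow> complex \<Rightarrow> 'i \<Rightarrow> 'v \<Rightarrow> 'v" where
  "torus_vector b wt z i x =
     (\<Sum>k\<in>basis_index i. scale (coefficient b i x k) (scale (z powi wt i k) (b i k)))"

definition torus_action ::
    "('i \<Rightarrow> nat \<Rightarrow> 'v) \<Rightarrow> ('i \<Rightarrow> nat \<Rightarrow> int) \<Rightarrow> complex \<Rightarrow> ('i \<Rightarrow> 'v set) \<Rightarrow> ('i \<Rightarrow> 'v set)" where
  "torus_action b wt z U = (\<lambda>i\<in>verts Q. torus_vector b wt z i ` U i)"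

end

end

theory Submission
  imports Defs "Jordan_Normal_Form.Determinant"
begin

text \<open>
  Write \<open>U\<close> at each vertex in reduced echelon form with respect to the basis, the pivot of a vector
  being the least index with a nonzero coefficient. As the weights increase with the index, the
  limit of \<open>z.U\<close> is the coordinate subspace of the pivots, so the attracting sets are the
  intersections of the quiver Grassmannian with products of Schubert cells.

  An arrow of the quiver maps a vector with pivot \<open>k\<close> to zero or to a vector whose pivot is the
  image of \<open>k\<close>; this is what alignment gives. Since the components of the coefficient quiver are
  strings, each pivot has at most one preimage. Hence a point of a cell is determined by the rows
  whose pivots have no preimage among the pivots, and these rows can be chosen freely: the remaining
  rows may be taken to be their images. This makes the cell an affine space.

  The fixed points are ordered by a weight that refines the lexicographic order of the pivots. The
  complements of the unions of initial cells are unions of standard charts of the Grassmannian.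
\<close>

section \<open>Spaces with functions\<close>

text \<open>The variety structure is a quotient of frames, and this decides how each morphism is
  built. A map into the Grassmannian is given by a lift to frames with polynomial coordinates. A
  function on the Grassmannian is regular when its pullback to frames is locally a quotient of
  polynomials; for entries of the normalised basis on a chart, Cramer's rule provides this, with a
  minor as denominator.

  The basis that parametrises a cell is not the reduced one, since reducing the image of a row would
  subtract multiples of other rows. The inverse therefore reads the reduced basis only at rows
  without preimage, where both bases agree. The other rows are recovered because the point is stable
  under the arrows, and an inclusion of subspaces with equal pivots is an equality.

  Oriented cycles in \<open>Q\<close> are allowed, so taking images repeatedly ends only because a
  string of the coefficient quiver never returns to a vertex.

  That no other fixed point can be the limit needs its own argument: the algebraic limit is tested
  on a chart, where rational functions are continuous at zero in the usual topology.\<close>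

lemma polynomial_functions_sum:
  assumes "\<And>i. i \<in> I \<Longrightarrow> (\<lambda>x. g i x) \<in> polynomial_functions C"
  shows "(\<lambda>x. \<Sum>i\<in>I. g i x) \<in> polynomial_functions C"
  using assms
  by (induction I rule: infinite_finite_induct) (simp_all add: polynomial_functions.intros)

lemma polynomial_functions_prod:
  assumes "\<And>i. i \<in> I \<Longrightarrow> (\<lambda>x. g i x) \<in> polynomial_functions C"
  shows "(\<lambda>x. \<Prod>i\<in>I. g i x) \<in> polynomial_functions C"
  using assms
  by (induction I rule: infinite_finite_induct) (simp_all add: polynomial_functions.intros)

lemma polynomial_functions_power:
  assumes "p \<in> polynomial_functions C"
  shows "(\<lambda>x. p x ^ n) \<in> polynomial_functions C"
  using assms by (induction n) (simp_all add: polynomial_functions.intros)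

lemma polynomial_functions_continuous:
  assumes "p \<in> polynomial_functions {\<lambda>z::complex. z}"
  shows "continuous_on UNIV p"
  using assms by induction (auto intro: continuous_intros)

text \<open>A sheaf of complex algebras whose non-vanishing loci are open and whose functions are
  invertible there. These properties pass to quotients and subspaces, and they make a map into a
  coordinate space a morphism as soon as its coordinates are regular.\<close>

locale function_space =
  fixes X :: "'p fspace"
  assumes regular_const: "openin (zariski X) D \<Longrightarrow> (\<lambda>_. k) \<in> regular X D"
    and regular_add: "\<lbrakk>openin (zariski X) D; g \<in> regular X D; h \<in> regular X D\<rbrakk>
      \<Longrightarrow> (\<lambda>x. g x + h x) \<in> regular X D"
    and regular_mult: "\<lbrakk>openin (zariski X) D; g \<in> regular X D; h \<in> regular X D\<rbrakk>
      \<Longrightarrow> (\<lambda>x. g x * h x) \<in> regular X D"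
    and openin_nonzero: "\<lbrakk>openin (zariski X) D; g \<in> regular X D\<rbrakk>
      \<Longrightarrow> openin (zariski X) {x \<in> D. g x \<noteq> 0}"
    and regular_inverse: "\<lbrakk>openin (zariski X) D; g \<in> regular X D\<rbrakk>
      \<Longrightarrow> (\<lambda>x. inverse (g x)) \<in> regular X {x \<in> D. g x \<noteq> 0}"
    and regular_mono: "\<lbrakk>openin (zariski X) D; openin (zariski X) D'; D' \<subseteq> D; g \<in> regular X D\<rbrakk>
      \<Longrightarrow> g \<in> regular X D'"
    and regular_local: "\<lbrakk>openin (zariski X) D;
        \<And>x. x \<in> D \<Longrightarrow> \<exists>N h. openin (zariski X) N \<and> x \<in> N \<and> N \<subseteq> D \<and> h \<in> regular X N
          \<and> (\<forall>y\<in>N. g y = h y)\<rbrakk>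
      \<Longrightarrow> g \<in> regular X D"

text \<open>Because \<open>p * q\<close> is non-zero exactly where both factors are, the generating
  sets are closed under finite intersections and so form a basis.\<close>

lemma openin_coordinate_space:
  "openin (zariski (coordinate_space A C)) D \<longleftrightarrow>
     D \<subseteq> A \<and> (\<forall>x\<in>D. \<exists>p\<in>polynomial_functions C. p x \<noteq> 0 \<and> {y \<in> A. p y \<noteq> 0} \<subseteq> D)"
    (is "_ \<longleftrightarrow> ?P D")
proof
  let ?B = "{{x \<in> A. p x \<noteq> 0} | p. p \<in> polynomial_functions C}"
  assume "openin (zariski (coordinate_space A C)) D"
  then have "generate_topology_on ?B D"
    unfolding coordinate_space_def by (simp add: openin_topology_generated_by_iff)
  then show "?P D"
  proof induction
    case Empty
    then show ?case by simp
  next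
    case (Int a b)
    have "\<exists>p\<in>polynomial_functions C. p x \<noteq> 0 \<and> {y \<in> A. p y \<noteq> 0} \<subseteq> a \<inter> b"
      if x: "x \<in> a \<inter> b" for x
    proof -
      obtain p where "p \<in> polynomial_functions C" "p x \<noteq> 0" "{y \<in> A. p y \<noteq> 0} \<subseteq> a"
        using Int.IH(1) x by blast
      moreover obtain q where "q \<in> polynomial_functions C" "q x \<noteq> 0" "{y \<in> A. q y \<noteq> 0} \<subseteq> b"
        using Int.IH(2) x by blast
      ultimately show ?thesis
        by (intro bexI[of _ "\<lambda>y. p y * q y"]) (auto simp: polynomial_functions.mult)
    qed
    moreover have "a \<inter> b \<subseteq> A" using Int.IH(1) by blast
    ultimately show ?case by blast
  next
    case (UN K)
    show ?case
    proof (intro conjI ballI)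
      show "\<Union>K \<subseteq> A" using UN.IH by blast
      fix x assume "x \<in> \<Union>K"
      then obtain k where k: "k \<in> K" "x \<in> k" by blast
      then obtain p where "p \<in> polynomial_functions C" "p x \<noteq> 0" "{y \<in> A. p y \<noteq> 0} \<subseteq> k"
        using UN.IH[OF k(1)] by blast
      then show "\<exists>p\<in>polynomial_functions C. p x \<noteq> 0 \<and> {y \<in> A. p y \<noteq> 0} \<subseteq> \<Union>K"
        using k by blast
    qed
  next
    case (Basis s)
    then show ?case by auto
  qed
next
  assume D: "?P D"
  show "openin (zariski (coordinate_space A C)) D"
  proof (subst openin_subopen, intro ballI)
    fix x assume "x \<in> D"
    with D obtain p where p: "p \<in> polynomial_functions C" "p x \<noteq> 0" "{y \<in> A. p y \<noteq> 0} \<subseteq> D"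
      by blast
    have "openin (zariski (coordinate_space A C)) {y \<in> A. p y \<noteq> 0}"
      unfolding coordinate_space_def using p(1)
      by (auto intro: topology_generated_by_Basis)
    with p D \<open>x \<in> D\<close> show "\<exists>T. openin (zariski (coordinate_space A C)) T \<and> x \<in> T \<and> T \<subseteq> D"
      by (intro exI[of _ "{y \<in> A. p y \<noteq> 0}"]) auto
  qed
qed

lemma openin_coordinate_spaceE:
  assumes "openin (zariski (coordinate_space A C)) D" "x \<in> D"
  obtains p where "p \<in> polynomial_functions C" "p x \<noteq> 0" "{y \<in> A. p y \<noteq> 0} \<subseteq> D"
  using assms unfolding openin_coordinate_space by blast

lemma regular_coordinate_space:
  "g \<in> regular (coordinate_space A C) D \<longleftrightarrow>
     (\<forall>x\<in>D. \<exists>p\<in>polynomial_functions C. \<exists>q\<in>polynomial_functions C.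
        q x \<noteq> 0 \<and> (\<forall>y\<in>D. q y \<noteq> 0 \<longrightarrow> g y = p y / q y))"
  by (simp add: coordinate_space_def)

lemma regular_coordinate_spaceE:
  assumes "g \<in> regular (coordinate_space A C) D" "x \<in> D"
  obtains p q where "p \<in> polynomial_functions C" "q \<in> polynomial_functions C"
    "q x \<noteq> 0" "\<forall>y\<in>D. q y \<noteq> 0 \<longrightarrow> g y = p y / q y"
  using assms unfolding regular_coordinate_space by blast

lemma polynomial_function_regular:
  "p \<in> polynomial_functions C \<Longrightarrow> p \<in> regular (coordinate_space A C) D"
  unfolding regular_coordinate_space
  using polynomial_functions.const[of 1 C] by force

lemma function_space_coordinate_space: "function_space (coordinate_space A C)"
proof
  fix D :: "'a set" and k
  show "(\<lambda>_. k) \<in> regular (coordinate_space A C) D"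
    by (rule polynomial_function_regular[OF polynomial_functions.const])
next
  fix D :: "'a set" and g h
  assume g: "g \<in> regular (coordinate_space A C) D" and h: "h \<in> regular (coordinate_space A C) D"
  have "\<exists>p\<in>polynomial_functions C. \<exists>p'\<in>polynomial_functions C. \<exists>q\<in>polynomial_functions C.
      q x \<noteq> 0 \<and> (\<forall>y\<in>D. q y \<noteq> 0 \<longrightarrow> g y + h y = p y / q y \<and> g y * h y = p' y / q y)"
    if x: "x \<in> D" for x
  proof -
    obtain p q where 1: "p \<in> polynomial_functions C" "q \<in> polynomial_functions C"
      "q x \<noteq> 0" "\<forall>y\<in>D. q y \<noteq> 0 \<longrightarrow> g y = p y / q y"
      by (rule regular_coordinate_spaceE[OF g x])
    obtain p' q' where 2: "p' \<in> polynomial_functions C" "q' \<in> polynomial_functions C"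
      "q' x \<noteq> 0" "\<forall>y\<in>D. q' y \<noteq> 0 \<longrightarrow> h y = p' y / q' y"
      by (rule regular_coordinate_spaceE[OF h x])
    have "(\<lambda>y. p y * q' y + p' y * q y) \<in> polynomial_functions C"
      "(\<lambda>y. p y * p' y) \<in> polynomial_functions C" "(\<lambda>y. q y * q' y) \<in> polynomial_functions C"
      using 1 2 by (simp_all add: polynomial_functions.add polynomial_functions.mult)
    moreover have "\<forall>y\<in>D. q y * q' y \<noteq> 0 \<longrightarrow>
        g y + h y = (p y * q' y + p' y * q y) / (q y * q' y) \<and> g y * h y = (p y * p' y) / (q y * q' y)"
      using 1(4) 2(4) by (auto simp: add_frac_eq)
    moreover have "q x * q' x \<noteq> 0" using 1(3) 2(3) by simp
    ultimately show ?thesis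
      by - (rule bexI[of _ "\<lambda>y. p y * q' y + p' y * q y"], rule bexI[of _ "\<lambda>y. p y * p' y"],
        rule bexI[of _ "\<lambda>y. q y * q' y"], rule conjI)
  qed
  then show "(\<lambda>x. g x + h x) \<in> regular (coordinate_space A C) D"
    and "(\<lambda>x. g x * h x) \<in> regular (coordinate_space A C) D"
    unfolding regular_coordinate_space by blast+
next
  fix D :: "'a set" and g
  assume D: "openin (zariski (coordinate_space A C)) D"
    and g: "g \<in> regular (coordinate_space A C) D"
  show "openin (zariski (coordinate_space A C)) {x \<in> D. g x \<noteq> 0}"
    unfolding openin_coordinate_space
  proof (intro conjI ballI)
    show "{x \<in> D. g x \<noteq> 0} \<subseteq> A"
      using D unfolding openin_coordinate_space by blast
    fix x assume x: "x \<in> {x \<in> D. g x \<noteq> 0}"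
    then have xD: "x \<in> D" by simp
    obtain p q where 1: "p \<in> polynomial_functions C" "q \<in> polynomial_functions C"
      "q x \<noteq> 0" "\<forall>y\<in>D. q y \<noteq> 0 \<longrightarrow> g y = p y / q y"
      by (rule regular_coordinate_spaceE[OF g xD])
    obtain r where 2: "r \<in> polynomial_functions C" "r x \<noteq> 0" "{y \<in> A. r y \<noteq> 0} \<subseteq> D"
      by (rule openin_coordinate_spaceE[OF D xD])
    show "\<exists>p\<in>polynomial_functions C. p x \<noteq> 0 \<and> {y \<in> A. p y \<noteq> 0} \<subseteq> {x \<in> D. g x \<noteq> 0}"
      \<comment> \<open>The factor \<open>r\<close> keeps the locus inside \<open>D\<close>, the
        factor \<open>q\<close> makes \<open>g = p / q\<close> available there, and the factor
        \<open>p\<close> then makes \<open>g\<close> non-zero.\<close>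
      using 1 2 x by (intro bexI[of _ "\<lambda>y. r y * (p y * q y)"]) (auto simp: polynomial_functions.mult)
  qed
  show "(\<lambda>x. inverse (g x)) \<in> regular (coordinate_space A C) {x \<in> D. g x \<noteq> 0}"
    unfolding regular_coordinate_space
  proof
    fix x assume x: "x \<in> {x \<in> D. g x \<noteq> 0}"
    then have xD: "x \<in> D" by simp
    obtain p q where 1: "p \<in> polynomial_functions C" "q \<in> polynomial_functions C"
      "q x \<noteq> 0" "\<forall>y\<in>D. q y \<noteq> 0 \<longrightarrow> g y = p y / q y"
      by (rule regular_coordinate_spaceE[OF g xD])
    show "\<exists>p\<in>polynomial_functions C. \<exists>q\<in>polynomial_functions C. q x \<noteq> 0 \<and>
        (\<forall>y\<in>{x \<in> D. g x \<noteq> 0}. q y \<noteq> 0 \<longrightarrow> inverse (g y) = p y / q y)"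
      \<comment> \<open>The inverse of \<open>p / q\<close> is written as
        \<open>(q * q) / (p * q)\<close>: a non-zero denominator then implies that \<open>q\<close>
        is non-zero, which the formula for \<open>g\<close> requires.\<close>
      using 1 x by - (rule bexI[of _ "\<lambda>y. q y * q y"], rule bexI[of _ "\<lambda>y. p y * q y"],
          auto simp: polynomial_functions.mult)
  qed
next
  fix D D' :: "'a set" and g
  assume sub: "D' \<subseteq> D" and g: "g \<in> regular (coordinate_space A C) D"
  show "g \<in> regular (coordinate_space A C) D'"
    unfolding regular_coordinate_space
  proof
    fix x assume "x \<in> D'"
    with sub have "x \<in> D" by blast
    then obtain p q where "p \<in> polynomial_functions C" "q \<in> polynomial_functions C"
      "q x \<noteq> 0" "\<forall>y\<in>D. q y \<noteq> 0 \<longrightarrow> g y = p y / q y"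
      by (rule regular_coordinate_spaceE[OF g])
    with sub show "\<exists>p\<in>polynomial_functions C. \<exists>q\<in>polynomial_functions C. q x \<noteq> 0 \<and>
        (\<forall>y\<in>D'. q y \<noteq> 0 \<longrightarrow> g y = p y / q y)"
      by - (rule bexI[of _ p], rule bexI[of _ q], auto)
  qed
next
  fix D :: "'a set" and g
  assume D: "openin (zariski (coordinate_space A C)) D"
    and loc: "\<And>x. x \<in> D \<Longrightarrow> \<exists>N h. openin (zariski (coordinate_space A C)) N \<and> x \<in> N \<and> N \<subseteq> D
      \<and> h \<in> regular (coordinate_space A C) N \<and> (\<forall>y\<in>N. g y = h y)"
  show "g \<in> regular (coordinate_space A C) D"
    unfolding regular_coordinate_space
  proof
    fix x assume "x \<in> D"
    from loc[OF this] obtain N h where N: "openin (zariski (coordinate_space A C)) N" "x \<in> N"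
      and h: "h \<in> regular (coordinate_space A C) N" "\<forall>y\<in>N. g y = h y"
      by blast
    obtain p q where 1: "p \<in> polynomial_functions C" "q \<in> polynomial_functions C"
      "q x \<noteq> 0" "\<forall>y\<in>N. q y \<noteq> 0 \<longrightarrow> h y = p y / q y"
      by (rule regular_coordinate_spaceE[OF h(1) N(2)])
    obtain r where 2: "r \<in> polynomial_functions C" "r x \<noteq> 0" "{y \<in> A. r y \<noteq> 0} \<subseteq> N"
      by (rule openin_coordinate_spaceE[OF N])
    have "D \<subseteq> A" using D unfolding openin_coordinate_space by blast
    then show "\<exists>p\<in>polynomial_functions C. \<exists>q\<in>polynomial_functions C. q x \<noteq> 0 \<and>
        (\<forall>y\<in>D. q y \<noteq> 0 \<longrightarrow> g y = p y / q y)"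
      \<comment> \<open>Both polynomials are multiplied by \<open>r\<close>, which vanishes on
        \<open>A\<close> outside \<open>N\<close>. The local fraction then holds on all of
        \<open>D\<close> wherever its denominator is non-zero.\<close>
      using 1 2 h(2) by - (rule bexI[of _ "\<lambda>y. p y * r y"], rule bexI[of _ "\<lambda>y. q y * r y"],
          auto simp: polynomial_functions.mult)
  qed
qed

text \<open>Taking preimages commutes with restriction, gluing and the algebra operations, so each
  axiom is the axiom on \<open>X\<close> for the pulled-back functions.\<close>

lemma (in function_space) function_space_fquotient: "function_space (fquotient \<pi> X)"
proof
  let ?pre = "\<lambda>D. {x \<in> points X. \<pi> x \<in> D}"
  have reg: "g \<in> regular (fquotient \<pi> X) D \<longleftrightarrow> (\<lambda>x. g (\<pi> x)) \<in> regular X (?pre D)" for g D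
    by (simp add: fquotient_def comp_def)
  note op = openin_fquotient[of \<pi> X]
  fix D
  assume D: "openin (zariski (fquotient \<pi> X)) D"
  then have pD: "openin (zariski X) (?pre D)" by (simp add: op)
  fix g
  show "(\<lambda>_. k) \<in> regular (fquotient \<pi> X) D" for k
    using pD by (simp add: reg regular_const)
  show "g \<in> regular (fquotient \<pi> X) D"
    if loc: "\<And>x. x \<in> D \<Longrightarrow> \<exists>N h. openin (zariski (fquotient \<pi> X)) N \<and> x \<in> N \<and> N \<subseteq> D
      \<and> h \<in> regular (fquotient \<pi> X) N \<and> (\<forall>y\<in>N. g y = h y)"
    unfolding reg
  proof (rule regular_local[OF pD])
    fix x assume x: "x \<in> ?pre D"
    then have "\<pi> x \<in> D" by simp
    from loc[OF this] obtain N h where "openin (zariski (fquotient \<pi> X)) N" "\<pi> x \<in> N" "N \<subseteq> D"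
      "h \<in> regular (fquotient \<pi> X) N" "\<forall>y\<in>N. g y = h y"
      by blast
    with x show "\<exists>N h. openin (zariski X) N \<and> x \<in> N \<and> N \<subseteq> ?pre D \<and> h \<in> regular X N
        \<and> (\<forall>y\<in>N. g (\<pi> y) = h y)"
      by (intro exI[of _ "?pre N"] exI[of _ "\<lambda>x. h (\<pi> x)"]) (auto simp: op reg)
  qed
  assume g: "g \<in> regular (fquotient \<pi> X) D"
  then have pg: "(\<lambda>x. g (\<pi> x)) \<in> regular X (?pre D)" by (simp add: reg)
  have nz: "?pre {x \<in> D. g x \<noteq> 0} = {x \<in> ?pre D. g (\<pi> x) \<noteq> 0}" by auto
  show "openin (zariski (fquotient \<pi> X)) {x \<in> D. g x \<noteq> 0}"
    using D openin_nonzero[OF pD pg] unfolding op nz by auto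
  show "(\<lambda>x. inverse (g x)) \<in> regular (fquotient \<pi> X) {x \<in> D. g x \<noteq> 0}"
    using regular_inverse[OF pD pg] unfolding reg nz .
  show "g \<in> regular (fquotient \<pi> X) D'" if "openin (zariski (fquotient \<pi> X)) D'" "D' \<subseteq> D" for D'
    using that unfolding reg op by (intro regular_mono[OF pD _ _ pg]) auto
  fix h
  assume "h \<in> regular (fquotient \<pi> X) D"
  then have ph: "(\<lambda>x. h (\<pi> x)) \<in> regular X (?pre D)" by (simp add: reg)
  show "(\<lambda>x. g x + h x) \<in> regular (fquotient \<pi> X) D"
    using regular_add[OF pD pg ph] by (simp add: reg)
  show "(\<lambda>x. g x * h x) \<in> regular (fquotient \<pi> X) D"
    using regular_mult[OF pD pg ph] by (simp add: reg)
qed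

lemma regular_fsubspace:
  "g \<in> regular (fsubspace X S) D \<longleftrightarrow>
     (\<forall>x\<in>D. \<exists>N h. openin (zariski X) N \<and> x \<in> N \<and> h \<in> regular X N \<and> (\<forall>y\<in>N \<inter> D. g y = h y))"
  by (simp add: fsubspace_def)

lemma zariski_fsubspace [simp]: "zariski (fsubspace X S) = subtopology (zariski X) S"
  by (simp add: fsubspace_def)

lemma regular_fsubspaceE:
  assumes "g \<in> regular (fsubspace X S) D" "x \<in> D"
  obtains N h where "openin (zariski X) N" "x \<in> N" "h \<in> regular X N" "\<forall>y\<in>N \<inter> D. g y = h y"
  using assms unfolding regular_fsubspace by blast

lemma regular_fsubspaceI:
  "\<lbrakk>openin (zariski X) D; g \<in> regular X D; D' \<subseteq> D\<rbrakk> \<Longrightarrow> g \<in> regular (fsubspace X S) D'"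
  unfolding regular_fsubspace by blast

text \<open>Two functions may extend over different neighbourhoods; both are restricted to the
  intersection before being combined, and gluing likewise intersects the neighbourhood with that of
  the local representative.\<close>

lemma (in function_space) function_space_fsubspace: "function_space (fsubspace X S)"
proof
  fix D
  assume D: "openin (zariski (fsubspace X S)) D"
  then obtain T where T: "openin (zariski X) T" "D = T \<inter> S"
    by (auto simp: openin_subtopology)
  fix g
  show "(\<lambda>_. k) \<in> regular (fsubspace X S) D" for k
    using T regular_const[of T k] by (auto intro: regular_fsubspaceI)
  show "g \<in> regular (fsubspace X S) D"
    if loc: "\<And>x. x \<in> D \<Longrightarrow> \<exists>N h. openin (zariski (fsubspace X S)) N \<and> x \<in> N \<and> N \<subseteq> D
      \<and> h \<in> regular (fsubspace X S) N \<and> (\<forall>y\<in>N. g y = h y)"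
    unfolding regular_fsubspace
  proof
    fix x assume x: "x \<in> D"
    then obtain N h where N: "openin (zariski (fsubspace X S)) N" "x \<in> N" "N \<subseteq> D"
      and h: "h \<in> regular (fsubspace X S) N" "\<forall>y\<in>N. g y = h y"
      using loc[OF x] by blast
    obtain N' where N': "openin (zariski X) N'" "N = N' \<inter> S"
      using N by (auto simp: openin_subtopology)
    obtain N2 h2 where N2: "openin (zariski X) N2" "x \<in> N2" "h2 \<in> regular X N2"
      "\<forall>y\<in>N2 \<inter> N. h y = h2 y"
      by (rule regular_fsubspaceE[OF h(1) N(2)])
    have "openin (zariski X) (N' \<inter> N2)" "h2 \<in> regular X (N' \<inter> N2)"
      using N' N2 by (auto intro: regular_mono[of N2])
    moreover have "x \<in> N' \<inter> N2" "\<forall>y\<in>N' \<inter> N2 \<inter> D. g y = h2 y"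
      using N N' N2 h(2) T by auto
    ultimately show "\<exists>N h. openin (zariski X) N \<and> x \<in> N \<and> h \<in> regular X N
        \<and> (\<forall>y\<in>N \<inter> D. g y = h y)" by blast
  qed
  assume g: "g \<in> regular (fsubspace X S) D"
  show "openin (zariski (fsubspace X S)) {x \<in> D. g x \<noteq> 0}"
  proof (subst openin_subopen, intro ballI)
    fix x assume x: "x \<in> {x \<in> D. g x \<noteq> 0}"
    then have xD: "x \<in> D" by simp
    obtain N h where N: "openin (zariski X) N" "x \<in> N" "h \<in> regular X N"
      "\<forall>y\<in>N \<inter> D. g y = h y"
      by (rule regular_fsubspaceE[OF g xD])
    have "openin (zariski (fsubspace X S)) (({y \<in> N. h y \<noteq> 0} \<inter> T) \<inter> S)"
      using openin_nonzero[OF N(1,3)] T by (auto simp: openin_subtopology)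
    then show "\<exists>T. openin (zariski (fsubspace X S)) T \<and> x \<in> T \<and> T \<subseteq> {x \<in> D. g x \<noteq> 0}"
      using N T x by (intro exI[of _ "({y \<in> N. h y \<noteq> 0} \<inter> T) \<inter> S"]) auto
  qed
  show "(\<lambda>x. inverse (g x)) \<in> regular (fsubspace X S) {x \<in> D. g x \<noteq> 0}"
    unfolding regular_fsubspace
  proof
    fix x assume x: "x \<in> {x \<in> D. g x \<noteq> 0}"
    then have xD: "x \<in> D" by simp
    obtain N h where N: "openin (zariski X) N" "x \<in> N" "h \<in> regular X N"
      "\<forall>y\<in>N \<inter> D. g y = h y"
      by (rule regular_fsubspaceE[OF g xD])
    show "\<exists>N h. openin (zariski X) N \<and> x \<in> N \<and> h \<in> regular X N
        \<and> (\<forall>y\<in>N \<inter> {x \<in> D. g x \<noteq> 0}. inverse (g y) = h y)"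
      using openin_nonzero[OF N(1,3)] regular_inverse[OF N(1,3)] N x
      by (intro exI[of _ "{y \<in> N. h y \<noteq> 0}"] exI[of _ "\<lambda>y. inverse (h y)"]) auto
  qed
  show "g \<in> regular (fsubspace X S) D'"
    if "openin (zariski (fsubspace X S)) D'" and sub: "D' \<subseteq> D" for D'
    unfolding regular_fsubspace
  proof
    fix x assume "x \<in> D'"
    with sub have "x \<in> D" by blast
    then obtain N h where "openin (zariski X) N" "x \<in> N" "h \<in> regular X N"
      "\<forall>y\<in>N \<inter> D. g y = h y"
      by (rule regular_fsubspaceE[OF g])
    with sub show "\<exists>N h. openin (zariski X) N \<and> x \<in> N \<and> h \<in> regular X N
        \<and> (\<forall>y\<in>N \<inter> D'. g y = h y)" by blast
  qed
  fix h
  assume h: "h \<in> regular (fsubspace X S) D"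
  have "\<exists>N g' h'. openin (zariski X) N \<and> x \<in> N \<and> g' \<in> regular X N \<and> h' \<in> regular X N
      \<and> (\<forall>y\<in>N \<inter> D. g y = g' y \<and> h y = h' y)" if x: "x \<in> D" for x
  proof -
    obtain N g' where N: "openin (zariski X) N" "x \<in> N" "g' \<in> regular X N" "\<forall>y\<in>N \<inter> D. g y = g' y"
      by (rule regular_fsubspaceE[OF g x])
    obtain N2 h' where N2: "openin (zariski X) N2" "x \<in> N2" "h' \<in> regular X N2" "\<forall>y\<in>N2 \<inter> D. h y = h' y"
      by (rule regular_fsubspaceE[OF h x])
    have "openin (zariski X) (N \<inter> N2)" using N N2 by blast
    moreover from this have "g' \<in> regular X (N \<inter> N2)" "h' \<in> regular X (N \<inter> N2)"
      using N N2 regular_mono[of N "N \<inter> N2"] regular_mono[of N2 "N \<inter> N2"] by auto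
    ultimately show ?thesis
      using N N2 by (intro exI[of _ "N \<inter> N2"] exI[of _ g'] exI[of _ h']) auto
  qed
  note both = this
  show "(\<lambda>x. g x + h x) \<in> regular (fsubspace X S) D"
    unfolding regular_fsubspace
  proof
    fix x assume "x \<in> D"
    from both[OF this] obtain N g' h' where N: "openin (zariski X) N" "x \<in> N"
      "g' \<in> regular X N" "h' \<in> regular X N" "\<forall>y\<in>N \<inter> D. g y = g' y \<and> h y = h' y" by blast
    then show "\<exists>N f. openin (zariski X) N \<and> x \<in> N \<and> f \<in> regular X N
        \<and> (\<forall>y\<in>N \<inter> D. g y + h y = f y)"
      using regular_add[OF N(1,3,4)] by (intro exI[of _ N] exI[of _ "\<lambda>x. g' x + h' x"]) simp
  qed
  show "(\<lambda>x. g x * h x) \<in> regular (fsubspace X S) D"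
    unfolding regular_fsubspace
  proof
    fix x assume "x \<in> D"
    from both[OF this] obtain N g' h' where N: "openin (zariski X) N" "x \<in> N"
      "g' \<in> regular X N" "h' \<in> regular X N" "\<forall>y\<in>N \<inter> D. g y = g' y \<and> h y = h' y" by blast
    then show "\<exists>N f. openin (zariski X) N \<and> x \<in> N \<and> f \<in> regular X N
        \<and> (\<forall>y\<in>N \<inter> D. g y * h y = f y)"
      using regular_mult[OF N(1,3,4)] by (intro exI[of _ N] exI[of _ "\<lambda>x. g' x * h' x"]) simp
  qed
qed

section \<open>Morphisms: composition, quotient maps, subspaces and coordinate spaces as
  targets\<close>

lemma variety_morphism_openin:
  "\<lbrakk>variety_morphism X Y \<phi>; openin (zariski Y) D\<rbrakk> \<Longrightarrow> openin (zariski X) {x \<in> points X. \<phi> x \<in> D}"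
  by (simp add: variety_morphism_def continuous_map_def)

lemma variety_morphism_regular:
  "\<lbrakk>variety_morphism X Y \<phi>; openin (zariski Y) D; g \<in> regular Y D\<rbrakk>
    \<Longrightarrow> (\<lambda>x. g (\<phi> x)) \<in> regular X {x \<in> points X. \<phi> x \<in> D}"
  by (simp add: variety_morphism_def comp_def)

lemma variety_morphism_compose:
  assumes "variety_morphism X Y \<phi>" "variety_morphism Y Z \<psi>"
  shows "variety_morphism X Z (\<lambda>x. \<psi> (\<phi> x))"
  unfolding variety_morphism_def
proof (intro conjI allI impI)
  have 1: "continuous_map (zariski X) (zariski Y) \<phi>" "continuous_map (zariski Y) (zariski Z) \<psi>"
    using assms by (auto simp: variety_morphism_def)
  then show "continuous_map (zariski X) (zariski Z) (\<lambda>x. \<psi> (\<phi> x))"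
    using continuous_map_compose[OF 1] by (simp add: comp_def)
  fix D g assume D: "openin (zariski Z) D \<and> g \<in> regular Z D"
  have "openin (zariski Y) {y \<in> points Y. \<psi> y \<in> D}"
    using 1 D by (auto simp: continuous_map_def)
  moreover have "g \<circ> \<psi> \<in> regular Y {y \<in> points Y. \<psi> y \<in> D}"
    using D assms by (auto simp: variety_morphism_def)
  ultimately have "(g \<circ> \<psi>) \<circ> \<phi> \<in> regular X {x \<in> points X. \<phi> x \<in> {y \<in> points Y. \<psi> y \<in> D}}"
    using assms(1) unfolding variety_morphism_def by blast
  moreover have "{x \<in> points X. \<phi> x \<in> {y \<in> points Y. \<psi> y \<in> D}} = {x \<in> points X. \<psi> (\<phi> x) \<in> D}"
    using 1 by (auto simp: continuous_map_def)
  ultimately show "g \<circ> (\<lambda>x. \<psi> (\<phi> x)) \<in> regular X {x \<in> points X. \<psi> (\<phi> x) \<in> D}"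
    by (simp add: comp_def)
qed

lemma variety_morphism_fquotient: "variety_morphism X (fquotient \<pi> X) \<pi>"
proof -
  have "continuous_map (zariski X) (zariski (fquotient \<pi> X)) \<pi>"
    by (simp add: continuous_map_def points_fquotient openin_fquotient)
  then show ?thesis
    by (simp add: variety_morphism_def fquotient_def)
qed

text \<open>A regular function on the subspace extends to the ambient space only locally, so its
  pullback is regular on small open sets and is glued on the source by
  \<open>regular_local\<close>.\<close>

lemma (in function_space) variety_morphism_into_fsubspace:
  assumes \<phi>: "variety_morphism X Y \<phi>" and S: "\<phi> ` points X \<subseteq> S"
  shows "variety_morphism X (fsubspace Y S) \<phi>"
  unfolding variety_morphism_def
proof (intro conjI allI impI)
  have cont: "continuous_map (zariski X) (zariski Y) \<phi>"
    using \<phi> by (simp add: variety_morphism_def)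
  with S show cont': "continuous_map (zariski X) (zariski (fsubspace Y S)) \<phi>"
    by (simp add: continuous_map_in_subtopology image_subset_iff_funcset)
  fix D g assume D: "openin (zariski (fsubspace Y S)) D \<and> g \<in> regular (fsubspace Y S) D"
  let ?D = "{x \<in> points X. \<phi> x \<in> D}"
  have op: "openin (zariski X) ?D" using cont' D by (auto simp: continuous_map_def)
  show "g \<circ> \<phi> \<in> regular X ?D"
  proof (rule regular_local[OF op])
    fix x assume x: "x \<in> ?D"
    then obtain N h where N: "openin (zariski Y) N" "\<phi> x \<in> N" "h \<in> regular Y N"
      "\<forall>y\<in>N \<inter> D. g y = h y"
      using D unfolding regular_fsubspace by blast
    let ?N = "{x \<in> points X. \<phi> x \<in> N}"
    have "openin (zariski X) ?N" using cont N by (auto simp: continuous_map_def)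
    moreover have "h \<circ> \<phi> \<in> regular X ?N" using \<phi> N by (auto simp: variety_morphism_def)
    ultimately have "openin (zariski X) (?N \<inter> ?D)" "h \<circ> \<phi> \<in> regular X (?N \<inter> ?D)"
      using op regular_mono[of ?N "?N \<inter> ?D" "h \<circ> \<phi>"] by auto
    then show "\<exists>N h. openin (zariski X) N \<and> x \<in> N \<and> N \<subseteq> ?D \<and> h \<in> regular X N
        \<and> (\<forall>y\<in>N. (g \<circ> \<phi>) y = h y)"
      using N x by (intro exI[of _ "?N \<inter> ?D"] exI[of _ "h \<circ> \<phi>"]) auto
  qed
qed

lemma (in function_space) polynomial_function_comp_regular:
  assumes "p \<in> polynomial_functions C" "\<And>c. c \<in> C \<Longrightarrow> (\<lambda>x. c (\<phi> x)) \<in> regular X (points X)"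
  shows "(\<lambda>x. p (\<phi> x)) \<in> regular X (points X)"
  using assms by (induction) (auto intro: regular_const regular_add regular_mult)

text \<open>Polynomials in regular functions are regular, and a local fraction pulls back to a
  product with an inverse on the open set where the denominator does not vanish.\<close>

lemma (in function_space) variety_morphism_into_coordinate_space:
  assumes A: "\<phi> ` points X \<subseteq> A"
    and C: "\<And>c. c \<in> C \<Longrightarrow> (\<lambda>x. c (\<phi> x)) \<in> regular X (points X)"
  shows "variety_morphism X (coordinate_space A C) \<phi>"
proof -
  have poly: "(\<lambda>x. p (\<phi> x)) \<in> regular X (points X)" if "p \<in> polynomial_functions C" for p
    using polynomial_function_comp_regular[OF that C] .
  have nz: "openin (zariski X) {x \<in> points X. p (\<phi> x) \<noteq> 0}" if "p \<in> polynomial_functions C" for p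
    using openin_nonzero[OF _ poly[OF that]] by simp
  have op: "openin (zariski X) {x \<in> points X. \<phi> x \<in> D}"
    if D: "openin (zariski (coordinate_space A C)) D" for D
  proof (subst openin_subopen, intro ballI)
    fix x assume x: "x \<in> {x \<in> points X. \<phi> x \<in> D}"
    then obtain p where p: "p \<in> polynomial_functions C" "p (\<phi> x) \<noteq> 0" "{y \<in> A. p y \<noteq> 0} \<subseteq> D"
      using D unfolding openin_coordinate_space by blast
    then show "\<exists>T. openin (zariski X) T \<and> x \<in> T \<and> T \<subseteq> {x \<in> points X. \<phi> x \<in> D}"
      using nz[OF p(1)] A x by (intro exI[of _ "{x \<in> points X. p (\<phi> x) \<noteq> 0}"]) auto
  qed
  show ?thesis
    unfolding variety_morphism_def
  proof (intro conjI allI impI)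
    show "continuous_map (zariski X) (zariski (coordinate_space A C)) \<phi>"
      unfolding continuous_map_def using op A by auto
    fix D g
    assume D: "openin (zariski (coordinate_space A C)) D \<and> g \<in> regular (coordinate_space A C) D"
    let ?D = "{x \<in> points X. \<phi> x \<in> D}"
    have oD: "openin (zariski X) ?D" using D op by blast
    show "g \<circ> \<phi> \<in> regular X ?D"
    proof (rule regular_local[OF oD])
      fix x assume x: "x \<in> ?D"
      then obtain p q where 1: "p \<in> polynomial_functions C" "q \<in> polynomial_functions C"
        "q (\<phi> x) \<noteq> 0" "\<forall>y\<in>D. q y \<noteq> 0 \<longrightarrow> g y = p y / q y"
        using D unfolding regular_coordinate_space by blast
      let ?N0 = "{x \<in> points X. q (\<phi> x) \<noteq> 0}"
      have N0: "openin (zariski X) ?N0" using nz 1 by blast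
      have "(\<lambda>x. p (\<phi> x)) \<in> regular X ?N0"
        using regular_mono[OF _ N0 _ poly[OF 1(1)]] by auto
      moreover have "(\<lambda>x. inverse (q (\<phi> x))) \<in> regular X ?N0"
        using regular_inverse[OF _ poly[OF 1(2)]] by auto
      ultimately have "(\<lambda>x. p (\<phi> x) * inverse (q (\<phi> x))) \<in> regular X ?N0"
        using regular_mult[OF N0] by blast
      then have "(\<lambda>x. p (\<phi> x) * inverse (q (\<phi> x))) \<in> regular X (?N0 \<inter> ?D)"
        using regular_mono[OF N0, of "?N0 \<inter> ?D"] N0 oD by blast
      then show "\<exists>N h. openin (zariski X) N \<and> x \<in> N \<and> N \<subseteq> ?D \<and> h \<in> regular X N
          \<and> (\<forall>y\<in>N. (g \<circ> \<phi>) y = h y)"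
        using 1 N0 oD x
        by (intro exI[of _ "?N0 \<inter> ?D"] exI[of _ "\<lambda>x. p (\<phi> x) * inverse (q (\<phi> x))"])
          (auto simp: divide_inverse)
    qed
  qed
qed

section \<open>Polynomial dependence of determinants and adjugates on the matrix entries\<close>

lemma polynomial_functions_det:
  assumes "\<And>i j. i < n \<Longrightarrow> j < n \<Longrightarrow> (\<lambda>x. A x i j) \<in> polynomial_functions C"
  shows "(\<lambda>x. Determinant.det (Matrix.mat n n (\<lambda>(i, j). A x i j))) \<in> polynomial_functions C"
proof -
  have "(\<lambda>x. Determinant.det (Matrix.mat n n (\<lambda>(i, j). A x i j))) =
    (\<lambda>x. \<Sum>p\<in>{p. p permutes {0..<n}}. signof p * (\<Prod>i = 0..<n. A x i (p i)))"
  proof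
    fix x
    show "Determinant.det (Matrix.mat n n (\<lambda>(i, j). A x i j)) =
      (\<Sum>p\<in>{p. p permutes {0..<n}}. signof p * (\<Prod>i = 0..<n. A x i (p i)))"
      by (subst det_def'[of _ n]) (auto intro!: sum.cong prod.cong simp: permutes_in_image)
  qed
  moreover have "\<dots> \<in> polynomial_functions C"
    using assms
    by (intro polynomial_functions_sum polynomial_functions.mult polynomial_functions_prod
        polynomial_functions.const) (auto simp: permutes_in_image)
  ultimately show ?thesis by simp
qed

lemma polynomial_functions_adj_mat:
  assumes A: "\<And>i j. i < n \<Longrightarrow> j < n \<Longrightarrow> (\<lambda>x. A x i j) \<in> polynomial_functions C"
    and ij: "i < n" "j < n"
  shows "(\<lambda>x. adj_mat (Matrix.mat n n (\<lambda>(i, j). A x i j)) $$ (i, j)) \<in> polynomial_functions C"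
proof -
  \<comment> \<open>Renumbering that skips the deleted index. The adjugate entry
    \<open>(i, j)\<close> is a cofactor with row \<open>j\<close> and column \<open>i\<close>
    removed.\<close>
  let ?s = "\<lambda>k m::nat. if m < k then m else Suc m"
  have "(\<lambda>x. adj_mat (Matrix.mat n n (\<lambda>(i, j). A x i j)) $$ (i, j)) =
    (\<lambda>x. (-1) ^ (j + i) *
      Determinant.det (Matrix.mat (n - 1) (n - 1) (\<lambda>(i', j'). A x (?s j i') (?s i j'))))"
    using ij by (intro ext) (auto simp: adj_mat_def cofactor_def mat_delete_def
        intro!: arg_cong[where f = Determinant.det] eq_matI)
  moreover have "\<dots> \<in> polynomial_functions C"
    by (intro polynomial_functions.mult polynomial_functions.const polynomial_functions_det A) auto
  ultimately show ?thesis by simp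
qed

section \<open>Coordinates on subspaces\<close>

locale quiver_representation_basis = quiver_representation Q scale V f
  for Q :: "('i, 'a) pre_digraph"
    and scale :: "complex \<Rightarrow> 'v::ab_group_add \<Rightarrow> 'v"
    and V :: "'i \<Rightarrow> 'v set"
    and f :: "'a \<Rightarrow> 'v \<Rightarrow> 'v" +
  fixes b :: "'i \<Rightarrow> nat \<Rightarrow> 'v"
  assumes indexed_basis: "indexed_basis b"
begin

abbreviation c :: "'i \<Rightarrow> 'v \<Rightarrow> nat \<Rightarrow> complex" where
  "c \<equiv> coefficient b"

lemma finite_basis_index [simp]: "finite (basis_index i)"
  by (simp add: basis_index_def)

context
  fixes i
  assumes i: "i \<in> verts Q"
begin

lemma basis_facts:
  shows inj_b: "inj_on (b i) (basis_index i)"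
    and independent_b: "independent (b i ` basis_index i)"
    and span_b: "span (b i ` basis_index i) = V i"
  using indexed_basis i by (auto simp: indexed_basis_def)

lemma b_in_V: "k \<in> basis_index i \<Longrightarrow> b i k \<in> V i"
  using span_base[of "b i k" "b i ` basis_index i"] by (simp add: span_b)

lemma b_nonzero: "k \<in> basis_index i \<Longrightarrow> b i k \<noteq> 0"
  using independent_b dependent_zero[of "b i ` basis_index i"] by force

lemma V_closed:
  shows zero_in_V: "0 \<in> V i"
    and add_in_V: "\<lbrakk>x \<in> V i; y \<in> V i\<rbrakk> \<Longrightarrow> x + y \<in> V i"
    and scale_in_V: "x \<in> V i \<Longrightarrow> scale r x \<in> V i"
    and sum_in_V: "(\<And>j. j \<in> J \<Longrightarrow> g j \<in> V i) \<Longrightarrow> (\<Sum>j\<in>J. g j) \<in> V i"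
  using subspace_V[OF i] by (auto intro: subspace_0 subspace_add subspace_scale subspace_sum)

lemma c_add: "\<lbrakk>x \<in> V i; y \<in> V i\<rbrakk> \<Longrightarrow> c i (x + y) k = c i x k + c i y k"
  using representation_add[OF independent_b] by (simp add: coefficient_def span_b)

lemma c_scale: "x \<in> V i \<Longrightarrow> c i (scale r x) k = r * c i x k"
  using representation_scale[OF independent_b] by (simp add: coefficient_def span_b)

lemma c_zero [simp]: "c i 0 k = 0"
  by (simp add: coefficient_def representation_zero)

lemma c_sum: "(\<And>j. j \<in> J \<Longrightarrow> g j \<in> V i) \<Longrightarrow> c i (\<Sum>j\<in>J. g j) k = (\<Sum>j\<in>J. c i (g j) k)"
  using representation_sum[OF independent_b, of J g] by (simp add: coefficient_def span_b)

lemma c_lincomb: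
  assumes "\<And>j. j \<in> J \<Longrightarrow> g j \<in> V i"
  shows "c i (\<Sum>j\<in>J. scale (r j) (g j)) k = (\<Sum>j\<in>J. r j * c i (g j) k)"
  using assms by (simp add: c_sum scale_in_V c_scale)

lemma c_basis:
  assumes "k \<in> basis_index i" "l \<in> basis_index i"
  shows "c i (b i l) k = (if k = l then 1 else 0)"
  using representation_basis[OF independent_b, of "b i l"] assms inj_b
  by (auto simp: coefficient_def inj_on_def)

lemma c_basis_sum:
  assumes "J \<subseteq> basis_index i" "k \<in> basis_index i"
  shows "c i (\<Sum>l\<in>J. scale (r l) (b i l)) k = (if k \<in> J then r k else 0)"
proof -
  have "finite J" using finite_subset[OF assms(1)] by simp
  have "c i (\<Sum>l\<in>J. scale (r l) (b i l)) k = (\<Sum>l\<in>J. r l * c i (b i l) k)"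
    using assms b_in_V by (intro c_lincomb) auto
  also have "\<dots> = (\<Sum>l\<in>J. if k = l then r l else 0)"
    using assms by (intro sum.cong) (auto simp: c_basis)
  finally show ?thesis using \<open>finite J\<close> by simp
qed

lemma basis_expansion:
  assumes "x \<in> V i"
  shows "x = (\<Sum>k\<in>basis_index i. scale (c i x k) (b i k))"
proof -
  have "(\<Sum>v\<in>b i ` basis_index i. scale (representation (b i ` basis_index i) x v) v) = x"
    using assms by (intro sum_representation_eq independent_b) (auto simp: span_b)
  then show ?thesis
    by (simp add: coefficient_def sum.reindex[OF inj_b] comp_def)
qed

lemma c_eqI:
  assumes "x \<in> V i" "y \<in> V i" "\<And>k. k \<in> basis_index i \<Longrightarrow> c i x k = c i y k"
  shows "x = y"
proof -
  have "(\<Sum>k\<in>basis_index i. scale (c i x k) (b i k)) = (\<Sum>k\<in>basis_index i. scale (c i y k) (b i k))"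
    using assms(3) by (intro sum.cong) auto
  then show ?thesis
    using basis_expansion[OF assms(1)] basis_expansion[OF assms(2)] by simp
qed

end

text \<open>
  The regular functions on the variety of frames are built from linear functionals on the whole
  ambient space, so the coordinates on \<open>V i\<close> have to be extended to it.
\<close>

definition dual :: "'i \<Rightarrow> nat \<Rightarrow> 'v \<Rightarrow> complex" where
  "dual i k x = representation (extend_basis (b i ` basis_index i)) x (b i k)"

lemma linear_dual: "i \<in> verts Q \<Longrightarrow> Vector_Spaces.linear scale (*) (dual i k)"
  unfolding dual_def
  by (intro linear_representation independent_extend_basis span_extend_basis independent_b)

lemma dual_eq: "\<lbrakk>i \<in> verts Q; x \<in> V i\<rbrakk> \<Longrightarrow> dual i k x = c i x k"
  unfolding dual_def coefficient_def
  by (subst representation_extend[of _ _ "b i ` basis_index i"])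
    (auto simp: independent_b independent_extend_basis extend_basis_superset span_b
      intro!: extend_basis_superset)

section \<open>Finite indexed families: spans, relations and independence\<close>

lemma span_image_eq:
  assumes "finite J"
  shows "span (w ` J) = range (\<lambda>r. \<Sum>k\<in>J. scale (r k) (w k))"
proof
  have "subspace (range (\<lambda>r. \<Sum>k\<in>J. scale (r k) (w k)))"
  proof (rule subspaceI)
    show "0 \<in> range (\<lambda>r. \<Sum>k\<in>J. scale (r k) (w k))"
      by (rule range_eqI[of _ _ "\<lambda>_. 0"]) simp
    fix x y assume "x \<in> range (\<lambda>r. \<Sum>k\<in>J. scale (r k) (w k))" "y \<in> range (\<lambda>r. \<Sum>k\<in>J. scale (r k) (w k))"
    then obtain r s where "x = (\<Sum>k\<in>J. scale (r k) (w k))" "y = (\<Sum>k\<in>J. scale (s k) (w k))" by blast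
    then show "x + y \<in> range (\<lambda>r. \<Sum>k\<in>J. scale (r k) (w k))"
      by (intro range_eqI[of _ _ "\<lambda>k. r k + s k"]) (simp add: scale_left_distrib sum.distrib)
  next
    fix a x assume "x \<in> range (\<lambda>r. \<Sum>k\<in>J. scale (r k) (w k))"
    then obtain r where "x = (\<Sum>k\<in>J. scale (r k) (w k))" by blast
    then show "scale a x \<in> range (\<lambda>r. \<Sum>k\<in>J. scale (r k) (w k))"
      by (intro range_eqI[of _ _ "\<lambda>k. a * r k"]) (simp add: scale_sum_right)
  qed
  moreover have "w k \<in> range (\<lambda>r. \<Sum>k\<in>J. scale (r k) (w k))" if "k \<in> J" for k
  proof (rule range_eqI[of _ _ "\<lambda>l. if l = k then 1 else 0"])
    show "w k = (\<Sum>l\<in>J. scale (if l = k then 1 else 0) (w l))"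
      using assms that by (subst sum.remove[of _ k]) (auto intro!: sum.neutral)
  qed
  ultimately show "span (w ` J) \<subseteq> range (\<lambda>r. \<Sum>k\<in>J. scale (r k) (w k))"
    by (intro span_minimal) auto
  show "range (\<lambda>r. \<Sum>k\<in>J. scale (r k) (w k)) \<subseteq> span (w ` J)"
    by (rule image_subsetI) (intro span_sum span_scale span_base imageI)
qed

text \<open>A family indexed by \<open>J\<close>, unlike its image set, can repeat a vector; the
  triviality of all relations excludes this too.\<close>

lemma independent_family:
  assumes "finite J" "\<And>r. (\<Sum>k\<in>J. scale (r k) (w k)) = 0 \<Longrightarrow> \<forall>k\<in>J. r k = 0"
  shows "inj_on w J" "independent (w ` J)"
proof -
  show inj: "inj_on w J"
  proof (rule inj_onI, rule ccontr)
    fix k l assume kl: "k \<in> J" "l \<in> J" "w k = w l" "k \<noteq> l"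
    \<comment> \<open>Two equal members would satisfy the relation with coefficients 1 and
      -1.\<close>
    let ?r = "\<lambda>m. if m = k then 1 else if m = l then - 1 else 0"
    have "(\<Sum>m\<in>J. scale (?r m) (w m)) =
        scale (?r k) (w k) + (scale (?r l) (w l) + (\<Sum>m\<in>J - {k} - {l}. scale (?r m) (w m)))"
      using assms(1) kl by (simp add: sum.remove[of J k] sum.remove[of "J - {k}" l])
    also have "(\<Sum>m\<in>J - {k} - {l}. scale (?r m) (w m)) = 0" by (intro sum.neutral) auto
    finally have "(\<Sum>m\<in>J. scale (?r m) (w m)) = 0" using kl by simp
    then show False using assms(2) kl(1) by fastforce
  qed
  show "independent (w ` J)"
  proof (rule independent_if_scalars_zero)
    fix r x assume "(\<Sum>x\<in>w ` J. scale (r x) x) = 0" "x \<in> w ` J"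
    then show "r x = 0" using assms(2)[of "r \<circ> w"] by (auto simp: sum.reindex[OF inj])
  qed (use assms in simp)
qed

lemma independent_family_zero:
  assumes "finite J" "inj_on w J" "independent (w ` J)" "(\<Sum>k\<in>J. scale (r k) (w k)) = 0" "k \<in> J"
  shows "r k = 0"
proof -
  have "(\<Sum>x\<in>w ` J. scale (r (the_inv_into J w x)) x) = 0"
    using assms by (simp add: sum.reindex the_inv_into_f_f)
  then have "r (the_inv_into J w (w k)) = 0"
    using assms by (intro independentD[of "w ` J" "w ` J"]) auto
  then show ?thesis using assms by (simp add: the_inv_into_f_f)
qed

subsection \<open>Reduced bases\<close>

text \<open>The standard open piece of the Grassmannian on which projecting \<open>U\<close> to the
  coordinates in \<open>J\<close> is bijective. The last two conjuncts are surjectivity, tested on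
  unit vectors, and injectivity.\<close>

definition chart :: "'i \<Rightarrow> nat set \<Rightarrow> 'v set \<Rightarrow> bool" where
  "chart i J U \<longleftrightarrow> subspace U \<and> U \<subseteq> V i \<and>
     (\<forall>k\<in>J. \<exists>x\<in>U. \<forall>l\<in>J. c i x l = (if l = k then 1 else 0)) \<and>
     (\<forall>x\<in>U. (\<forall>k\<in>J. c i x k = 0) \<longrightarrow> x = 0)"

text \<open>The preimage of the unit vector at \<open>k\<close> under this projection. The
  description is meaningful because \<open>chart i J U\<close> gives existence and uniqueness for
  \<open>k\<close> in \<open>J\<close>.\<close>

definition reduced :: "'i \<Rightarrow> nat set \<Rightarrow> 'v set \<Rightarrow> nat \<Rightarrow> 'v" where
  "reduced i J U k = (THE x. x \<in> U \<and> (\<forall>l\<in>J. c i x l = (if l = k then 1 else 0)))"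

definition lead :: "'i \<Rightarrow> nat \<Rightarrow> 'v \<Rightarrow> bool" where
  "lead i k x \<longleftrightarrow> x \<in> V i \<and> k \<in> basis_index i \<and> c i x k \<noteq> 0 \<and>
     (\<forall>l\<in>basis_index i. l < k \<longrightarrow> c i x l = 0)"

definition pivots :: "'i \<Rightarrow> 'v set \<Rightarrow> nat set" where
  "pivots i U = {k. \<exists>x\<in>U. lead i k x}"

lemma pivots_subset: "pivots i U \<subseteq> basis_index i"
  by (auto simp: pivots_def lead_def)

lemma finite_pivots [simp]: "finite (pivots i U)"
  by (rule finite_subset[OF pivots_subset finite_basis_index])

lemma lead_unique: "\<lbrakk>lead i k x; lead i l x\<rbrakk> \<Longrightarrow> k = l"
  unfolding lead_def by (metis linorder_neqE_nat)

context
  fixes i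
  assumes i: "i \<in> verts Q"
begin

lemma lead_exists:
  assumes "x \<in> V i" "x \<noteq> 0"
  shows "\<exists>k. lead i k x"
proof -
  define k where "k = (LEAST k. k \<in> basis_index i \<and> c i x k \<noteq> 0)"
  have "\<exists>k. k \<in> basis_index i \<and> c i x k \<noteq> 0"
    using c_eqI[OF i assms(1) zero_in_V[OF i]] assms(2) i by auto
  then have "k \<in> basis_index i \<and> c i x k \<noteq> 0"
    unfolding k_def by (rule LeastI_ex)
  moreover have "c i x l = 0" if "l \<in> basis_index i" "l < k" for l
    using that not_less_Least unfolding k_def by blast
  ultimately show ?thesis using assms unfolding lead_def by blast
qed

lemma chart_eqI:
  assumes "chart i J U" "x \<in> U" "y \<in> U" "\<And>k. k \<in> J \<Longrightarrow> c i x k = c i y k"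
  shows "x = y"
proof -
  have V: "x \<in> V i" "y \<in> V i" and sub: "subspace U" using assms by (auto simp: chart_def)
  have "x + scale (- 1) y \<in> U"
    using assms sub by (intro subspace_add subspace_scale)
  moreover have "\<forall>k\<in>J. c i (x + scale (- 1) y) k = 0"
    using V i assms(4) by (simp only: c_add scale_in_V c_scale) simp
  ultimately have "x + scale (- 1) y = 0"
    using assms(1) unfolding chart_def by blast
  then show ?thesis by (simp add: add_eq_0_iff2)
qed

lemma reduced_props:
  assumes "chart i J U" "k \<in> J"
  shows "reduced i J U k \<in> U" "\<And>l. l \<in> J \<Longrightarrow> c i (reduced i J U k) l = (if l = k then 1 else 0)"
proof -
  obtain x where x: "x \<in> U" "\<forall>l\<in>J. c i x l = (if l = k then 1 else 0)"
    using assms unfolding chart_def by blast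
  have "reduced i J U k = x"
    unfolding reduced_def
  proof (rule the_equality)
    fix y assume "y \<in> U \<and> (\<forall>l\<in>J. c i y l = (if l = k then 1 else 0))"
    then show "y = x" using chart_eqI[OF assms(1) _ x(1)] x(2) by simp
  qed (use x in simp)
  with x show "reduced i J U k \<in> U"
    and "\<And>l. l \<in> J \<Longrightarrow> c i (reduced i J U k) l = (if l = k then 1 else 0)" by auto
qed

lemma reduced_in_V: "\<lbrakk>chart i J U; k \<in> J\<rbrakk> \<Longrightarrow> reduced i J U k \<in> V i"
  using reduced_props(1) by (auto simp: chart_def)

lemma reduced_eqI:
  assumes "chart i J U" "k \<in> J" "x \<in> U" "\<And>l. l \<in> J \<Longrightarrow> c i x l = (if l = k then 1 else 0)"
  shows "reduced i J U k = x"
  using assms reduced_props[OF assms(1,2)] by (intro chart_eqI[OF assms(1)]) auto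

lemma c_reduced_sum:
  assumes "chart i J U" "finite J" "l \<in> J"
  shows "c i (\<Sum>k\<in>J. scale (r k) (reduced i J U k)) l = r l"
proof -
  have "c i (\<Sum>k\<in>J. scale (r k) (reduced i J U k)) l = (\<Sum>k\<in>J. r k * c i (reduced i J U k) l)"
    using assms reduced_in_V by (intro c_lincomb i)
  also have "\<dots> = (\<Sum>k\<in>J. if l = k then r k else 0)"
    using assms by (intro sum.cong) (auto simp: reduced_props)
  finally show ?thesis using assms by simp
qed

lemma chart_expansion:
  assumes "chart i J U" "finite J" "x \<in> U"
  shows "x = (\<Sum>k\<in>J. scale (c i x k) (reduced i J U k))"
proof (rule chart_eqI[OF assms(1,3)])
  show "(\<Sum>k\<in>J. scale (c i x k) (reduced i J U k)) \<in> U"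
    using assms reduced_props(1)[OF assms(1)]
    by (intro subspace_sum subspace_scale) (auto simp: chart_def)
qed (use c_reduced_sum[OF assms(1,2)] in simp)

lemma chart_span:
  assumes "chart i J U" "finite J"
  shows "U = span (reduced i J U ` J)"
proof
  show "U \<subseteq> span (reduced i J U ` J)"
    using chart_expansion[OF assms] unfolding span_image_eq[OF assms(2)] by blast
  show "span (reduced i J U ` J) \<subseteq> U"
    using assms reduced_props(1)[OF assms(1)] by (intro span_minimal) (auto simp: chart_def)
qed

lemma chart_dim:
  assumes "chart i J U" "finite J"
  shows "dim U = card J"
proof -
  have "\<forall>k\<in>J. r k = 0" if "(\<Sum>k\<in>J. scale (r k) (reduced i J U k)) = 0" for r
    using c_reduced_sum[OF assms, of _ r] that i by simp
  from independent_family[OF assms(2) this]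
  have "inj_on (reduced i J U) J" "independent (reduced i J U ` J)" by blast+
  then show ?thesis
    using chart_span[OF assms] dim_span_eq_card_independent card_image by metis
qed

text \<open>The reduced vectors of \<open>U\<close> lie in \<open>U'\<close> and satisfy the
  normalisation that characterises the reduced vectors of \<open>U'\<close>, so both bases
  agree.\<close>

lemma chart_subset_eq:
  assumes "chart i J U" "chart i J U'" "finite J" "U \<subseteq> U'"
  shows "U = U'"
proof -
  have "reduced i J U k = reduced i J U' k" if "k \<in> J" for k
    using assms reduced_props[OF assms(1) that] that reduced_eqI[OF assms(2) that] by auto
  then have "reduced i J U ` J = reduced i J U' ` J" by (rule image_cong[OF refl])
  then show ?thesis using chart_span assms by metis
qed

text \<open>Among the vectors with non-zero coefficient, the one of least pivot \<open>m\<close>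
  alone contributes at index \<open>m\<close>, and none contributes before \<open>m\<close>.\<close>

lemma lead_lincomb:
  assumes J: "finite J" and lead: "\<And>k. k \<in> J \<Longrightarrow> lead i k (y k)"
    and r: "k \<in> J" "r k \<noteq> 0"
  shows "\<exists>m\<in>J. lead i m (\<Sum>k\<in>J. scale (r k) (y k))"
proof -
  let ?x = "\<Sum>k\<in>J. scale (r k) (y k)"
  define m where "m = Min {k \<in> J. r k \<noteq> 0}"
  have ne: "finite {k \<in> J. r k \<noteq> 0}" "{k \<in> J. r k \<noteq> 0} \<noteq> {}" using J r by auto
  then have m: "m \<in> J" "r m \<noteq> 0" using Min_in[OF ne] unfolding m_def by auto
  have less: "r k = 0" if "k \<in> J" "k < m" for k
  proof (rule ccontr)
    assume "r k \<noteq> 0"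
    with that have "m \<le> k" unfolding m_def by (intro Min_le ne) auto
    with that show False by simp
  qed
  have V: "y k \<in> V i" if "k \<in> J" for k using lead[OF that] by (simp add: lead_def)
  have cx: "c i ?x l = (\<Sum>k\<in>J. r k * c i (y k) l)" for l
    using V by (intro c_lincomb i)
  have term0: "r k * c i (y k) l = 0" if "k \<in> J" "l \<in> basis_index i" "l < m \<or> l = m \<and> k \<noteq> m" for k l
  proof (cases "k < m")
    case True
    then show ?thesis using less that by simp
  next
    case False
    with that have "l < k" by auto
    then show ?thesis using lead[OF that(1)] that by (simp add: lead_def)
  qed
  have mB: "m \<in> basis_index i" using lead[OF m(1)] by (simp add: lead_def)
  have "c i ?x m = r m * c i (y m) m + (\<Sum>k\<in>J - {m}. r k * c i (y k) m)"
    unfolding cx using J m(1) by (rule sum.remove)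
  also have "(\<Sum>k\<in>J - {m}. r k * c i (y k) m) = 0"
  proof (intro sum.neutral ballI)
    fix k assume "k \<in> J - {m}"
    then show "r k * c i (y k) m = 0" using mB by (intro term0) auto
  qed
  finally have "c i ?x m \<noteq> 0" using m lead[OF m(1)] by (simp add: lead_def)
  moreover have "c i ?x l = 0" if "l \<in> basis_index i" "l < m" for l
    unfolding cx using that by (intro sum.neutral ballI term0) auto
  moreover have "?x \<in> V i" using V i by (intro sum_in_V scale_in_V)
  ultimately show ?thesis using mB m unfolding lead_def by blast
qed

text \<open>The zero vector has no pivot, so by \<open>lead_lincomb\<close> a vanishing combination
  has zero coefficients, and every non-zero element of the span has its pivot in
  \<open>J\<close>.\<close>

lemma lead_family:
  assumes J: "finite J" and lead: "\<And>k. k \<in> J \<Longrightarrow> lead i k (y k)"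
  shows "inj_on y J" "independent (y ` J)" "pivots i (span (y ` J)) = J"
proof -
  have not0: "\<not> lead i m 0" for m using i by (simp add: lead_def)
  have "\<forall>k\<in>J. r k = 0" if "(\<Sum>k\<in>J. scale (r k) (y k)) = 0" for r
    using lead_lincomb[OF J lead, of _ r] that not0 by auto
  from independent_family[OF J this]
  show "inj_on y J" "independent (y ` J)" by blast+
  show "pivots i (span (y ` J)) = J"
  proof
    show "J \<subseteq> pivots i (span (y ` J))"
      using lead by (auto simp: pivots_def intro: span_base)
    show "pivots i (span (y ` J)) \<subseteq> J"
    proof
      fix l assume "l \<in> pivots i (span (y ` J))"
      then obtain r where r: "lead i l (\<Sum>k\<in>J. scale (r k) (y k))"
        unfolding pivots_def span_image_eq[OF J] by blast
      then obtain k where "k \<in> J" "r k \<noteq> 0"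
        using not0 by (metis (mono_tags, lifting) scale_zero_left sum.neutral)
      then obtain m where "m \<in> J" "lead i m (\<Sum>k\<in>J. scale (r k) (y k))"
        using lead_lincomb[OF J lead, of k r] by blast
      with r show "l \<in> J" using lead_unique by blast
    qed
  qed
qed

text \<open>Existence of the reduced echelon form. The projection is injective since a non-zero
  vector has a non-zero coefficient at its own pivot; the normalised vectors come from
  elimination.\<close>

lemma chart_pivots:
  assumes U: "subspace U" "U \<subseteq> V i"
  shows "chart i (pivots i U) U"
  unfolding chart_def
proof (intro conjI ballI impI)
  fix x assume x: "x \<in> U" "\<forall>k\<in>pivots i U. c i x k = 0"
  show "x = 0"
  proof (rule ccontr)
    assume "x \<noteq> 0"
    then obtain k where "lead i k x" using lead_exists x U by blast
    then show False using x by (auto simp: pivots_def lead_def)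
  qed
next
  fix k assume "k \<in> pivots i U"
  \<comment> \<open>Elimination runs from the largest pivot downwards: the vectors for later pivots
    are already reduced, so subtracting them clears later pivot entries without creating new ones.
    The claim also records their pivots, which shows that entries up to \<open>k\<close> stay
    unchanged.\<close>
  moreover have "k \<in> pivots i U \<Longrightarrow> \<exists>x\<in>U. lead i k x \<and> (\<forall>l\<in>pivots i U. c i x l = (if l = k then 1 else 0))"
  proof (induction "dim (V i) - k" arbitrary: k rule: less_induct)
    case less
    let ?P = "pivots i U \<inter> {k<..}"
    obtain v0 where v0: "v0 \<in> U" "lead i k v0" using less.prems by (auto simp: pivots_def)
    define v where "v = scale (inverse (c i v0 k)) v0"
    have v0V: "v0 \<in> V i" using v0 U by auto
    have v: "v \<in> U" "c i v k = 1" "\<And>l. l \<in> basis_index i \<Longrightarrow> l < k \<Longrightarrow> c i v l = 0"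
      using v0 U v0V i by (auto simp: v_def subspace_scale c_scale lead_def)
    have "\<exists>x\<in>U. lead i l x \<and> (\<forall>m\<in>pivots i U. c i x m = (if m = l then 1 else 0))"
      if "l \<in> ?P" for l
    proof (rule less.hyps)
      show "dim (V i) - l < dim (V i) - k"
        using that pivots_subset[of i U] by (auto simp: basis_index_def)
    qed (use that in simp)
    then obtain w where w: "\<And>l. l \<in> ?P \<Longrightarrow> w l \<in> U" "\<And>l. l \<in> ?P \<Longrightarrow> lead i l (w l)"
      "\<And>l m. \<lbrakk>l \<in> ?P; m \<in> pivots i U\<rbrakk> \<Longrightarrow> c i (w l) m = (if m = l then 1 else 0)"
      by metis
    define x where "x = v + (\<Sum>l\<in>?P. scale (- c i v l) (w l))"
    have wV: "w l \<in> V i" if "l \<in> ?P" for l using w(1)[OF that] U by auto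
    have sV: "(\<Sum>l\<in>?P. scale (- c i v l) (w l)) \<in> V i"
      using wV i by (intro sum_in_V scale_in_V)
    have cx: "c i x m = c i v m + (\<Sum>l\<in>?P. - c i v l * c i (w l) m)" for m
    proof -
      have "c i (\<Sum>l\<in>?P. scale (- c i v l) (w l)) m = (\<Sum>l\<in>?P. - c i v l * c i (w l) m)"
        using wV by (intro c_lincomb i)
      moreover have "v \<in> V i" using v U by blast
      ultimately show ?thesis
        unfolding x_def using sV by (simp only: c_add[OF i])
    qed
    have "x \<in> U"
      unfolding x_def using v w U by (intro subspace_add subspace_sum subspace_scale)
    have kB: "k \<in> basis_index i" using v0 by (simp add: lead_def)
    have low: "c i x m = c i v m" if "m \<in> basis_index i" "m \<le> k" for m
    proof -
      have "(\<Sum>l\<in>?P. - c i v l * c i (w l) m) = 0"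
        using that w(2) by (intro sum.neutral) (auto simp: lead_def)
      then show ?thesis by (simp add: cx)
    qed
    have "lead i k x"
      using \<open>x \<in> U\<close> U kB low v by (auto simp: lead_def)
    moreover have "c i x m = (if m = k then 1 else 0)" if m: "m \<in> pivots i U" for m
    proof (cases "m \<le> k")
      case True
      then show ?thesis using low[of m] v m pivots_subset[of i U] by (cases "m = k") auto
    next
      case False
      then have mP: "m \<in> ?P" using m by simp
      have "(\<Sum>l\<in>?P. - c i v l * c i (w l) m) = (\<Sum>l\<in>?P. if m = l then - c i v l else 0)"
        using w(3) m by (intro sum.cong) auto
      also have "\<dots> = - c i v m" using mP by (simp add: sum.delta)
      finally show ?thesis using False by (simp add: cx)
    qed
    ultimately show ?case using \<open>x \<in> U\<close> by blast
  qed
  ultimately show "\<exists>x\<in>U. \<forall>l\<in>pivots i U. c i x l = (if l = k then 1 else 0)" by blast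
qed (use U in auto)

lemma dim_eq_card_pivots: "\<lbrakk>subspace U; U \<subseteq> V i\<rbrakk> \<Longrightarrow> dim U = card (pivots i U)"
  using chart_dim[OF chart_pivots] by simp

text \<open>The pivot of this vector is again a pivot of \<open>U\<close>, and among the pivots of
  \<open>U\<close> its only non-zero coefficient is at \<open>k\<close>.\<close>

lemma lead_reduced_pivots:
  assumes "subspace U" "U \<subseteq> V i" "k \<in> pivots i U"
  shows "lead i k (reduced i (pivots i U) U k)"
proof -
  let ?w = "reduced i (pivots i U) U k"
  note w = reduced_props[OF chart_pivots[OF assms(1,2)] assms(3)]
  have "?w \<noteq> 0" using w(2)[OF assms(3)] i by auto
  then obtain m where m: "lead i m ?w" using lead_exists w(1) assms by blast
  then have "m \<in> pivots i U" using w(1) by (auto simp: pivots_def)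
  with w(2) m have "m = k" by (auto simp: lead_def split: if_splits)
  with m show ?thesis by simp
qed

text \<open>A larger weight means lexicographically smaller as an increasing sequence.\<close>

definition weight :: "nat set \<Rightarrow> nat" where
  "weight J = (\<Sum>k\<in>J. 2 ^ (dim (V i) - k))"

text \<open>The weight is a binary number: the digit at the first place of difference outweighs all
  later digits together.\<close>

lemma weight_less:
  assumes "I \<subseteq> basis_index i" "J \<subseteq> basis_index i" "k \<in> I" "k \<notin> J"
    and "\<And>l. l < k \<Longrightarrow> l \<in> I \<longleftrightarrow> l \<in> J"
  shows "weight J < weight I"
proof -
  let ?m = "dim (V i)" and ?e = "\<lambda>l. 2 ^ (dim (V i) - l) :: nat"
  have fin: "finite I" "finite J" using assms finite_subset finite_basis_index by blast+
  have km: "k \<le> ?m" using assms by (auto simp: basis_index_def)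
  \<comment> \<open>Value of all digits after position \<open>m\<close> set to 1, in a form suited
    to induction on their number \<open>n\<close>.\<close>
  have geo: "(\<Sum>l\<in>{m<..m + n}. 2 ^ (m + n - l)) < (2::nat) ^ n" for m n
  proof (induction n arbitrary: m)
    case (Suc n)
    have "{m<..m + Suc n} = insert (Suc m) {Suc m<..Suc m + n}" by auto
    then show ?case using Suc[of "Suc m"] by simp
  qed simp
  have "(\<Sum>l\<in>J \<inter> {k<..}. ?e l) \<le> (\<Sum>l\<in>{k<..?m}. ?e l)"
    using assms(2) by (intro sum_mono2) (auto simp: basis_index_def)
  also have "\<dots> < ?e k" using geo[of k "?m - k"] km by simp
  finally have 1: "(\<Sum>l\<in>J \<inter> {k<..}. ?e l) < ?e k" .
  have "J = (J \<inter> {..<k}) \<union> (J \<inter> {k<..})" using assms(4) by (auto simp: not_less_iff_gr_or_eq)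
  then have "weight J = (\<Sum>l\<in>J \<inter> {..<k}. ?e l) + (\<Sum>l\<in>J \<inter> {k<..}. ?e l)"
    unfolding weight_def using fin by (metis (no_types, lifting) sum.union_disjoint finite_Int
      disjoint_iff IntE greaterThan_iff lessThan_iff less_asym)
  also have "\<dots> < (\<Sum>l\<in>J \<inter> {..<k}. ?e l) + ?e k" using 1 by simp
  also have "J \<inter> {..<k} = I \<inter> {..<k}" using assms(5) by auto
  also have "(\<Sum>l\<in>I \<inter> {..<k}. ?e l) + ?e k = (\<Sum>l\<in>insert k (I \<inter> {..<k}). ?e l)"
    using fin by simp
  also have "\<dots> \<le> weight I"
    unfolding weight_def using fin assms(3) by (intro sum_mono2) auto
  finally show ?thesis .
qed

text \<open>The pivot set is the lexicographically first index set whose chart contains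
  \<open>U\<close>. If the first difference \<open>k\<close> lay in \<open>J\<close>, the reduced
  vector at \<open>k\<close> would have an earlier element of \<open>J\<close> as pivot, where its
  coefficient is prescribed to be zero.\<close>

lemma chart_weight:
  assumes chart: "chart i J U" and J: "J \<subseteq> basis_index i" and ne: "pivots i U \<noteq> J"
  shows "weight J < weight (pivots i U)"
proof -
  let ?I = "pivots i U"
  let ?P = "\<lambda>k. (k \<in> ?I) \<noteq> (k \<in> J)"
  define k where "k = (LEAST k. ?P k)"
  have "\<exists>k. ?P k" using ne by auto
  then have k: "?P k" unfolding k_def by (rule LeastI_ex)
  have less: "l \<in> ?I \<longleftrightarrow> l \<in> J" if "l < k" for l
    using not_less_Least[of l ?P] that unfolding k_def by blast
  have "k \<notin> J"
  proof
    assume kJ: "k \<in> J"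
    let ?w = "reduced i J U k"
    note w = reduced_props[OF chart kJ]
    have "?w \<noteq> 0" using w(2)[OF kJ] i by auto
    moreover have "?w \<in> V i" using w(1) chart by (auto simp: chart_def)
    ultimately obtain m where m: "lead i m ?w" using lead_exists by blast
    then have mI: "m \<in> ?I" using w(1) by (auto simp: pivots_def)
    have "\<not> k < m" using m w(2)[OF kJ] J kJ by (auto simp: lead_def)
    moreover have "m \<noteq> k" using mI k kJ by auto
    ultimately have "m < k" by simp
    with less mI have "m \<in> J" by blast
    then show False using w(2)[of m] \<open>m \<noteq> k\<close> m by (simp add: lead_def)
  qed
  then show ?thesis
    using k less J pivots_subset by (intro weight_less[of _ _ k]) auto
qed

end

end

section \<open>Charts of the Grassmannian\<close>

text \<open>Products with the adjugate replace an inverse matrix, so expressions in the entries stay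
  polynomial up to one final division by the determinant.\<close>

lemma adj_mat_sums:
  fixes A :: "nat \<Rightarrow> nat \<Rightarrow> 'a::comm_ring_1"
  assumes M: "M = Matrix.mat n n (\<lambda>(i, j). A i j)" and rs: "r < n" "s < n"
  shows "(\<Sum>t<n. A r t * adj_mat M $$ (t, s)) = (if r = s then Determinant.det M else 0)"
    and "(\<Sum>t<n. adj_mat M $$ (r, t) * A t s) = (if r = s then Determinant.det M else 0)"
proof -
  have Mc: "M \<in> carrier_mat n n" by (simp add: M)
  note adj = adj_mat[OF Mc]
  have "(M * adj_mat M) $$ (r, s) = (\<Sum>t<n. A r t * adj_mat M $$ (t, s))"
    using rs Mc adj(1) by (simp add: scalar_prod_def lessThan_atLeast0 M)
  then show "(\<Sum>t<n. A r t * adj_mat M $$ (t, s)) = (if r = s then Determinant.det M else 0)"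
    using rs by (cases "r = s") (simp_all add: adj(2))
  have "(adj_mat M * M) $$ (r, s) = (\<Sum>t<n. adj_mat M $$ (r, t) * A t s)"
    using rs Mc adj(1) by (simp add: scalar_prod_def lessThan_atLeast0 M)
  then show "(\<Sum>t<n. adj_mat M $$ (r, t) * A t s) = (if r = s then Determinant.det M else 0)"
    using rs by (cases "r = s") (simp_all add: adj(3))
qed

abbreviation enum :: "nat set \<Rightarrow> nat \<Rightarrow> nat" where
  "enum J r \<equiv> sorted_list_of_set J ! r"

lemma bij_betw_enum: "\<lbrakk>finite J; card J = n\<rbrakk> \<Longrightarrow> bij_betw (enum J) {..<n} J"
  using bij_betw_nth[of "sorted_list_of_set J" "{..<n}" J] by simp

lemma
  assumes "finite J" "card J = n"
  shows enum_in: "r < n \<Longrightarrow> enum J r \<in> J"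
    and enum_eq_iff: "\<lbrakk>r < n; s < n\<rbrakk> \<Longrightarrow> enum J r = enum J s \<longleftrightarrow> r = s"
    and enum_surj: "k \<in> J \<Longrightarrow> \<exists>r<n. enum J r = k"
proof -
  have bij: "bij_betw (enum J) {..<n} J" using assms by (rule bij_betw_enum)
  show "r < n \<Longrightarrow> enum J r \<in> J" using bij_betwE[OF bij] by simp
  show "\<lbrakk>r < n; s < n\<rbrakk> \<Longrightarrow> enum J r = enum J s \<longleftrightarrow> r = s"
    using bij by (auto simp: bij_betw_def inj_on_def)
  show "k \<in> J \<Longrightarrow> \<exists>r<n. enum J r = k"
    using bij_betw_imp_surj_on[OF bij] by (metis imageE lessThan_iff)
qed

context quiver_representation_basis
begin

section \<open>Tuples of subspaces as spans of frames\<close>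

lemma frame_in_V: "\<lbrakk>F \<in> frames e; i \<in> verts Q; s < nat (e i)\<rbrakk> \<Longrightarrow> F (i, s) \<in> V i"
  by (fastforce simp: frames_def frame_index_def PiE_def Pi_def)

lemma frame_span_apply:
  "i \<in> verts Q \<Longrightarrow> frame_span e F i = span ((\<lambda>s. F (i, s)) ` {..<nat (e i)})"
  by (simp add: frame_span_def)

lemma frame_span_elem:
  assumes "i \<in> verts Q"
  shows "x \<in> frame_span e F i \<longleftrightarrow> (\<exists>a. x = (\<Sum>s<nat (e i). scale (a s) (F (i, s))))"
  unfolding frame_span_apply[OF assms] span_image_eq[OF finite_lessThan] by blast

lemma frame_span_in_grassmannian:
  assumes F: "F \<in> frames e"
  shows "frame_span e F \<in> grassmannian_product e"
proof -
  have "span ((\<lambda>s. F (i, s)) ` {..<nat (e i)}) \<subseteq> V i" if i: "i \<in> verts Q" for i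
    using frame_in_V[OF F i] by (intro span_minimal subspace_V[OF i]) auto
  moreover have "int (dim (span ((\<lambda>s. F (i, s)) ` {..<nat (e i)}))) = e i" if i: "i \<in> verts Q" for i
  proof -
    have "0 \<le> e i" "inj_on (\<lambda>r. F (i, r)) {..<nat (e i)}"
      "independent ((\<lambda>r. F (i, r)) ` {..<nat (e i)})"
      using F i by (auto simp: frames_def)
    then show ?thesis by (simp add: dim_eq_card_independent card_image)
  qed
  ultimately show ?thesis
    unfolding grassmannian_product_def frame_span_def by (auto simp: subspace_span)
qed

text \<open>The reduced echelon basis, listed by increasing pivot, serves as a frame. This
  identifies the points of the quotient with all tuples of subspaces.\<close>

lemma frame_exists:
  assumes U: "U \<in> grassmannian_product e"
  shows "\<exists>F\<in>frames e. frame_span e F = U"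
proof -
  have Ui: "subspace (U i)" "U i \<subseteq> V i" "int (dim (U i)) = e i" if "i \<in> verts Q" for i
    using U that by (auto simp: grassmannian_product_def PiE_def Pi_def)
  have "\<exists>h. bij_betw h {..<nat (e i)} (h ` {..<nat (e i)}) \<and> independent (h ` {..<nat (e i)}) \<and>
      span (h ` {..<nat (e i)}) = U i" if i: "i \<in> verts Q" for i
  proof -
    let ?J = "pivots i (U i)"
    note ch = chart_pivots[OF i Ui(1,2)[OF i]]
    have card: "card ?J = nat (e i)" using chart_dim[OF i ch] Ui(3)[OF i] by simp
    define h where "h = (\<lambda>r. reduced i ?J (U i) (enum ?J r))"
    have bij: "bij_betw (enum ?J) {..<nat (e i)} ?J" using card by (simp add: bij_betw_enum)
    have im: "h ` {..<nat (e i)} = reduced i ?J (U i) ` ?J"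
      using bij by (auto simp: h_def bij_betw_def image_image[symmetric])
    have lead: "lead i k (reduced i ?J (U i) k)" if "k \<in> ?J" for k
      using lead_reduced_pivots[OF i Ui(1,2)[OF i] that] .
    note fam = lead_family[OF i, of ?J "reduced i ?J (U i)", OF finite_pivots lead]
    have "inj_on h {..<nat (e i)}"
      using comp_inj_on[of "enum ?J" "{..<nat (e i)}"] fam(1) bij
      unfolding h_def bij_betw_def comp_def by auto
    moreover have "span (reduced i ?J (U i) ` ?J) = U i"
      using chart_span[OF i ch] by simp
    ultimately show ?thesis
      using fam(2) unfolding im[symmetric] by (intro exI[of _ h]) (auto simp: bij_betw_def)
  qed
  then obtain h where h: "\<And>i. i \<in> verts Q \<Longrightarrow> bij_betw (h i) {..<nat (e i)} (h i ` {..<nat (e i)})"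
    "\<And>i. i \<in> verts Q \<Longrightarrow> independent (h i ` {..<nat (e i)})"
    "\<And>i. i \<in> verts Q \<Longrightarrow> span (h i ` {..<nat (e i)}) = U i" by metis
  define F where "F = (\<lambda>j\<in>frame_index e. h (fst j) (snd j))"
  have F: "F (i, s) = h i s" if "i \<in> verts Q" "s < nat (e i)" for i s
    using that by (simp add: F_def frame_index_def)
  then have im: "(\<lambda>s. F (i, s)) ` {..<nat (e i)} = h i ` {..<nat (e i)}" if "i \<in> verts Q" for i
    using that by (intro image_cong) auto
  have "h i s \<in> V i" if "i \<in> verts Q" "s < nat (e i)" for i s
    using h(3)[OF that(1)] that Ui(2)[OF that(1)] span_base[of "h i s" "h i ` {..<nat (e i)}"] by auto
  moreover have "inj_on (\<lambda>s. F (i, s)) {..<nat (e i)}" if "i \<in> verts Q" for i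
    using h(1)[OF that] F[OF that] by (auto simp: bij_betw_def inj_on_def)
  moreover have "0 \<le> e i" if "i \<in> verts Q" for i using Ui(3)[OF that] by linarith
  ultimately have "F \<in> frames e"
    using h(2) unfolding frames_def by (auto simp: im frame_index_def F_def)
  moreover have "frame_span e F = U"
  proof
    fix i
    show "frame_span e F i = U i"
    proof (cases "i \<in> verts Q")
      case True
      then show ?thesis using h(3) im by (simp add: frame_span_def)
    next
      case False
      then show ?thesis
        using U by (simp add: frame_span_def grassmannian_product_def PiE_def extensional_def)
    qed
  qed
  ultimately show ?thesis by blast
qed

lemma points_frame_variety [simp]: "points (frame_variety e) = frames e"
  by (simp add: frame_variety_def)

lemma points_grassmannian_product_variety [simp]:
  "points (grassmannian_product_variety e) = grassmannian_product e"
  unfolding grassmannian_product_variety_def points_fquotient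
proof
  show "frame_span e ` points (frame_variety e) \<subseteq> grassmannian_product e"
    using frame_span_in_grassmannian by auto
  show "grassmannian_product e \<subseteq> frame_span e ` points (frame_variety e)"
  proof
    fix U assume "U \<in> grassmannian_product e"
    then obtain F where "F \<in> frames e" "frame_span e F = U" using frame_exists by blast
    then show "U \<in> frame_span e ` points (frame_variety e)" by auto
  qed
qed

lemma points_quiver_grassmannian [simp]:
  "points (quiver_grassmannian e) = subrepresentations e"
proof -
  have "subrepresentations e \<subseteq> grassmannian_product e"
    by (auto simp: subrepresentations_def)
  then show ?thesis by (auto simp: quiver_grassmannian_def)
qed

lemma function_space_grassmannian_product_variety:
  "function_space (grassmannian_product_variety e)"
  unfolding grassmannian_product_variety_def frame_variety_def
  by (rule function_space.function_space_fquotient[OF function_space_coordinate_space])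

lemma function_space_quiver_grassmannian: "function_space (quiver_grassmannian e)"
  unfolding quiver_grassmannian_def
  by (rule function_space.function_space_fsubspace[OF function_space_grassmannian_product_variety])

text \<open>The submatrix of the frame at the rows \<open>J\<close>. Its entries use
  \<open>dual\<close> rather than \<open>c\<close> because the coordinates of the frame variety are
  functionals on the whole ambient space.\<close>

definition frame_matrix :: "('i \<Rightarrow> int) \<Rightarrow> 'i \<Rightarrow> nat set \<Rightarrow> ('i \<times> nat \<Rightarrow> 'v) \<Rightarrow> complex mat" where
  "frame_matrix e i J F =
     Matrix.mat (nat (e i)) (nat (e i)) (\<lambda>(r, s). dual i (enum J r) (F (i, s)))"

context
  fixes e :: "'i \<Rightarrow> int" and i :: 'i and J :: "nat set" and F :: "'i \<times> nat \<Rightarrow> 'v"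
  assumes i: "i \<in> verts Q" and F: "F \<in> frames e"
    and J: "finite J" "card J = nat (e i)"
begin

lemma c_frame_lincomb:
  "c i (\<Sum>s<nat (e i). scale (a s) (F (i, s))) l = (\<Sum>s<nat (e i). dual i l (F (i, s)) * a s)"
proof -
  have "c i (\<Sum>s<nat (e i). scale (a s) (F (i, s))) l = (\<Sum>s<nat (e i). a s * c i (F (i, s)) l)"
    using frame_in_V[OF F i] by (intro c_lincomb[OF i]) auto
  also have "\<dots> = (\<Sum>s<nat (e i). dual i l (F (i, s)) * a s)"
    using frame_in_V[OF F i] by (intro sum.cong) (auto simp: dual_eq[OF i])
  finally show ?thesis .
qed

lemmas frame_matrix_sums = adj_mat_sums[of "frame_matrix e i J F" "nat (e i)"
    "\<lambda>r s. dual i (enum J r) (F (i, s))", OF frame_matrix_def]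

text \<open>Cramer's rule: the coefficients solve the linear system whose right-hand side is the
  unit vector at \<open>r0\<close>.\<close>

lemma cramer_vector:
  assumes det: "Determinant.det (frame_matrix e i J F) \<noteq> 0" and r0: "r0 < nat (e i)" and k: "k \<in> J"
  shows "c i (\<Sum>s<nat (e i). scale (adj_mat (frame_matrix e i J F) $$ (s, r0) / Determinant.det (frame_matrix e i J F)) (F (i, s))) k =
    (if k = enum J r0 then 1 else 0)"
proof -
  obtain r where r: "r < nat (e i)" "k = enum J r" using enum_surj[OF J k] by blast
  have "c i (\<Sum>s<nat (e i). scale (adj_mat (frame_matrix e i J F) $$ (s, r0) / Determinant.det (frame_matrix e i J F)) (F (i, s))) k =
      (\<Sum>s<nat (e i). dual i (enum J r) (F (i, s)) * adj_mat (frame_matrix e i J F) $$ (s, r0)) / Determinant.det (frame_matrix e i J F)"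
    unfolding c_frame_lincomb r(2) by (simp add: sum_divide_distrib)
  also have "\<dots> = (if r = r0 then 1 else 0)"
    using frame_matrix_sums(1)[OF r(1) r0] det by simp
  finally show ?thesis using enum_eq_iff[OF J r(1) r0] r(2) by simp
qed

text \<open>Written in the frame, the projection to the coordinates in \<open>J\<close> is this
  square matrix, so it is bijective exactly when the determinant is non-zero.\<close>

lemma chart_iff_det:
  assumes JB: "J \<subseteq> basis_index i"
  shows "chart i J (frame_span e F i) \<longleftrightarrow> Determinant.det (frame_matrix e i J F) \<noteq> 0"
proof
  assume det: "Determinant.det (frame_matrix e i J F) \<noteq> 0"
  have "\<exists>x\<in>(frame_span e F i). \<forall>l\<in>J. c i x l = (if l = k then 1 else 0)" if k: "k \<in> J" for k
  proof -
    obtain r0 where r0: "r0 < nat (e i)" "enum J r0 = k" using enum_surj[OF J k] by blast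
    let ?x = "\<Sum>s<nat (e i). scale (adj_mat (frame_matrix e i J F) $$ (s, r0) / Determinant.det (frame_matrix e i J F)) (F (i, s))"
    have "?x \<in> (frame_span e F i)" unfolding frame_span_elem[OF i] by (rule exI, rule refl)
    then show ?thesis using cramer_vector[OF det r0(1)] r0(2) by blast
  qed
  moreover have "x = 0" if x: "x \<in> (frame_span e F i)" "\<forall>k\<in>J. c i x k = 0" for x
  proof -
    obtain a where a: "x = (\<Sum>s<nat (e i). scale (a s) (F (i, s)))" using x(1) frame_span_elem[OF i] by blast
    have z: "(\<Sum>s<nat (e i). dual i (enum J r) (F (i, s)) * a s) = 0" if "r < nat (e i)" for r
      using x(2) enum_in[OF J that] unfolding a c_frame_lincomb by blast
    have "a t = 0" if t: "t < nat (e i)" for t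
    proof -
      \<comment> \<open>Applying row \<open>t\<close> of the adjugate to the vanishing system
        isolates the determinant times \<open>a t\<close>.\<close>
      have "Determinant.det (frame_matrix e i J F) * a t = (\<Sum>s<nat (e i). if t = s then Determinant.det (frame_matrix e i J F) * a s else 0)"
        using t by simp
      also have "\<dots> = (\<Sum>s<nat (e i). (\<Sum>r<nat (e i). adj_mat (frame_matrix e i J F) $$ (t, r) * dual i (enum J r) (F (i, s))) * a s)"
        using t by (intro sum.cong) (auto simp: frame_matrix_sums(2))
      also have "\<dots> = (\<Sum>s<nat (e i). \<Sum>r<nat (e i). adj_mat (frame_matrix e i J F) $$ (t, r) * (dual i (enum J r) (F (i, s)) * a s))"
        by (simp add: sum_distrib_right mult.assoc)
      also have "\<dots> = (\<Sum>r<nat (e i). \<Sum>s<nat (e i). adj_mat (frame_matrix e i J F) $$ (t, r) * (dual i (enum J r) (F (i, s)) * a s))"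
        by (rule sum.swap)
      also have "\<dots> = 0"
        using z by (simp add: sum_distrib_left[symmetric])
      finally show ?thesis using det by simp
    qed
    then show "x = 0" unfolding a by (intro sum.neutral) auto
  qed
  moreover have "subspace (frame_span e F i)" "(frame_span e F i) \<subseteq> V i"
    using frame_span_in_grassmannian[OF F] i by (auto simp: grassmannian_product_def PiE_def Pi_def)
  ultimately show "chart i J (frame_span e F i)" unfolding chart_def by blast
next
  assume ch: "chart i J (frame_span e F i)"
  show "Determinant.det (frame_matrix e i J F) \<noteq> 0"
  proof
    assume "Determinant.det (frame_matrix e i J F) = 0"
    moreover have Mc: "(frame_matrix e i J F) \<in> carrier_mat (nat (e i)) (nat (e i))" by (simp add: frame_matrix_def)
    \<comment> \<open>The entries of a kernel vector, used as coefficients, give an element of the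
      span that vanishes on \<open>J\<close> and hence is zero, against the independence of the
      frame.\<close>
    ultimately obtain v where v: "v \<in> carrier_vec (nat (e i))" "v \<noteq> 0\<^sub>v (nat (e i))" "(frame_matrix e i J F) *\<^sub>v v = 0\<^sub>v (nat (e i))"
      using det_0_iff_vec_prod_zero_field[OF Mc] by blast
    let ?a = "vec_index v"
    let ?x = "\<Sum>s<nat (e i). scale (?a s) (F (i, s))"
    have "c i ?x k = 0" if k: "k \<in> J" for k
    proof -
      obtain r where r: "r < nat (e i)" "enum J r = k" using enum_surj[OF J k] by blast
      have "((frame_matrix e i J F) *\<^sub>v v) $ r = (\<Sum>s<nat (e i). dual i k (F (i, s)) * ?a s)"
        using r v(1) by (auto simp: frame_matrix_def scalar_prod_def lessThan_atLeast0)
      then show ?thesis unfolding c_frame_lincomb using v(3) r by simp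
    qed
    moreover have "?x \<in> (frame_span e F i)" unfolding frame_span_elem[OF i] by (rule exI, rule refl)
    ultimately have "?x = 0" using ch unfolding chart_def by blast
    then have "?a s = 0" if "s < nat (e i)" for s
      using independent_family_zero[of "{..<nat (e i)}" "\<lambda>s. F (i, s)" ?a s] F i that
      by (auto simp: frames_def)
    then have "v = 0\<^sub>v (nat (e i))" using v(1) by (intro eq_vecI) auto
    with v(2) show False by blast
  qed
qed

lemma reduced_frame:
  assumes JB: "J \<subseteq> basis_index i" and det: "Determinant.det (frame_matrix e i J F) \<noteq> 0" and r0: "r0 < nat (e i)"
  shows "reduced i J (frame_span e F i) (enum J r0) =
    (\<Sum>s<nat (e i). scale (adj_mat (frame_matrix e i J F) $$ (s, r0) / Determinant.det (frame_matrix e i J F)) (F (i, s)))" (is "_ = ?x")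
proof (rule reduced_eqI[OF i _ enum_in[OF J r0]])
  show "chart i J (frame_span e F i)" using chart_iff_det[OF JB] det by blast
  show "?x \<in> (frame_span e F i)" unfolding frame_span_elem[OF i] by (rule exI, rule refl)
  show "c i ?x l = (if l = enum J r0 then 1 else 0)" if "l \<in> J" for l
    by (rule cramer_vector[OF det r0 that])
qed

end

lemma dual_polynomial:
  assumes "i \<in> verts Q" "s < nat (e i)"
  shows "(\<lambda>F. dual i k (F (i, s))) \<in> polynomial_functions
    {(\<lambda>F. \<xi> (F j)) | \<xi> j. j \<in> frame_index e \<and> Vector_Spaces.linear scale (*) \<xi>}"
  using assms linear_dual[OF assms(1), of k]
  by (intro polynomial_functions.coordinate) (auto simp: frame_index_def)

lemma frame_matrix_polynomial:
  assumes i: "i \<in> verts Q"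
  shows "(\<lambda>F. Determinant.det (frame_matrix e i J F)) \<in> polynomial_functions
      {(\<lambda>F. \<xi> (F j)) | \<xi> j. j \<in> frame_index e \<and> Vector_Spaces.linear scale (*) \<xi>}"
    and "\<lbrakk>r < nat (e i); s < nat (e i)\<rbrakk> \<Longrightarrow> (\<lambda>F. adj_mat (frame_matrix e i J F) $$ (r, s)) \<in> polynomial_functions
      {(\<lambda>F. \<xi> (F j)) | \<xi> j. j \<in> frame_index e \<and> Vector_Spaces.linear scale (*) \<xi>}"
  unfolding frame_matrix_def
  by (intro polynomial_functions_det polynomial_functions_adj_mat dual_polynomial i; assumption)+

section \<open>Charts as open sets and regularity of their coordinates\<close>

definition charts :: "('i \<Rightarrow> int) \<Rightarrow> ('i \<Rightarrow> nat set) \<Rightarrow> ('i \<Rightarrow> 'v set) set" where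
  "charts e I = {U \<in> grassmannian_product e. \<forall>i\<in>verts Q. chart i (I i) (U i)}"

context
  fixes e :: "'i \<Rightarrow> int" and I :: "'i \<Rightarrow> nat set"
  assumes I: "\<And>i. i \<in> verts Q \<Longrightarrow> I i \<subseteq> basis_index i \<and> card (I i) = nat (e i)"
begin

lemma finite_I: "i \<in> verts Q \<Longrightarrow> finite (I i)"
  using I[of i] finite_subset[of "I i" "basis_index i"] by simp

lemma frame_span_in_charts:
  "F \<in> frames e \<Longrightarrow> frame_span e F \<in> charts e I \<longleftrightarrow>
     (\<forall>i\<in>verts Q. Determinant.det (frame_matrix e i (I i) F) \<noteq> 0)"
  using I finite_I chart_iff_det frame_span_in_grassmannian[of F e] by (simp add: charts_def)

lemma openin_charts: "openin (zariski (grassmannian_product_variety e)) (charts e I)"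
  unfolding grassmannian_product_variety_def openin_fquotient points_frame_variety
proof
  show "charts e I \<subseteq> frame_span e ` frames e"
    using frame_exists unfolding charts_def by blast
  \<comment> \<open>The product of the minors over the finitely many vertices is one polynomial that
    is non-zero exactly on the frames over the chart.\<close>
  let ?p = "\<lambda>F. \<Prod>i\<in>verts Q. Determinant.det (frame_matrix e i (I i) F)"
  have "?p \<in> regular (frame_variety e) (frames e)"
    unfolding frame_variety_def
    by (intro polynomial_function_regular polynomial_functions_prod frame_matrix_polynomial)
  moreover have "openin (zariski (frame_variety e)) (frames e)"
    using openin_topspace[of "zariski (frame_variety e)"] by simp
  moreover have "function_space (frame_variety e)"
    unfolding frame_variety_def by (rule function_space_coordinate_space)
  ultimately have "openin (zariski (frame_variety e)) {F \<in> frames e. ?p F \<noteq> 0}"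
    by (intro function_space.openin_nonzero)
  moreover have "{F \<in> frames e. ?p F \<noteq> 0} = {F \<in> frames e. frame_span e F \<in> charts e I}"
    using frame_span_in_charts by auto
  ultimately show "openin (zariski (frame_variety e)) {F \<in> frames e. frame_span e F \<in> charts e I}"
    by simp
qed

text \<open>Regularity on the quotient is defined by pullback to frames, where Cramer's rule writes
  the entry as \<open>p / q\<close> with \<open>q\<close> a minor that has no zero over the
  chart.\<close>

lemma reduced_coordinate_regular:
  assumes i: "i \<in> verts Q" and k: "k \<in> I i"
  shows "(\<lambda>U. c i (reduced i (I i) (U i) k) l) \<in> regular (grassmannian_product_variety e) (charts e I)"
proof -
  let ?C = "{(\<lambda>F. \<xi> (F j)) | \<xi> j. j \<in> frame_index e \<and> Vector_Spaces.linear scale (*) \<xi>}"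
  let ?D = "{F \<in> frames e. frame_span e F \<in> charts e I}"
  let ?M = "frame_matrix e i (I i)"
  have J: "finite (I i)" "card (I i) = nat (e i)" "I i \<subseteq> basis_index i"
    using I[OF i] finite_I[OF i] by auto
  obtain r where r: "r < nat (e i)" "enum (I i) r = k"
    using enum_surj[OF J(1,2) k] by blast
  define p where "p = (\<lambda>F. \<Sum>s<nat (e i). dual i l (F (i, s)) * adj_mat (?M F) $$ (s, r))"
  define q where "q = (\<lambda>F. Determinant.det (?M F))"
  have "p \<in> polynomial_functions ?C"
    unfolding p_def using r(1) i
    by (intro polynomial_functions_sum polynomial_functions.mult dual_polynomial
        frame_matrix_polynomial(2)) auto
  moreover have "q \<in> polynomial_functions ?C"
    unfolding q_def by (rule frame_matrix_polynomial(1)[OF i])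
  moreover have q: "q F \<noteq> 0" if "F \<in> ?D" for F
    using that frame_span_in_charts i by (auto simp: q_def)
  moreover have "c i (reduced i (I i) (frame_span e F i) k) l = p F / q F" if F: "F \<in> ?D" for F
  proof -
    have F': "F \<in> frames e" using F by simp
    have "Determinant.det (?M F) \<noteq> 0" using q[OF F] by (simp add: q_def)
    from reduced_frame[OF i F' J this r(1)]
    have "c i (reduced i (I i) (frame_span e F i) k) l =
      (\<Sum>s<nat (e i). dual i l (F (i, s)) * (adj_mat (?M F) $$ (s, r) / Determinant.det (?M F)))"
      unfolding r(2) by (simp only: c_frame_lincomb[OF i F' J(1,2)])
    then show ?thesis by (simp add: p_def q_def sum_divide_distrib)
  qed
  ultimately have "(\<lambda>F. c i (reduced i (I i) (frame_span e F i) k) l) \<in> regular (frame_variety e) ?D"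
    unfolding frame_variety_def regular_coordinate_space
    by (intro ballI bexI[of _ p] bexI[of _ q]) auto
  then show ?thesis
    by (simp add: grassmannian_product_variety_def fquotient_def comp_def)
qed

end

text \<open>The way to construct morphisms into the quiver Grassmannian: a polynomial lift to frames
  is composed with the quotient map and then restricted to subrepresentations.\<close>

lemma frame_morphism:
  assumes frames: "\<And>t. F t \<in> frames e"
    and poly: "\<And>i s k. \<lbrakk>i \<in> verts Q; s < nat (e i); k \<in> basis_index i\<rbrakk>
      \<Longrightarrow> (\<lambda>t. c i (F t (i, s)) k) \<in> polynomial_functions C"
    and sub: "\<And>t. t \<in> A \<Longrightarrow> frame_span e (F t) \<in> subrepresentations e"
  shows "variety_morphism (coordinate_space A C) (quiver_grassmannian e) (\<lambda>t. frame_span e (F t))"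
proof -
  interpret A: function_space "coordinate_space A C" by (rule function_space_coordinate_space)
  have "variety_morphism (coordinate_space A C) (frame_variety e) F"
    unfolding frame_variety_def
  proof (rule A.variety_morphism_into_coordinate_space)
    show "F ` points (coordinate_space A C) \<subseteq> frames e" using frames by auto
    fix g assume "g \<in> {(\<lambda>F. \<xi> (F j)) | \<xi> j. j \<in> frame_index e \<and> Vector_Spaces.linear scale (*) \<xi>}"
    then obtain \<xi> j where g: "g = (\<lambda>F. \<xi> (F j))" "j \<in> frame_index e"
      and lin: "Vector_Spaces.linear scale (*) \<xi>" by blast
    obtain i s where j: "j = (i, s)" by force
    have isV: "i \<in> verts Q" "s < nat (e i)" using g(2) by (auto simp: j frame_index_def)
    interpret \<xi>: Vector_Spaces.linear scale "(*)" \<xi> by (fact lin)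
    \<comment> \<open>A functional on the ambient space is determined on \<open>V i\<close> by its
      values on the basis, so it is a combination of the coordinates with constant
      coefficients.\<close>
    have "g (F t) = (\<Sum>k\<in>basis_index i. c i (F t (i, s)) k * \<xi> (b i k))" for t
      using arg_cong[where f = \<xi>, OF basis_expansion[OF isV(1) frame_in_V[OF frames isV]]]
      by (simp add: g(1) j \<xi>.sum \<xi>.scale)
    then have "(\<lambda>t. g (F t)) = (\<lambda>t. \<Sum>k\<in>basis_index i. c i (F t (i, s)) k * \<xi> (b i k))" by blast
    also have "\<dots> \<in> polynomial_functions C"
      using isV by (intro polynomial_functions_sum polynomial_functions.mult poly polynomial_functions.const)
    finally show "(\<lambda>t. g (F t)) \<in> regular (coordinate_space A C) (points (coordinate_space A C))"
      by (rule polynomial_function_regular)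
  qed
  then have "variety_morphism (coordinate_space A C) (grassmannian_product_variety e)
      (\<lambda>t. frame_span e (F t))"
    unfolding grassmannian_product_variety_def
    by (rule variety_morphism_compose[OF _ variety_morphism_fquotient])
  then show ?thesis
    unfolding quiver_grassmannian_def
    by (rule A.variety_morphism_into_fsubspace) (use sub in auto)
qed

definition frame_of :: "('i \<Rightarrow> int) \<Rightarrow> ('i \<Rightarrow> nat set) \<Rightarrow> ('i \<Rightarrow> nat \<Rightarrow> 'v) \<Rightarrow> 'i \<times> nat \<Rightarrow> 'v" where
  "frame_of e J y = (\<lambda>j\<in>frame_index e. y (fst j) (enum (J (fst j)) (snd j)))"

lemma frame_of_apply:
  "\<lbrakk>i \<in> verts Q; s < nat (e i)\<rbrakk> \<Longrightarrow> frame_of e J y (i, s) = y i (enum (J i) s)"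
  by (simp add: frame_of_def frame_index_def)

text \<open>Vectors with distinct prescribed pivots are independent, so knowing the pivots is enough
  to obtain a frame.\<close>

lemma frame_of_lead:
  assumes J: "\<And>i. i \<in> verts Q \<Longrightarrow> finite (J i) \<and> int (card (J i)) = e i"
    and lead: "\<And>i k. \<lbrakk>i \<in> verts Q; k \<in> J i\<rbrakk> \<Longrightarrow> lead i k (y i k)"
  shows "frame_of e J y \<in> frames e"
    and "frame_span e (frame_of e J y) = (\<lambda>i\<in>verts Q. span (y i ` J i))"
proof -
  let ?F = "frame_of e J y"
  have bij: "bij_betw (enum (J i)) {..<nat (e i)} (J i)" if "i \<in> verts Q" for i
    using J[OF that] by (intro bij_betw_enum) auto
  have im: "(\<lambda>s. ?F (i, s)) ` {..<nat (e i)} = y i ` J i" if i: "i \<in> verts Q" for i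
  proof -
    have "(\<lambda>s. ?F (i, s)) ` {..<nat (e i)} = (\<lambda>s. y i (enum (J i) s)) ` {..<nat (e i)}"
      using i by (intro image_cong) (auto simp: frame_of_apply)
    also have "\<dots> = y i ` (enum (J i) ` {..<nat (e i)})" by (simp add: image_image)
    finally show ?thesis using bij_betw_imp_surj_on[OF bij[OF i]] by simp
  qed
  have "inj_on (\<lambda>s. ?F (i, s)) {..<nat (e i)}" if i: "i \<in> verts Q" for i
  proof -
    have "inj_on (y i) (enum (J i) ` {..<nat (e i)})"
      using lead_family(1)[OF i, of "J i" "y i"] J[OF i] lead[OF i] bij_betw_imp_surj_on[OF bij[OF i]]
      by simp
    then have "inj_on (y i \<circ> enum (J i)) {..<nat (e i)}"
      using bij_betw_imp_inj_on[OF bij[OF i]] by (rule comp_inj_on[rotated])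
    then show ?thesis by (rule inj_on_cong[THEN iffD1, rotated]) (use i in \<open>simp add: frame_of_apply\<close>)
  qed
  moreover have "independent ((\<lambda>s. ?F (i, s)) ` {..<nat (e i)})" if i: "i \<in> verts Q" for i
    unfolding im[OF i] using lead_family(2)[OF i, of "J i" "y i"] J[OF i] lead[OF i] by simp
  moreover have "y i (enum (J i) s) \<in> V i" if i: "i \<in> verts Q" "s < nat (e i)" for i s
    using lead[OF i(1)] bij_betwE[OF bij[OF i(1)]] i(2) by (auto simp: lead_def)
  moreover have "0 \<le> e i" if "i \<in> verts Q" for i using J[OF that] by linarith
  ultimately show "?F \<in> frames e"
    unfolding frames_def by (auto simp: frame_of_def frame_index_def)
  show "frame_span e ?F = (\<lambda>i\<in>verts Q. span (y i ` J i))"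
    unfolding frame_span_def using im by (intro restrict_ext) simp
qed

end

section \<open>Components that are equioriented strings\<close>

lemma (in pre_digraph) apath_nth:
  assumes "apath u p v" "m < length p"
  shows "awalk_verts u p ! m = tail G (p ! m)" "awalk_verts u p ! Suc m = head G (p ! m)"
proof -
  have p: "p \<noteq> []" "cas u p v" using assms by (auto simp: apath_def awalk_def)
  show "awalk_verts u p ! m = tail G (p ! m)"
    using assms(2) p by (simp add: awalk_verts_conv nth_append)
  show "awalk_verts u p ! Suc m = head G (p ! m)"
    using assms(2) p by (simp add: awalk_verts_conv')
qed

context fin_digraph
begin

text \<open>Connectivity ignores orientation, hence the symmetric closure.\<close>

definition component :: "'a \<Rightarrow> ('a, 'b) pre_digraph" where
  "component v = G \<restriction> {w. (v, w) \<in> (symcl (arcs_ends G))\<^sup>*}"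

lemma arc_in_symcl:
  assumes "e \<in> arcs G"
  shows "(tail G e, head G e) \<in> symcl (arcs_ends G)" "(head G e, tail G e) \<in> symcl (arcs_ends G)"
  using assms by (force simp: symcl_def arcs_ends_def arc_to_ends_def)+

lemma symcl_in_verts: "(x, y) \<in> symcl (arcs_ends G) \<Longrightarrow> x \<in> verts G \<and> y \<in> verts G"
  by (auto simp: symcl_def arcs_ends_def arc_to_ends_def)

lemma verts_component:
  assumes "v \<in> verts G"
  shows "verts (component v) = {w. (v, w) \<in> (symcl (arcs_ends G))\<^sup>*}"
proof -
  have "w \<in> verts G" if "(v, w) \<in> (symcl (arcs_ends G))\<^sup>*" for w
    using that assms symcl_in_verts by (induction rule: rtrancl_induct) auto
  then show ?thesis by (auto simp: component_def)
qed

lemma arc_in_component: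
  assumes v: "v \<in> verts G" and e: "e \<in> arcs G"
    and "tail G e \<in> verts (component v) \<or> head G e \<in> verts (component v)"
  shows "e \<in> arcs (component v) \<and> tail G e \<in> verts (component v) \<and> head G e \<in> verts (component v)"
proof -
  have "tail G e \<in> verts (component v) \<and> head G e \<in> verts (component v)"
    using assms(3) arc_in_symcl[OF e] unfolding verts_component[OF v]
    by (auto intro: rtrancl_into_rtrancl)
  with e show ?thesis unfolding verts_component[OF v] by (auto simp: component_def)
qed

text \<open>A walk from \<open>v\<close> stays in the component, which is therefore connected.
  Conversely, a connected subgraph containing \<open>v\<close> reaches its vertices by walks of
  \<open>G\<close>, so it cannot be larger.\<close>

lemma max_subgraph_component:
  assumes v: "v \<in> verts G"
  shows "max_subgraph connected (component v)"
  unfolding max_subgraph_def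
proof (intro conjI allI impI)
  let ?H = "component v" and ?R = "symcl (arcs_ends G)"
  let ?R' = "symcl (arcs_ends ?H)"
  note verts = verts_component[OF v]
  show sub: "subgraph ?H G"
    using verts v symcl_in_verts unfolding component_def
    by (intro induced_imp_subgraph induced_induce) (auto elim: rtranclE)
  have R': "(x, y) \<in> ?R'" if xy: "(x, y) \<in> ?R" "x \<in> verts ?H" for x y
  proof -
    from xy(1) obtain e where e: "e \<in> arcs G"
      "x = tail G e \<and> y = head G e \<or> x = head G e \<and> y = tail G e"
      by (auto simp: symcl_def arcs_ends_def arc_to_ends_def)
    with arc_in_component[OF v e(1)] xy(2) have "e \<in> arcs ?H" by auto
    moreover have "tail ?H e = tail G e" "head ?H e = head G e" by (simp_all add: component_def)
    ultimately show ?thesis using e(2) by (force simp: symcl_def arcs_ends_def arc_to_ends_def)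
  qed
  have reach: "(v, w) \<in> rtrancl_on (verts ?H) ?R'" if "(v, w) \<in> ?R\<^sup>*" for w
    using that
  proof (induction rule: rtrancl_induct)
    case base
    then show ?case by (simp add: verts)
  next
    case (step y z)
    then have "y \<in> verts ?H" "z \<in> verts ?H" unfolding verts by auto
    then show ?case using step R' by (blast intro: rtrancl_on_into_rtrancl_on)
  qed
  have "sym ?R'" by (auto simp: sym_def symcl_def)
  then have sym: "sym (rtrancl_on (verts ?H) ?R')" by (rule rtrancl_on_sym)
  show "connected ?H"
    unfolding connected_conv
  proof (intro conjI ballI)
    show "verts ?H \<noteq> {}" unfolding verts by auto
    fix x y assume "x \<in> verts ?H" "y \<in> verts ?H"
    then have "(v, x) \<in> rtrancl_on (verts ?H) ?R'" "(v, y) \<in> rtrancl_on (verts ?H) ?R'"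
      using reach unfolding verts by auto
    then show "(x, y) \<in> rtrancl_on (verts ?H) ?R'"
      using sym by (meson rtrancl_on_trans symD)
  qed
  fix H' assume H': "H' \<noteq> ?H \<and> subgraph ?H H'"
  show "\<not> (subgraph H' G \<and> connected H')"
  proof
    assume sc: "subgraph H' G \<and> connected H'"
    have comp: "compatible G H'" and arcs: "arcs H' \<subseteq> arcs G" and wf: "wf_digraph H'"
      using sc by (auto simp: subgraph_def)
    have vH': "v \<in> verts H'" using H' verts by (auto simp: subgraph_def)
    have "arcs_ends H' \<subseteq> arcs_ends G"
      using sc arcs_ends_mono by blast
    then have "symcl (arcs_ends H') \<subseteq> ?R" by (auto simp: symcl_def)
    moreover have "(v, x) \<in> (symcl (arcs_ends H'))\<^sup>*" if "x \<in> verts H'" for x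
      using sc vH' that unfolding connected_conv by (blast intro: rtrancl_on_rtranclI)
    ultimately have "verts H' \<subseteq> verts ?H"
      unfolding verts using rtrancl_mono by blast
    moreover have "e \<in> arcs ?H" if "e \<in> arcs H'" for e
    proof -
      have "tail G e \<in> verts H'"
        using comp wf that unfolding compatible_def by (metis wf_digraph.tail_in_verts)
      then show ?thesis
        using \<open>verts H' \<subseteq> verts ?H\<close> arc_in_component[OF v] arcs that by blast
    qed
    ultimately have "verts H' = verts ?H" "arcs H' = arcs ?H"
      using H' by (auto simp: subgraph_def)
    \<comment> \<open>Maximality compares digraph records, so the \<open>tail\<close> and
      \<open>head\<close> functions must agree as well; compatibility of subgraphs gives
      this.\<close>
    moreover have "tail H' = tail ?H" "head H' = head ?H"
      using H' by (auto simp: subgraph_def compatible_def)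
    ultimately show False using H' by simp
  qed
qed

context
  assumes strings: "\<And>H. max_subgraph connected H \<Longrightarrow> equioriented_string H"
begin

lemma string_component:
  assumes "v \<in> verts G"
  obtains vs p where "distinct vs" "length vs = Suc (length p)"
    "arcs (component v) = set p"
    "\<And>m. m < length p \<Longrightarrow> vs ! m = tail G (p ! m) \<and> vs ! Suc m = head G (p ! m)"
proof -
  let ?H = "component v"
  obtain u p w where p: "pre_digraph.apath ?H u p w" "arcs ?H = set p"
    using strings[OF max_subgraph_component[OF assms]] unfolding equioriented_string_def by blast
  let ?vs = "pre_digraph.awalk_verts ?H u p"
  have th: "tail ?H = tail G" "head ?H = head G" by (auto simp: component_def)
  have vs: "\<And>m. m < length p \<Longrightarrow> ?vs ! m = tail G (p ! m) \<and> ?vs ! Suc m = head G (p ! m)"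
    using pre_digraph.apath_nth[OF p(1)] by (simp add: th)
  have "distinct ?vs" using p(1) by (simp add: pre_digraph.apath_def)
  moreover have len: "length ?vs = Suc (length p)" by (rule pre_digraph.length_awalk_verts)
  ultimately show thesis using that p(2) vs by blast
qed

text \<open>Arcs with a common head lie in one component, and in a string the head determines the
  position of the arc.\<close>

lemma unique_incoming_arc:
  assumes e: "e \<in> arcs G" "e' \<in> arcs G" "head G e = head G e'"
  shows "e = e'"
proof -
  let ?v = "head G e"
  have v: "?v \<in> verts G" using e by simp
  obtain vs p where p: "distinct vs" "length vs = Suc (length p)" "arcs (component ?v) = set p"
    "\<And>m. m < length p \<Longrightarrow> vs ! m = tail G (p ! m) \<and> vs ! Suc m = head G (p ! m)"
    using string_component[OF v] by metis
  have "?v \<in> verts (component ?v)" by (simp add: verts_component[OF v])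
  then have "e \<in> set p" "e' \<in> set p"
    using arc_in_component[OF v] e unfolding p(3)[symmetric] by auto
  then obtain m n where mn: "m < length p" "p ! m = e" "n < length p" "p ! n = e'"
    by (metis in_set_conv_nth)
  then have "vs ! Suc m = vs ! Suc n" using p(4)[of m] p(4)[of n] e(3) by simp
  then have "m = n" using mn p(1,2) by (simp add: nth_eq_iff_index_eq)
  with mn show ?thesis by simp
qed

text \<open>Along a string every arc moves to the next position, so a directed walk never returns to
  its start. Finiteness turns acyclicity into well-foundedness.\<close>

lemma wf_arcs_ends: "wf (arcs_ends G)"
proof (rule finite_acyclic_wf)
  show "finite (arcs_ends G)" by (simp add: arcs_ends_def)
  show "acyclic (arcs_ends G)"
    unfolding acyclic_def
  proof (intro allI notI)
    fix x assume cyc: "(x, x) \<in> (arcs_ends G)\<^sup>+"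
    then obtain z where "(x, z) \<in> arcs_ends G" by (blast dest: tranclD)
    then have x: "x \<in> verts G" by (auto simp: arcs_ends_def arc_to_ends_def)
    obtain vs p where p: "distinct vs" "length vs = Suc (length p)" "arcs (component x) = set p"
      "\<And>m. m < length p \<Longrightarrow> vs ! m = tail G (p ! m) \<and> vs ! Suc m = head G (p ! m)"
      using string_component[OF x] by metis
    have arc: "\<exists>m<length p. vs ! m = y \<and> vs ! Suc m = z" "z \<in> verts (component x)"
      if yz: "(y, z) \<in> arcs_ends G" "y \<in> verts (component x)" for y z
    proof -
      obtain e where e: "e \<in> arcs G" "y = tail G e" "z = head G e"
        using yz(1) by (auto simp: arcs_ends_def arc_to_ends_def)
      then have ec: "e \<in> set p" and z: "z \<in> verts (component x)"
        using arc_in_component[OF x e(1)] yz(2) p(3) by auto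
      then obtain m where "m < length p" "p ! m = e" by (metis in_set_conv_nth)
      with p(4)[of m] e show "\<exists>m<length p. vs ! m = y \<and> vs ! Suc m = z" by auto
      show "z \<in> verts (component x)" by (fact z)
    qed
    \<comment> \<open>Carrying the positions of start and end along the walk makes their strict
      increase available, which contradicts distinctness for a closed walk.\<close>
    have "y \<in> verts (component x) \<and> (\<exists>m n. m < n \<and> n < length vs \<and> vs ! m = x \<and> vs ! n = y)"
      if "(x, y) \<in> (arcs_ends G)\<^sup>+" for y
      using that
    proof (induction rule: trancl_induct)
      case (base y)
      have "x \<in> verts (component x)" by (simp add: verts_component[OF x])
      from arc(1)[OF base this] obtain m where "m < length p" "vs ! m = x" "vs ! Suc m = y" by blast
      moreover have "y \<in> verts (component x)" by (rule arc(2)[OF base \<open>x \<in> verts (component x)\<close>])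
      ultimately show ?case using p(2) by (intro conjI exI[of _ m] exI[of _ "Suc m"]) auto
    next
      case (step y z)
      then obtain m n where mn: "m < n" "n < length vs" "vs ! m = x" "vs ! n = y"
        and y: "y \<in> verts (component x)" by blast
      obtain n' where n': "n' < length p" "vs ! n' = y" "vs ! Suc n' = z"
        using arc(1)[OF step(2) y] by blast
      then have "n' = n" using mn p(1,2) nth_eq_iff_index_eq[of vs n' n] by simp
      then show ?case
        using n' mn p(2) arc(2)[OF step(2) y] by (intro conjI exI[of _ m] exI[of _ "Suc n"]) auto
    qed
    then obtain m n where "m < n" "n < length vs" "vs ! m = x" "vs ! n = x" using cyc by blast
    then show False using nth_eq_iff_index_eq[OF p(1), of m n] by simp
  qed
qed

end

end

section \<open>Straightening bases with an attractive grading\<close>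

locale attractive_quiver_representation = quiver_representation_basis Q scale V f b
  for Q :: "('i, 'a) pre_digraph"
    and scale :: "complex \<Rightarrow> 'v::ab_group_add \<Rightarrow> 'v"
    and V :: "'i \<Rightarrow> 'v set"
    and f :: "'a \<Rightarrow> 'v \<Rightarrow> 'v"
    and b :: "'i \<Rightarrow> nat \<Rightarrow> 'v" +
  fixes wt :: "'i \<Rightarrow> nat \<Rightarrow> int"
  assumes strings:
      "pre_digraph.max_subgraph (coefficient_quiver b) Digraph_Component.connected H
        \<Longrightarrow> equioriented_string H"
    and normalized: "normalized b"
    and aligned: "aligned b"
    and attractive: "attractive_grading b wt"
begin

section \<open>Arrows acting on basis vectors and on pivots\<close>

definition step :: "'a \<Rightarrow> nat \<Rightarrow> nat \<Rightarrow> bool" where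
  "step a k l \<longleftrightarrow> a \<in> arcs Q \<and> k \<in> basis_index (tail Q a) \<and> l \<in> basis_index (head Q a) \<and>
     f a (b (tail Q a) k) = b (head Q a) l"

lemma step_cases:
  assumes "a \<in> arcs Q" "k \<in> basis_index (tail Q a)"
  obtains "f a (b (tail Q a) k) = 0" | l where "step a k l"
  using normalized assms unfolding normalized_def step_def by blast

lemma not_step_zero: "step a k l \<Longrightarrow> f a (b (tail Q a) k) \<noteq> 0"
  unfolding step_def by (auto simp: b_nonzero)

lemma f_zero: "a \<in> arcs Q \<Longrightarrow> f a 0 = 0"
  using map_scale[of a 0 0] zero_in_V[of "tail Q a"] by simp

lemma f_sum:
  assumes a: "a \<in> arcs Q" and g: "\<And>j. j \<in> J \<Longrightarrow> g j \<in> V (tail Q a)"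
  shows "f a (\<Sum>j\<in>J. g j) = (\<Sum>j\<in>J. f a (g j))"
  using g
proof (induction J rule: infinite_finite_induct)
  case (insert x J)
  then have "(\<Sum>j\<in>J. g j) \<in> V (tail Q a)" using a by (intro sum_in_V) auto
  then show ?case using insert a by (simp add: map_add)
qed (use a in \<open>simp_all add: f_zero\<close>)

lemma f_expansion:
  assumes "a \<in> arcs Q" "x \<in> V (tail Q a)"
  shows "f a x = (\<Sum>k\<in>basis_index (tail Q a). scale (c (tail Q a) x k) (f a (b (tail Q a) k)))"
proof -
  let ?i = "tail Q a"
  have i: "?i \<in> verts Q" using assms by simp
  have "f a x = f a (\<Sum>k\<in>basis_index ?i. scale (c ?i x k) (b ?i k))"
    using basis_expansion[OF i assms(2)] by simp
  also have "\<dots> = (\<Sum>k\<in>basis_index ?i. f a (scale (c ?i x k) (b ?i k)))"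
    using assms(1) i by (intro f_sum scale_in_V b_in_V)
  also have "\<dots> = (\<Sum>k\<in>basis_index ?i. scale (c ?i x k) (f a (b ?i k)))"
    using assms(1) i by (intro sum.cong map_scale b_in_V) auto
  finally show ?thesis .
qed

lemma c_f:
  assumes "a \<in> arcs Q" "x \<in> V (tail Q a)"
  shows "c (head Q a) (f a x) l =
    (\<Sum>k\<in>basis_index (tail Q a). c (tail Q a) x k * c (head Q a) (f a (b (tail Q a) k)) l)"
  unfolding f_expansion[OF assms]
  using assms(1) by (intro c_lincomb map_in b_in_V) auto

lemma c_f_basis:
  assumes "a \<in> arcs Q" "k \<in> basis_index (tail Q a)" "l \<in> basis_index (head Q a)"
  shows "c (head Q a) (f a (b (tail Q a) k)) l = (if step a k l then 1 else 0)"
proof (cases rule: step_cases[OF assms(1,2)])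
  case 1
  then show ?thesis using not_step_zero assms(1) by auto
next
  case (2 m)
  then have m: "m \<in> basis_index (head Q a)" "f a (b (tail Q a) k) = b (head Q a) m"
    by (auto simp: step_def)
  have "step a k l \<longleftrightarrow> l = m"
    using 2 m assms inj_b[of "head Q a"] by (auto simp: step_def inj_on_def)
  then show ?thesis using c_basis[of "head Q a" l m] m assms by simp
qed

lemma coefficient_quiver_arcs: "(k, a, l) \<in> arcs (coefficient_quiver b) \<longleftrightarrow> step a k l"
  using c_f_basis[of a k l] by (auto simp: coefficient_quiver_def step_def split: if_splits)

lemma fin_digraph_coefficient_quiver: "fin_digraph (coefficient_quiver b)"
proof
  have sub: "arcs (coefficient_quiver b) \<subseteq>
      (\<Union>a\<in>arcs Q. basis_index (tail Q a)) \<times> arcs Q \<times> (\<Union>a\<in>arcs Q. basis_index (head Q a))"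
    by (auto simp: coefficient_quiver_def)
  show "finite (arcs (coefficient_quiver b))"
    by (rule finite_subset[OF sub]) simp
  show "finite (verts (coefficient_quiver b))" by (simp add: coefficient_quiver_def)
qed (auto simp: coefficient_quiver_def)

text \<open>A vertex of the coefficient quiver is a pair of a vertex and an index, hence the
  condition on heads. Uniqueness also covers different arrows of \<open>Q\<close> with the same
  head.\<close>

lemma step_unique:
  assumes "step a k l" "step a' k' l" "head Q a = head Q a'"
  shows "a = a' \<and> k = k'"
proof -
  interpret C: fin_digraph "coefficient_quiver b" by (rule fin_digraph_coefficient_quiver)
  have "(k, a, l) = (k', a', l)"
    using assms coefficient_quiver_arcs
    by (intro C.unique_incoming_arc strings) (auto simp: coefficient_quiver_def)
  then show ?thesis by simp
qed

text \<open>Allows recursion and induction along successive images of basis vectors.\<close>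

lemma wf_step: "wf {((tail Q a, k), (head Q a, l)) | a k l. step a k l}"
proof -
  interpret C: fin_digraph "coefficient_quiver b" by (rule fin_digraph_coefficient_quiver)
  have "wf (arcs_ends (coefficient_quiver b))" by (rule C.wf_arcs_ends[OF strings])
  moreover have "{((tail Q a, k), (head Q a, l)) | a k l. step a k l} \<subseteq> arcs_ends (coefficient_quiver b)"
    unfolding coefficient_quiver_arcs[symmetric] arcs_ends_def arc_to_ends_def
    by (force simp: coefficient_quiver_def)
  ultimately show ?thesis by (rule wf_subset)
qed

lemma step_mono: "\<lbrakk>step a k l; step a k' l'; k < k'\<rbrakk> \<Longrightarrow> l < l'"
  using aligned unfolding aligned_def step_def by metis

text \<open>The first alignment condition, read as: over an arrow the indices sent to zero form an
  upper set.\<close>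

lemma f_basis_zero_mono:
  assumes "a \<in> arcs Q" "k \<in> basis_index (tail Q a)" "k' \<in> basis_index (tail Q a)" "k < k'"
    "f a (b (tail Q a) k) = 0"
  shows "f a (b (tail Q a) k') = 0"
proof (rule ccontr)
  assume "f a (b (tail Q a) k') \<noteq> 0"
  then have "k > k'" using aligned assms unfolding aligned_def by blast
  with assms(4) show False by simp
qed

text \<open>The coefficient of the image at \<open>l\<close> comes from \<open>k\<close> alone, as
  \<open>l\<close> has only one preimage. A preimage of an index before \<open>l\<close> lies before
  \<open>k\<close> by \<open>step_mono\<close>, and there \<open>x\<close> vanishes.\<close>

lemma lead_f:
  assumes x: "lead (tail Q a) k x" and st: "step a k l"
  shows "lead (head Q a) l (f a x)"
proof -
  have a: "a \<in> arcs Q" "k \<in> basis_index (tail Q a)" "l \<in> basis_index (head Q a)"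
    using st by (auto simp: step_def)
  have xV: "x \<in> V (tail Q a)" using x by (simp add: lead_def)
  have cf: "c (head Q a) (f a x) l' =
      (\<Sum>k\<in>basis_index (tail Q a). c (tail Q a) x k * (if step a k l' then 1 else 0))"
    if "l' \<in> basis_index (head Q a)" for l'
    unfolding c_f[OF a(1) xV] using a that by (intro sum.cong) (auto simp: c_f_basis)
  have "c (head Q a) (f a x) l =
      (\<Sum>k'\<in>basis_index (tail Q a). if k' = k then c (tail Q a) x k' else 0)"
    unfolding cf[OF a(3)] using st step_unique by (intro sum.cong) auto
  then have eq: "c (head Q a) (f a x) l = c (tail Q a) x k" using a by simp
  have "c (head Q a) (f a x) l' = 0" if l': "l' \<in> basis_index (head Q a)" "l' < l" for l'
    unfolding cf[OF l'(1)]
  proof (intro sum.neutral ballI)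
    fix k' assume k': "k' \<in> basis_index (tail Q a)"
    show "c (tail Q a) x k' * (if step a k' l' then 1 else 0) = 0"
    proof (cases "step a k' l'")
      case True
      have "\<not> k < k'" using step_mono[OF st True] l'(2) by auto
      moreover have "k \<noteq> k'"
      proof
        assume "k = k'"
        then have "b (head Q a) l = b (head Q a) l'" using True st by (simp add: step_def)
        then show False
          using inj_onD[OF inj_b[OF head_in_verts[OF a(1)]]] a(3) l' by auto
      qed
      ultimately show ?thesis using x k' by (auto simp: lead_def)
    qed simp
  qed
  then show "lead (head Q a) l (f a x)"
    using x eq a map_in[OF a(1) xV] by (auto simp: lead_def)
qed

text \<open>The vector \<open>x\<close> involves only indices from \<open>k\<close> on, and all of
  these are sent to zero together with \<open>k\<close>.\<close>

lemma lead_f_zero: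
  assumes x: "lead (tail Q a) k x" and a: "a \<in> arcs Q" and z: "f a (b (tail Q a) k) = 0"
  shows "f a x = 0"
proof -
  have k: "x \<in> V (tail Q a)" "k \<in> basis_index (tail Q a)" using x by (auto simp: lead_def)
  have "scale (c (tail Q a) x k') (f a (b (tail Q a) k')) = 0" if k': "k' \<in> basis_index (tail Q a)" for k'
  proof (cases "k' < k")
    case True
    then show ?thesis using x k' by (simp add: lead_def)
  next
    case False
    then show ?thesis using f_basis_zero_mono[OF a k(2) k'] z by (cases "k' = k") auto
  qed
  then show ?thesis unfolding f_expansion[OF a k(1)] by (intro sum.neutral) auto
qed

lemma wt_mono: "\<lbrakk>i \<in> verts Q; k \<in> basis_index i; l \<in> basis_index i; k < l\<rbrakk> \<Longrightarrow> wt i k < wt i l"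
  using attractive by (auto simp: attractive_grading_def)

lemma wt_step: "a \<in> arcs Q \<Longrightarrow> \<exists>d. \<forall>k l. step a k l \<longrightarrow> wt (head Q a) l = wt (tail Q a) k + d"
  using attractive by (simp add: attractive_grading_def coefficient_quiver_arcs)

subsection \<open>The torus action\<close>

abbreviation \<tau> :: "complex \<Rightarrow> 'i \<Rightarrow> 'v \<Rightarrow> 'v" where
  "\<tau> \<equiv> torus_vector b wt"

abbreviation act :: "complex \<Rightarrow> ('i \<Rightarrow> 'v set) \<Rightarrow> ('i \<Rightarrow> 'v set)" where
  "act \<equiv> torus_action b wt"

context
  fixes i
  assumes i: "i \<in> verts Q"
begin

lemma c_torus: "k \<in> basis_index i \<Longrightarrow> c i (\<tau> z i x) k = z powi wt i k * c i x k"
  using c_basis_sum[OF i subset_refl, of k "\<lambda>k. c i x k * z powi wt i k"]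
  by (simp add: torus_vector_def mult.commute)

lemma torus_in_V: "\<tau> z i x \<in> V i"
  unfolding torus_vector_def using i by (intro sum_in_V scale_in_V b_in_V)

lemma torus_add: "\<lbrakk>x \<in> V i; y \<in> V i\<rbrakk> \<Longrightarrow> \<tau> z i (x + y) = \<tau> z i x + \<tau> z i y"
  using i by (intro c_eqI[OF i]) (simp_all add: torus_in_V add_in_V c_torus c_add algebra_simps)

lemma torus_scale: "x \<in> V i \<Longrightarrow> \<tau> z i (scale r x) = scale r (\<tau> z i x)"
  using i by (intro c_eqI[OF i]) (simp_all add: torus_in_V scale_in_V c_torus c_scale)

lemma torus_mult: "\<lbrakk>z \<noteq> 0; w \<noteq> 0\<rbrakk> \<Longrightarrow> \<tau> z i (\<tau> w i x) = \<tau> (z * w) i x"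
  using i by (intro c_eqI[OF i]) (simp_all add: torus_in_V c_torus power_int_mult_distrib)

lemma torus_one: "x \<in> V i \<Longrightarrow> \<tau> 1 i x = x"
  using i by (intro c_eqI[OF i]) (simp_all add: torus_in_V c_torus)

lemma subspace_torus:
  assumes "subspace U" "U \<subseteq> V i"
  shows "subspace (\<tau> z i ` U)"
proof (rule subspaceI)
  have "\<tau> z i 0 = 0" using torus_scale[of 0 z 0] zero_in_V[OF i] by simp
  then show "0 \<in> \<tau> z i ` U" using subspace_0[OF assms(1)] by force
  fix x y assume "x \<in> \<tau> z i ` U" "y \<in> \<tau> z i ` U"
  then obtain x' y' where xy: "x' \<in> U" "y' \<in> U" "x = \<tau> z i x'" "y = \<tau> z i y'" by blast
  moreover from this have "x' \<in> V i" "y' \<in> V i" using assms(2) by auto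
  ultimately have "x + y = \<tau> z i (x' + y')" by (simp add: torus_add)
  then show "x + y \<in> \<tau> z i ` U" using assms(1) xy by (simp add: subspace_add)
next
  fix r x assume "x \<in> \<tau> z i ` U"
  then obtain x' where "x' \<in> U" "x = \<tau> z i x'" by blast
  moreover from this have "scale r x = \<tau> z i (scale r x')" using assms(2) torus_scale by auto
  ultimately show "scale r x \<in> \<tau> z i ` U" using assms(1) by (simp add: subspace_scale)
qed

lemma c_scale_torus:
  assumes z: "z \<noteq> 0" and l: "l \<in> basis_index i"
  shows "c i (scale (z powi - m) (\<tau> z i x)) l = z powi (wt i l - m) * c i x l"
  using z l by (simp add: c_scale[OF i torus_in_V] c_torus power_int_diff power_int_minus field_simps)

text \<open>Scaling by non-zero powers of \<open>z\<close> respects the vanishing of coordinates;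
  the factor \<open>z powi - wt i k\<close> restores the entry 1 at \<open>k\<close>.\<close>

lemma chart_torus:
  assumes z: "z \<noteq> 0" and ch: "chart i J U" and J: "J \<subseteq> basis_index i"
  shows "chart i J (\<tau> z i ` U)"
    and "k \<in> J \<Longrightarrow> reduced i J (\<tau> z i ` U) k = scale (z powi - wt i k) (\<tau> z i (reduced i J U k))"
proof -
  have U: "subspace U" "U \<subseteq> V i" using ch by (auto simp: chart_def)
  have mem: "scale (z powi - wt i k) (\<tau> z i (reduced i J U k)) \<in> \<tau> z i ` U" if "k \<in> J" for k
    using subspace_torus[OF U] reduced_props(1)[OF i ch that] by (intro subspace_scale) auto
  have coef: "c i (scale (z powi - wt i k) (\<tau> z i (reduced i J U k))) l = (if l = k then 1 else 0)"
    if "k \<in> J" "l \<in> J" for k l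
  proof -
    have "l \<in> basis_index i" using that J by blast
    then show ?thesis
      using c_scale_torus[OF z] reduced_props(2)[OF i ch that] by simp
  qed
  have "x = 0" if x: "x \<in> \<tau> z i ` U" "\<forall>k\<in>J. c i x k = 0" for x
  proof -
    obtain x' where x': "x' \<in> U" "x = \<tau> z i x'" using x(1) by blast
    have "c i x' k = 0" if "k \<in> J" for k
      using x(2) that J z c_torus[of k z x'] unfolding x'(2) by auto
    then have "x' = 0" using ch x'(1) unfolding chart_def by blast
    then show "x = 0" using x'(2) torus_scale[of 0 z 0] zero_in_V[OF i] by simp
  qed
  moreover have "\<tau> z i ` U \<subseteq> V i" using torus_in_V by auto
  moreover have "\<exists>x\<in>\<tau> z i ` U. \<forall>l\<in>J. c i x l = (if l = k then 1 else 0)" if k: "k \<in> J" for k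
    using coef[OF k] by (intro bexI[OF _ mem[OF k]] ballI)
  ultimately show ch': "chart i J (\<tau> z i ` U)"
    unfolding chart_def using subspace_torus[OF U] by simp
  show "reduced i J (\<tau> z i ` U) k = scale (z powi - wt i k) (\<tau> z i (reduced i J U k))" if "k \<in> J"
    by (rule reduced_eqI[OF i ch' that mem[OF that] coef[OF that]])
qed

lemma chart_torus_iff:
  assumes z: "z \<noteq> 0" and U: "U \<subseteq> V i" and J: "J \<subseteq> basis_index i"
  shows "chart i J (\<tau> z i ` U) \<longleftrightarrow> chart i J U"
proof
  assume "chart i J (\<tau> z i ` U)"
  then have "chart i J (\<tau> (inverse z) i ` \<tau> z i ` U)"
    by (rule chart_torus(1)[rotated]) (use z J in auto)
  moreover have "\<tau> (inverse z) i ` \<tau> z i ` U = U"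
    unfolding image_image
  proof (subst image_cong[OF refl])
    fix x assume "x \<in> U"
    then show "\<tau> (inverse z) i (\<tau> z i x) = x" using U z torus_one by (auto simp: torus_mult)
  qed simp
  ultimately show "chart i J U" by (simp only:)
qed (rule chart_torus(1)[OF z _ J])

lemma dim_torus:
  assumes "z \<noteq> 0" "subspace U" "U \<subseteq> V i"
  shows "dim (\<tau> z i ` U) = dim U"
  using chart_torus(1)[OF assms(1) chart_pivots[OF i assms(2,3)] pivots_subset]
    chart_dim[OF i] chart_pivots[OF i assms(2,3)] finite_pivots by metis

lemma chart_coordinate:
  assumes J: "J \<subseteq> basis_index i"
  shows "chart i J (span (b i ` J))" "pivots i (span (b i ` J)) = J"
    and "k \<in> J \<Longrightarrow> reduced i J (span (b i ` J)) k = b i k"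
proof -
  let ?E = "span (b i ` J)"
  have fJ: "finite J" using finite_subset[OF J] by simp
  have lead: "lead i k (b i k)" if "k \<in> J" for k
    using that J i by (auto simp: lead_def b_in_V c_basis)
  show piv: "pivots i ?E = J" by (rule lead_family(3)[OF i fJ lead])
  have sub: "?E \<subseteq> V i" using J i by (intro span_minimal subspace_V) (auto intro: b_in_V)
  show ch: "chart i J ?E" using chart_pivots[OF i subspace_span sub] unfolding piv .
  show "reduced i J ?E k = b i k" if k: "k \<in> J"
  proof (rule reduced_eqI[OF i ch k])
    show "b i k \<in> ?E" using k by (intro span_base imageI)
    show "c i (b i k) l = (if l = k then 1 else 0)" if "l \<in> J" for l
      using k that J by (intro c_basis[OF i]) auto
  qed
qed

end

text \<open>Along one arrow all weights shift by the same \<open>d\<close>, so the map commutes with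
  the torus up to a scalar, which subspaces do not see. Hence the action preserves
  subrepresentations.\<close>

lemma torus_f:
  assumes a: "a \<in> arcs Q" and z: "z \<noteq> 0"
  obtains d where "\<And>x. x \<in> V (tail Q a) \<Longrightarrow>
    f a (\<tau> z (tail Q a) x) = scale (z powi - d) (\<tau> z (head Q a) (f a x))"
proof -
  obtain d where d: "\<And>k l. step a k l \<Longrightarrow> wt (head Q a) l = wt (tail Q a) k + d"
    using wt_step[OF a] by blast
  have i: "tail Q a \<in> verts Q" and j: "head Q a \<in> verts Q" using a by auto
  show thesis
  proof (rule that[of d], rule c_eqI[OF j])
    fix x l assume x: "x \<in> V (tail Q a)"
    show "f a (\<tau> z (tail Q a) x) \<in> V (head Q a)"
      using a i by (intro map_in torus_in_V)
    show "scale (z powi - d) (\<tau> z (head Q a) (f a x)) \<in> V (head Q a)"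
      using j by (intro scale_in_V torus_in_V)
    assume l: "l \<in> basis_index (head Q a)"
    have "c (head Q a) (f a (\<tau> z (tail Q a) x)) l =
        (\<Sum>k\<in>basis_index (tail Q a). z powi wt (tail Q a) k * c (tail Q a) x k * (if step a k l then 1 else 0))"
      unfolding c_f[OF a torus_in_V[OF i]] using a l
      by (intro sum.cong) (auto simp: c_f_basis c_torus[OF i])
    also have "\<dots> = (\<Sum>k\<in>basis_index (tail Q a). z powi - d * (z powi wt (head Q a) l *
        (c (tail Q a) x k * (if step a k l then 1 else 0))))"
      using z by (intro sum.cong) (auto simp: d power_int_add power_int_minus field_simps)
    also have "\<dots> = z powi - d * (z powi wt (head Q a) l * c (head Q a) (f a x) l)"
      unfolding c_f[OF a x] sum_distrib_left using a l
      by (intro sum.cong) (auto simp: c_f_basis)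
    also have "\<dots> = c (head Q a) (scale (z powi - d) (\<tau> z (head Q a) (f a x))) l"
      using l by (simp add: c_scale[OF j torus_in_V[OF j]] c_torus[OF j])
    finally show "c (head Q a) (f a (\<tau> z (tail Q a) x)) l =
      c (head Q a) (scale (z powi - d) (\<tau> z (head Q a) (f a x))) l" .
  qed
qed

lemma subrepresentationD:
  assumes "U \<in> subrepresentations e"
  shows "i \<in> verts Q \<Longrightarrow> subspace (U i)" "i \<in> verts Q \<Longrightarrow> U i \<subseteq> V i"
    "i \<in> verts Q \<Longrightarrow> int (dim (U i)) = e i" "i \<notin> verts Q \<Longrightarrow> U i = undefined"
    "\<lbrakk>a \<in> arcs Q; x \<in> U (tail Q a)\<rbrakk> \<Longrightarrow> f a x \<in> U (head Q a)"
  using assms by (auto simp: subrepresentations_def grassmannian_product_def PiE_def Pi_def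
      extensional_def image_subset_iff)

lemma subrepresentationI:
  assumes "\<And>i. i \<in> verts Q \<Longrightarrow> subspace (U i)" "\<And>i. i \<in> verts Q \<Longrightarrow> U i \<subseteq> V i"
    "\<And>i. i \<in> verts Q \<Longrightarrow> int (dim (U i)) = e i" "\<And>i. i \<notin> verts Q \<Longrightarrow> U i = undefined"
    "\<And>a x. \<lbrakk>a \<in> arcs Q; x \<in> U (tail Q a)\<rbrakk> \<Longrightarrow> f a x \<in> U (head Q a)"
  shows "U \<in> subrepresentations e"
  using assms by (auto simp: subrepresentations_def grassmannian_product_def PiE_def Pi_def
      extensional_def image_subset_iff)

lemma act_apply: "i \<in> verts Q \<Longrightarrow> act z U i = \<tau> z i ` U i"
  by (simp add: torus_action_def)

lemma act_subrepresentation: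
  assumes U: "U \<in> subrepresentations e" and z: "z \<noteq> 0"
  shows "act z U \<in> subrepresentations e"
proof (rule subrepresentationI)
  note U' = subrepresentationD[OF U]
  show "subspace (act z U i)" if "i \<in> verts Q" for i
    using U' that by (simp add: act_apply subspace_torus)
  show "act z U i \<subseteq> V i" if "i \<in> verts Q" for i
    using that torus_in_V by (auto simp: act_apply)
  show "int (dim (act z U i)) = e i" if "i \<in> verts Q" for i
    using U' that z by (simp add: act_apply dim_torus)
  show "act z U i = undefined" if "i \<notin> verts Q" for i
    using that by (simp add: torus_action_def)
  fix a x assume a: "a \<in> arcs Q" and x: "x \<in> act z U (tail Q a)"
  then obtain y where y: "y \<in> U (tail Q a)" "x = \<tau> z (tail Q a) y" by (auto simp: act_apply)
  have yV: "y \<in> V (tail Q a)" using U'(2)[OF tail_in_verts[OF a]] y(1) by blast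
  obtain d where "f a x = scale (z powi - d) (\<tau> z (head Q a) (f a y))"
    using torus_f[OF a z] y(2) yV by metis
  moreover have "f a y \<in> U (head Q a)" by (rule U'(5)[OF a y(1)])
  moreover have "subspace (\<tau> z (head Q a) ` U (head Q a))"
    using U' a by (simp add: subspace_torus)
  ultimately show "f a x \<in> act z U (head Q a)"
    using a by (simp add: act_apply subspace_scale)
qed

lemma cstar_action_subrepresentations: "cstar_action (subrepresentations e) act"
  unfolding cstar_action_def
proof (intro ballI conjI allI impI)
  fix U assume U: "U \<in> subrepresentations e"
  note U' = subrepresentationD[OF U]
  have "\<tau> 1 i ` U i = U i" if "i \<in> verts Q" for i
    using U'(2)[OF that] torus_one[OF that] by (force intro: image_cong[THEN trans])
  then show "act 1 U = U" using U' by (intro ext) (auto simp: torus_action_def)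
  fix z :: complex assume z: "z \<noteq> 0"
  show "act z U \<in> subrepresentations e" by (rule act_subrepresentation[OF U z])
  fix w :: complex assume w: "w \<noteq> 0"
  have "\<tau> z i ` \<tau> w i ` U i = \<tau> (z * w) i ` U i" if "i \<in> verts Q" for i
    unfolding image_image using torus_mult[OF that z w] by simp
  then show "act z (act w U) = act (z * w) U"
    by (intro ext) (simp add: torus_action_def)
qed

subsection \<open>Fixed points\<close>

definition coordinate_subspaces :: "('i \<Rightarrow> nat set) \<Rightarrow> 'i \<Rightarrow> 'v set" where
  "coordinate_subspaces I = (\<lambda>i\<in>verts Q. span (b i ` I i))"

definition all_pivots :: "('i \<Rightarrow> 'v set) \<Rightarrow> 'i \<Rightarrow> nat set" where
  "all_pivots U = (\<lambda>i\<in>verts Q. pivots i (U i))"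

lemma all_pivots_apply: "i \<in> verts Q \<Longrightarrow> all_pivots U i = pivots i (U i)"
  by (simp add: all_pivots_def)

lemma coordinate_subspaces_apply: "i \<in> verts Q \<Longrightarrow> coordinate_subspaces I i = span (b i ` I i)"
  by (simp add: coordinate_subspaces_def)

lemma all_pivots_coordinate_subspaces: "all_pivots (coordinate_subspaces (all_pivots U)) = all_pivots U"
  by (auto simp: all_pivots_def coordinate_subspaces_def chart_coordinate(2) pivots_subset
      intro!: restrict_ext)

lemma pivots_step:
  assumes U: "U \<in> subrepresentations e" and st: "step a k l" and k: "k \<in> pivots (tail Q a) (U (tail Q a))"
  shows "l \<in> pivots (head Q a) (U (head Q a))"
proof -
  obtain x where x: "x \<in> U (tail Q a)" "lead (tail Q a) k x" using k by (auto simp: pivots_def)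
  have a: "a \<in> arcs Q" using st by (simp add: step_def)
  show ?thesis
    using subrepresentationD(5)[OF U a x(1)] lead_f[OF x(2) st] by (auto simp: pivots_def)
qed

lemma card_pivots:
  assumes "U \<in> subrepresentations e" "i \<in> verts Q"
  shows "int (card (pivots i (U i))) = e i"
  using dim_eq_card_pivots[OF assms(2)] subrepresentationD(1-3)[OF assms] by simp

lemma charts_index:
  assumes "U \<in> subrepresentations e" "i \<in> verts Q"
  shows "all_pivots U i \<subseteq> basis_index i \<and> card (all_pivots U i) = nat (e i)"
  using card_pivots[OF assms] assms(2) pivots_subset by (simp add: all_pivots_apply)

text \<open>The basis vector of a pivot is sent to zero or to the basis vector of its image, and
  \<open>pivots_step\<close> puts that image among the pivots at the head.\<close>

lemma limit_subrepresentation: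
  assumes U: "U \<in> subrepresentations e"
  shows "coordinate_subspaces (all_pivots U) \<in> subrepresentations e"
proof (rule subrepresentationI)
  let ?E = "coordinate_subspaces (all_pivots U)"
  have E: "?E i = span (b i ` pivots i (U i))" if "i \<in> verts Q" for i
    using that by (simp add: coordinate_subspaces_def all_pivots_def)
  show sub: "subspace (?E i)" if "i \<in> verts Q" for i using that by (simp add: E)
  have ch: "chart i (pivots i (U i)) (?E i)" if "i \<in> verts Q" for i
    using that by (simp add: E chart_coordinate(1) pivots_subset)
  then show "?E i \<subseteq> V i" if "i \<in> verts Q" for i using that by (auto simp: chart_def)
  show "int (dim (?E i)) = e i" if "i \<in> verts Q" for i
    using chart_dim[OF that ch[OF that]] card_pivots[OF U that] by simp
  show "?E i = undefined" if "i \<notin> verts Q" for i using that by (simp add: coordinate_subspaces_def)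
  fix a x assume a: "a \<in> arcs Q" and x: "x \<in> ?E (tail Q a)"
  let ?i = "tail Q a" and ?j = "head Q a"
  have i: "?i \<in> verts Q" and j: "?j \<in> verts Q" using a by auto
  obtain r where r: "x = (\<Sum>k\<in>pivots ?i (U ?i). scale (r k) (b ?i k))"
    using x unfolding E[OF i] span_image_eq[OF finite_pivots] by blast
  have bV: "b ?i k \<in> V ?i" if "k \<in> pivots ?i (U ?i)" for k
    using that pivots_subset b_in_V[OF i] by blast
  have "f a x = (\<Sum>k\<in>pivots ?i (U ?i). f a (scale (r k) (b ?i k)))"
    unfolding r using a i bV by (intro f_sum scale_in_V)
  also have "\<dots> \<in> ?E ?j"
  proof (rule subspace_sum[OF sub[OF j]])
    fix k assume k: "k \<in> pivots ?i (U ?i)"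
    then have kB: "k \<in> basis_index ?i" using pivots_subset by blast
    have "f a (b ?i k) \<in> ?E ?j"
    proof (cases rule: step_cases[OF a kB])
      case 1
      then show ?thesis using subspace_0[OF sub[OF j]] by simp
    next
      case (2 l)
      then show ?thesis
        using pivots_step[OF U 2 k] unfolding E[OF j] by (simp add: step_def span_base)
    qed
    then show "f a (scale (r k) (b ?i k)) \<in> ?E ?j"
      using map_scale[OF a bV[OF k]] subspace_scale[OF sub[OF j]] by simp
  qed
  finally show "f a x \<in> ?E ?j" .
qed

text \<open>The image has the same reduced basis, since each basis vector is only scaled and the
  normalisation scales it back.\<close>

lemma torus_coordinate_subspace:
  assumes i: "i \<in> verts Q" and J: "J \<subseteq> basis_index i" and z: "z \<noteq> 0"
  shows "\<tau> z i ` span (b i ` J) = span (b i ` J)"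
proof -
  let ?E = "span (b i ` J)"
  note ch = chart_coordinate[OF i J]
  have fJ: "finite J" using finite_subset[OF J] by simp
  have red: "reduced i J (\<tau> z i ` ?E) k = b i k" if k: "k \<in> J" for k
  proof -
    have kB: "k \<in> basis_index i" using J k by blast
    have "reduced i J (\<tau> z i ` ?E) k = scale (z powi - wt i k) (\<tau> z i (b i k))"
      using chart_torus(2)[OF i z ch(1) J k] ch(3)[OF k] by simp
    also have "\<dots> = b i k"
      using z kB by (intro c_eqI[OF i])
        (auto simp: scale_in_V[OF i torus_in_V[OF i]] b_in_V[OF i] c_scale[OF i torus_in_V[OF i]]
          c_torus[OF i] c_basis[OF i] power_int_minus)
    finally show ?thesis .
  qed
  have "\<tau> z i ` ?E = span (reduced i J (\<tau> z i ` ?E) ` J)"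
    by (rule chart_span[OF i chart_torus(1)[OF i z ch(1) J] fJ])
  also have "reduced i J (\<tau> z i ` ?E) ` J = b i ` J" by (rule image_cong[OF refl red])
  finally show ?thesis .
qed

text \<open>The reduced vectors of a stable subspace are weight vectors, and distinct weights at one
  vertex leave room for a single non-zero entry.\<close>

lemma fixed_points_eq:
  "fixed_points (quiver_grassmannian e) act =
     {U \<in> subrepresentations e. coordinate_subspaces (all_pivots U) = U}"
proof (intro equalityI subsetI)
  fix U assume "U \<in> {U \<in> subrepresentations e. coordinate_subspaces (all_pivots U) = U}"
  then have U: "U \<in> subrepresentations e" and E: "coordinate_subspaces (all_pivots U) = U" by auto
  have "act z U = U" if z: "z \<noteq> 0" for z
  proof
    fix i
    show "act z U i = U i"
    proof (cases "i \<in> verts Q")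
      case True
      have Ui: "U i = span (b i ` pivots i (U i))"
        using fun_cong[OF E, of i] True by (simp add: coordinate_subspaces_def all_pivots_def)
      show ?thesis
        using torus_coordinate_subspace[OF True pivots_subset z, of "U i"] Ui True
        by (simp add: act_apply)
    next
      case False
      then show ?thesis using subrepresentationD(4)[OF U] by (simp add: torus_action_def)
    qed
  qed
  with U show "U \<in> fixed_points (quiver_grassmannian e) act" by (simp add: fixed_points_def)
next
  fix U assume "U \<in> fixed_points (quiver_grassmannian e) act"
  then have U: "U \<in> subrepresentations e" and fixed: "\<And>z. z \<noteq> 0 \<Longrightarrow> act z U = U"
    by (auto simp: fixed_points_def)
  note U' = subrepresentationD[OF U]
  have "span (b i ` pivots i (U i)) = U i" if i: "i \<in> verts Q" for i
  proof -
    let ?J = "pivots i (U i)"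
    note ch = chart_pivots[OF i U'(1)[OF i] U'(2)[OF i]]
    \<comment> \<open>The single element 2 suffices because it is not a root of unity:
      \<open>2 powi n = 1\<close> forces \<open>n = 0\<close>, while distinct indices have distinct
      weights.\<close>
    have inv: "\<tau> 2 i ` U i = U i" using fixed[of 2] i act_apply[OF i, of 2 U] by simp
    have "reduced i ?J (U i) k = b i k" if k: "k \<in> ?J" for k
    proof (rule c_eqI[OF i reduced_in_V[OF i ch k]])
      have kB: "k \<in> basis_index i" using k pivots_subset by blast
      show "b i k \<in> V i" by (rule b_in_V[OF i kB])
      fix l assume l: "l \<in> basis_index i"
      let ?w = "reduced i ?J (U i) k"
      have eq: "?w = scale (2 powi - wt i k) (\<tau> 2 i ?w)"
        using chart_torus(2)[OF i _ ch pivots_subset k, of 2] unfolding inv by simp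
      have "c i ?w l = 2 powi (wt i l - wt i k) * c i ?w l"
        using c_scale_torus[OF i _ l, of 2 "wt i k" ?w] eq by simp
      then have "c i ?w l = 0 \<or> (2::complex) powi (wt i l - wt i k) = 1" by simp
      moreover have "wt i l = wt i k" if "(2::complex) powi (wt i l - wt i k) = 1"
      proof -
        have "norm ((2::complex) powi (wt i l - wt i k)) = 1" using that by simp
        then have "(2::real) powi (wt i l - wt i k) = 1" by (simp add: norm_power_int)
        then show ?thesis
          using power_int_strict_increasing[of "wt i l - wt i k" 0 "2::real"]
            power_int_strict_increasing[of 0 "wt i l - wt i k" "2::real"] by force
      qed
      moreover have "wt i l \<noteq> wt i k" if "l \<noteq> k"
        using wt_mono[OF i l kB] wt_mono[OF i kB l] that by linarith
      ultimately have "c i ?w l = 0" if "l \<noteq> k" using that by blast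
      then show "c i ?w l = c i (b i k) l"
        using reduced_props(2)[OF i ch k k] c_basis[OF i l kB] by auto
    qed
    then have "reduced i ?J (U i) ` ?J = b i ` ?J" by (rule image_cong[OF refl])
    then show ?thesis using chart_span[OF i ch] by simp
  qed
  then have "coordinate_subspaces (all_pivots U) = U"
    using U'(4) by (intro ext) (simp add: coordinate_subspaces_def all_pivots_def)
  with U show "U \<in> {U \<in> subrepresentations e. coordinate_subspaces (all_pivots U) = U}" by simp
qed

lemma finite_fixed_points: "finite (fixed_points (quiver_grassmannian e) act)"
proof (rule finite_subset)
  show "fixed_points (quiver_grassmannian e) act \<subseteq>
      coordinate_subspaces ` (\<Pi>\<^sub>E i\<in>verts Q. Pow (basis_index i))"
  proof
    fix U assume "U \<in> fixed_points (quiver_grassmannian e) act"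
    then have "U = coordinate_subspaces (all_pivots U)" by (simp add: fixed_points_eq)
    moreover have "all_pivots U \<in> (\<Pi>\<^sub>E i\<in>verts Q. Pow (basis_index i))"
      using pivots_subset by (auto simp: all_pivots_def)
    ultimately show "U \<in> coordinate_subspaces ` (\<Pi>\<^sub>E i\<in>verts Q. Pow (basis_index i))" by blast
  qed
  show "finite (coordinate_subspaces ` (\<Pi>\<^sub>E i\<in>verts Q. Pow (basis_index i)))"
    by (intro finite_imageI finite_PiE) auto
qed

lemma limit_fixed:
  "U \<in> subrepresentations e \<Longrightarrow>
    coordinate_subspaces (all_pivots U) \<in> fixed_points (quiver_grassmannian e) act"
  by (simp add: fixed_points_eq limit_subrepresentation all_pivots_coordinate_subspaces)

subsection \<open>Attracting sets\<close>

context
  fixes e :: "'i \<Rightarrow> int" and U :: "'i \<Rightarrow> 'v set"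
  assumes U: "U \<in> subrepresentations e"
begin

section \<open>The orbit map extended to zero by a curve of frames\<close>

definition reduced_pivot :: "'i \<Rightarrow> nat \<Rightarrow> 'v" where
  "reduced_pivot i k = reduced i (pivots i (U i)) (U i) k"

lemma chart_pivots_sub: "i \<in> verts Q \<Longrightarrow> chart i (pivots i (U i)) (U i)"
  using subrepresentationD[OF U] by (simp add: chart_pivots)

lemma lead_reduced_pivot: "\<lbrakk>i \<in> verts Q; k \<in> pivots i (U i)\<rbrakk> \<Longrightarrow> lead i k (reduced_pivot i k)"
  unfolding reduced_pivot_def using subrepresentationD[OF U] by (simp add: lead_reduced_pivots)

lemma c_reduced_pivot: "\<lbrakk>i \<in> verts Q; k \<in> pivots i (U i)\<rbrakk> \<Longrightarrow> c i (reduced_pivot i k) k = 1"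
  unfolding reduced_pivot_def using reduced_props(2)[OF _ chart_pivots_sub] by simp

text \<open>The normalised basis of \<open>z.U\<close>, with negative exponents truncated by
  \<open>nat\<close>. For a pivot \<open>k\<close> this is harmless, as the entries before the pivot
  are zero. At \<open>z = 0\<close> the convention \<open>0 ^ 0 = 1\<close> keeps the pivot entry,
  and the later entries vanish because their weights are larger.\<close>

definition curve :: "complex \<Rightarrow> 'i \<Rightarrow> nat \<Rightarrow> 'v" where
  "curve z i k = (\<Sum>l\<in>basis_index i.
     scale (z ^ nat (wt i l - wt i k) * c i (reduced_pivot i k) l) (b i l))"

lemma c_curve:
  "\<lbrakk>i \<in> verts Q; l \<in> basis_index i\<rbrakk> \<Longrightarrow>
     c i (curve z i k) l = z ^ nat (wt i l - wt i k) * c i (reduced_pivot i k) l"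
  unfolding curve_def by (simp add: c_basis_sum)

lemma lead_curve:
  assumes i: "i \<in> verts Q" and k: "k \<in> pivots i (U i)"
  shows "lead i k (curve z i k)"
proof -
  have "curve z i k \<in> V i" unfolding curve_def using i by (intro sum_in_V scale_in_V b_in_V)
  then show ?thesis
    using lead_reduced_pivot[OF i k] i by (auto simp: lead_def c_curve)
qed

lemma curve_frame:
  shows "frame_of e (all_pivots U) (curve z) \<in> frames e"
    and "frame_span e (frame_of e (all_pivots U) (curve z)) =
      (\<lambda>i\<in>verts Q. span (curve z i ` pivots i (U i)))"
proof -
  have 1: "finite (all_pivots U i) \<and> int (card (all_pivots U i)) = e i" if "i \<in> verts Q" for i
    using that card_pivots[OF U] by (simp add: all_pivots_apply)
  have 2: "lead i k (curve z i k)" if "i \<in> verts Q" "k \<in> all_pivots U i" for i k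
    using that lead_curve by (simp add: all_pivots_apply)
  show "frame_of e (all_pivots U) (curve z) \<in> frames e"
    by (rule frame_of_lead(1)[OF 1 2])
  have "frame_span e (frame_of e (all_pivots U) (curve z)) =
      (\<lambda>i\<in>verts Q. span (curve z i ` all_pivots U i))"
    by (rule frame_of_lead(2)[OF 1 2])
  also have "\<dots> = (\<lambda>i\<in>verts Q. span (curve z i ` pivots i (U i)))"
    by (intro restrict_ext) (simp add: all_pivots_apply)
  finally show "frame_span e (frame_of e (all_pivots U) (curve z)) =
      (\<lambda>i\<in>verts Q. span (curve z i ` pivots i (U i)))" .
qed

lemma curve_span:
  "frame_span e (frame_of e (all_pivots U) (curve z)) =
     (if z = 0 then coordinate_subspaces (all_pivots U) else act z U)"
proof -
  have "span (curve z i ` pivots i (U i)) =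
      (if z = 0 then span (b i ` pivots i (U i)) else \<tau> z i ` U i)" if i: "i \<in> verts Q" for i
  proof (cases "z = 0")
    case True
    have "curve z i k = b i k" if k: "k \<in> pivots i (U i)" for k
    proof (rule c_eqI[OF i])
      have kB: "k \<in> basis_index i" using k pivots_subset by blast
      show "curve z i k \<in> V i" using lead_curve[OF i k] by (simp add: lead_def)
      show "b i k \<in> V i" by (rule b_in_V[OF i kB])
      fix l assume l: "l \<in> basis_index i"
      show "c i (curve z i k) l = c i (b i k) l"
      proof (cases l k rule: linorder_cases)
        case less
        then show ?thesis
          using lead_reduced_pivot[OF i k] l kB i by (simp add: c_curve lead_def c_basis)
      next
        case equal
        then show ?thesis using c_reduced_pivot[OF i k] kB i by (simp add: c_curve c_basis)
      next
        case greater
        then show ?thesis using wt_mono[OF i kB l] True l kB i by (simp add: c_curve c_basis)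
      qed
    qed
    then have "curve z i ` pivots i (U i) = b i ` pivots i (U i)" by (rule image_cong[OF refl])
    with True show ?thesis by simp
  next
    case False
    note ch = chart_pivots_sub[OF i]
    have "curve z i k = reduced i (pivots i (U i)) (\<tau> z i ` U i) k" if k: "k \<in> pivots i (U i)" for k
      unfolding chart_torus(2)[OF i False ch pivots_subset k]
    proof (rule c_eqI[OF i])
      have kB: "k \<in> basis_index i" using k pivots_subset by blast
      show "curve z i k \<in> V i" using lead_curve[OF i k] by (simp add: lead_def)
      show "scale (z powi - wt i k) (\<tau> z i (reduced i (pivots i (U i)) (U i) k)) \<in> V i"
        using i by (intro scale_in_V torus_in_V)
      fix l assume l: "l \<in> basis_index i"
      show "c i (curve z i k) l =
          c i (scale (z powi - wt i k) (\<tau> z i (reduced i (pivots i (U i)) (U i) k))) l"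
        unfolding c_scale_torus[OF i False l] c_curve[OF i l]
      proof (cases "l < k")
        case True
        then have "c i (reduced_pivot i k) l = 0"
          using lead_reduced_pivot[OF i k] l by (simp add: lead_def)
        then show "z ^ nat (wt i l - wt i k) * c i (reduced_pivot i k) l =
          z powi (wt i l - wt i k) * c i (reduced i (pivots i (U i)) (U i) k) l"
          by (simp add: reduced_pivot_def)
      next
        case ge: False
        then have "wt i k \<le> wt i l"
          using wt_mono[OF i kB l] by (cases "l = k") auto
        then have "z powi (wt i l - wt i k) = z ^ nat (wt i l - wt i k)"
          by (simp add: power_int_def)
        then show "z ^ nat (wt i l - wt i k) * c i (reduced_pivot i k) l =
          z powi (wt i l - wt i k) * c i (reduced i (pivots i (U i)) (U i) k) l"
          by (simp add: reduced_pivot_def)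
      qed
    qed
    then have "curve z i ` pivots i (U i) =
        reduced i (pivots i (U i)) (\<tau> z i ` U i) ` pivots i (U i)"
      by (rule image_cong[OF refl])
    then show ?thesis
      using False chart_span[OF i chart_torus(1)[OF i False ch pivots_subset] finite_pivots] by simp
  qed
  then have "(\<lambda>i\<in>verts Q. span (curve z i ` pivots i (U i))) =
      (if z = 0 then coordinate_subspaces (all_pivots U) else act z U)"
    by (auto simp: coordinate_subspaces_def torus_action_def all_pivots_apply intro!: restrict_ext)
  then show ?thesis using curve_frame(2)[of z] by simp
qed

text \<open>The curve of frames has entries polynomial in \<open>z\<close>, so its span is a
  morphism on the whole affine line that extends the orbit map.\<close>

lemma limit_at_zero_pivots:
  "limit_at_zero (quiver_grassmannian e) act U (coordinate_subspaces (all_pivots U))"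
  unfolding limit_at_zero_def affine_line_def curve_span[symmetric]
proof (rule frame_morphism)
  show "frame_of e (all_pivots U) (curve z) \<in> frames e" for z by (rule curve_frame)
  show "frame_span e (frame_of e (all_pivots U) (curve z)) \<in> subrepresentations e" for z
    unfolding curve_span using U limit_subrepresentation act_subrepresentation by simp
  fix i s l assume i: "i \<in> verts Q" "s < nat (e i)" "l \<in> basis_index i"
  have "(\<lambda>z. c i (frame_of e (all_pivots U) (curve z) (i, s)) l) =
    (\<lambda>z. z ^ nat (wt i l - wt i (enum (all_pivots U i) s)) *
      c i (reduced_pivot i (enum (all_pivots U i) s)) l)"
    using i by (simp add: frame_of_apply c_curve)
  also have "\<dots> \<in> polynomial_functions {\<lambda>z. z}"
    by (intro polynomial_functions.mult polynomial_functions_power polynomial_functions.const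
        polynomial_functions.coordinate) simp
  finally show "(\<lambda>z. c i (frame_of e (all_pivots U) (curve z) (i, s)) l) \<in> polynomial_functions {\<lambda>z. z}" .
qed

text \<open>
  On the chart around a fixed point the coordinates of \<open>z.U\<close> are those of \<open>U\<close>, scaled by
  powers of \<open>z\<close>. If the limit is the fixed point then they are rational in \<open>z\<close> and vanish at
  \<open>0\<close>, so the coordinates with a negative exponent are zero.
\<close>

lemma limit_at_zero_imp_pivots:
  assumes y: "y \<in> fixed_points (quiver_grassmannian e) act"
    and lim: "limit_at_zero (quiver_grassmannian e) act U y"
  shows "all_pivots U = all_pivots y"
proof -
  let ?I = "all_pivots y" and ?G = "grassmannian_product_variety e"
  let ?S = "subrepresentations e" and ?X = "quiver_grassmannian e"
  let ?\<phi> = "\<lambda>z. if z = 0 then y else act z U"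
  have yS: "y \<in> ?S" and yE: "coordinate_subspaces ?I = y" using y by (auto simp: fixed_points_eq)
  have I: "?I i \<subseteq> basis_index i \<and> card (?I i) = nat (e i)" if "i \<in> verts Q" for i
    by (rule charts_index[OF yS that])
  have yi: "y i = span (b i ` ?I i)" if "i \<in> verts Q" for i
    using fun_cong[OF yE, of i] that by (simp add: coordinate_subspaces_def)
  have SG: "?S \<subseteq> grassmannian_product e" by (auto simp: subrepresentations_def)
  have ych: "y \<in> charts e ?I"
    using yS SG I by (auto simp: charts_def yi chart_coordinate(1))
  let ?D = "charts e ?I \<inter> ?S" and ?P = "{z. ?\<phi> z \<in> charts e ?I \<inter> ?S}"
  have mor: "variety_morphism affine_line ?X ?\<phi>" using lim by (simp add: limit_at_zero_def)
  have oD: "openin (zariski ?X) ?D"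
    unfolding quiver_grassmannian_def zariski_fsubspace openin_subtopology
    using openin_charts[OF I] by blast
  have oP: "openin (zariski affine_line) ?P"
    using variety_morphism_openin[OF mor oD] by (simp add: affine_line_def)
  have "0 \<in> ?P" using ych yS by simp
  then obtain p where p: "p \<in> polynomial_functions {\<lambda>z. z}" "p 0 \<noteq> 0" "{z \<in> UNIV. p z \<noteq> 0} \<subseteq> ?P"
    by (rule openin_coordinate_spaceE[OF oP[unfolded affine_line_def]])
  \<comment> \<open>Passage to the usual topology: polynomials are continuous, so one that is
    non-zero at 0 is non-zero at all nearby points.\<close>
  have near: "eventually (\<lambda>z. q z \<noteq> 0) (at 0)"
    if "q \<in> polynomial_functions {\<lambda>z. z}" "q 0 \<noteq> 0" for q :: "complex \<Rightarrow> complex"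
  proof -
    have "isCont q 0"
      using polynomial_functions_continuous[OF that(1)] by (simp add: continuous_on_eq_continuous_at)
    then have "(q \<longlongrightarrow> q 0) (at 0)" by (simp add: isCont_def)
    then show ?thesis using that(2) by (rule tendsto_imp_eventually_ne)
  qed
  have nz: "eventually (\<lambda>z::complex. z \<noteq> 0) (at 0)" by (simp add: eventually_at_filter)
  have "eventually (\<lambda>z. p z \<noteq> 0 \<and> z \<noteq> 0) (at 0)"
    using near[OF p(1,2)] nz by (rule eventually_conj)
  \<comment> \<open>Charts are torus-stable, so one non-zero \<open>z0\<close> whose translate lies
    in the chart already places \<open>U\<close> there.\<close>
  then obtain z0 where z0: "p z0 \<noteq> 0" "z0 \<noteq> 0"
    using eventually_happens'[OF at_neq_bot] by blast
  have ch: "chart i (?I i) (U i)" if i: "i \<in> verts Q" for i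
  proof -
    have "act z0 U \<in> charts e ?I" using p(3) z0 by auto
    then have "chart i (?I i) (\<tau> z0 i ` U i)" using i by (auto simp: charts_def act_apply)
    then show ?thesis
      using chart_torus_iff[OF i z0(2)] subrepresentationD(2)[OF U i] I[OF i] by blast
  qed
  have lead: "lead i k (reduced i (?I i) (U i) k)" if i: "i \<in> verts Q" and k: "k \<in> ?I i" for i k
  proof -
    let ?w = "reduced i (?I i) (U i) k"
    have kB: "k \<in> basis_index i" using I[OF i] k by blast
    have "c i ?w l = 0" if l: "l \<in> basis_index i" "l < k" for l
    proof (rule ccontr)
      assume ne: "c i ?w l \<noteq> 0"
      let ?g = "\<lambda>U. c i (reduced i (?I i) (U i) k) l"
      have "?g \<in> regular ?X ?D"
        unfolding quiver_grassmannian_def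
        by (rule regular_fsubspaceI[OF openin_charts[OF I] reduced_coordinate_regular[OF I i k]]) auto
      from variety_morphism_regular[OF mor oD this]
      have "?g \<circ> ?\<phi> \<in> regular affine_line ?P" by (simp add: affine_line_def comp_def)
      then obtain p' q where pq: "p' \<in> polynomial_functions {\<lambda>z. z}" "q \<in> polynomial_functions {\<lambda>z. z}"
        "q 0 \<noteq> 0" "\<forall>z\<in>?P. q z \<noteq> 0 \<longrightarrow> (?g \<circ> ?\<phi>) z = p' z / q z"
        unfolding affine_line_def using \<open>0 \<in> ?P\<close> by (rule regular_coordinate_spaceE)
      have "?g y = 0"
        using chart_coordinate(3)[OF i _ k] I[OF i] l kB i k by (simp add: yi c_basis)
      moreover have "(?g \<circ> ?\<phi>) 0 = p' 0 / q 0" using bspec[OF pq(4) \<open>0 \<in> ?P\<close>] pq(3) by blast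
      ultimately have p'0: "p' 0 = 0" using pq(3) by simp
      have "isCont (\<lambda>z. p' z / q z) 0"
        using polynomial_functions_continuous[OF pq(1)] polynomial_functions_continuous[OF pq(2)] pq(3)
        by (auto simp: continuous_on_eq_continuous_at intro!: continuous_intros)
      then have "((\<lambda>z. p' z / q z) \<longlongrightarrow> 0) (at 0)" using p'0 by (simp add: isCont_def)
      then have small: "eventually (\<lambda>z. norm (p' z / q z) < norm (c i ?w l)) (at 0)"
        using ne by (auto dest: tendstoD[of _ _ _ "norm (c i ?w l)"] simp: dist_norm)
      have ball: "eventually (\<lambda>z::complex. norm z < 1) (at 0)"
        using eventually_at_ball[of 1 "0::complex" UNIV] by (auto elim: eventually_mono)
      have "eventually (\<lambda>z. (p z \<noteq> 0 \<and> q z \<noteq> 0) \<and> (z \<noteq> 0 \<and> norm z < 1) \<and>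
          norm (p' z / q z) < norm (c i ?w l)) (at 0)"
        by (intro eventually_conj near p pq nz small ball)
      then obtain z where z: "p z \<noteq> 0" "q z \<noteq> 0" "z \<noteq> 0" "norm z < 1"
        "norm (p' z / q z) < norm (c i ?w l)"
        using eventually_happens'[OF at_neq_bot] by blast
      have "z \<in> ?P" using p(3) z(1) by blast
      then have "(?g \<circ> ?\<phi>) z = p' z / q z" using bspec[OF pq(4)] z(2) by blast
      then have "p' z / q z = ?g (act z U)" using z(3) by simp
      also have "\<dots> = z powi (wt i l - wt i k) * c i ?w l"
        using chart_torus(2)[OF i z(3) ch[OF i] _ k] I[OF i] i
          c_scale_torus[OF i z(3) l(1)]
        by (simp add: act_apply)
      finally have "norm (p' z / q z) = norm z powi (wt i l - wt i k) * norm (c i ?w l)"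
        by (simp add: norm_mult norm_power_int)
      \<comment> \<open>Indices before \<open>k\<close> have smaller weight, so the exponent is
        negative; as \<open>norm z < 1\<close>, the coordinate cannot shrink towards 0.\<close>
      moreover have "1 \<le> norm z powi (wt i l - wt i k)"
        using power_int_decreasing[of "wt i l - wt i k" 0 "norm z"] wt_mono[OF i l(1) kB l(2)] z(3,4)
        by simp
      ultimately have "norm (c i ?w l) \<le> norm (p' z / q z)"
        using mult_right_mono[of 1 "norm z powi (wt i l - wt i k)" "norm (c i ?w l)"] by simp
      with z(5) show False by simp
    qed
    then show ?thesis
      using reduced_props(2)[OF i ch[OF i] k k] reduced_in_V[OF i ch[OF i] k] kB
      by (auto simp: lead_def)
  qed
  have "pivots i (U i) = ?I i" if i: "i \<in> verts Q" for i
  proof -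
    have fin: "finite (?I i)" using I[OF i] finite_subset finite_basis_index by blast
    show ?thesis
      using lead_family(3)[OF i fin lead[OF i]] chart_span[OF i ch[OF i] fin] by simp
  qed
  then show ?thesis
    unfolding all_pivots_def[of U] by (intro ext) (auto simp: all_pivots_def)
qed

end

lemma attracting_set_eq:
  assumes y: "y \<in> fixed_points (quiver_grassmannian e) act"
  shows "attracting_set (quiver_grassmannian e) act y =
    {U \<in> subrepresentations e. all_pivots U = all_pivots y}"
proof -
  have "coordinate_subspaces (all_pivots y) = y" using y by (simp add: fixed_points_eq)
  then have "limit_at_zero (quiver_grassmannian e) act U y"
    if "U \<in> subrepresentations e" "all_pivots U = all_pivots y" for U
    using limit_at_zero_pivots[OF that(1)] that(2) by simp
  then show ?thesis
    using limit_at_zero_imp_pivots y by (auto simp: attracting_set_def)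
qed

subsection \<open>The order of the cells\<close>

definition total_weight :: "('i \<Rightarrow> 'v set) \<Rightarrow> nat" where
  "total_weight U = (\<Sum>i\<in>verts Q. weight i (pivots i (U i)))"

text \<open>By \<open>chart_weight\<close> the weight drops at no vertex and grows strictly at each
  vertex where the pivots differ, so the sum compares all vertices at once.\<close>

lemma charts_total_weight:
  assumes U: "U \<in> subrepresentations e" and y: "y \<in> subrepresentations e"
    and ch: "U \<in> charts e (all_pivots y)"
  shows "all_pivots U = all_pivots y \<or> total_weight y < total_weight U"
proof (cases "\<forall>i\<in>verts Q. pivots i (U i) = pivots i (y i)")
  case True
  then show ?thesis by (auto simp: all_pivots_def intro!: restrict_ext)
next
  case False
  then obtain j where j: "j \<in> verts Q" "pivots j (U j) \<noteq> pivots j (y j)" by blast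
  have chi: "chart i (pivots i (y i)) (U i)" if "i \<in> verts Q" for i
    using ch that by (auto simp: charts_def all_pivots_apply)
  have le: "weight i (pivots i (y i)) \<le> weight i (pivots i (U i))" if "i \<in> verts Q" for i
    using chart_weight[OF that chi[OF that] pivots_subset]
    by (cases "pivots i (U i) = pivots i (y i)") auto
  have "weight j (pivots j (y j)) < weight j (pivots j (U j))"
    by (rule chart_weight[OF j(1) chi[OF j(1)] pivots_subset j(2)])
  then have "total_weight y < total_weight U"
    unfolding total_weight_def using j(1) le by (intro sum_strict_mono_ex1) auto
  then show ?thesis ..
qed

lemma alpha_partition_attracting_sets:
  "alpha_partition (quiver_grassmannian e) (fixed_points (quiver_grassmannian e) act)
     (attracting_set (quiver_grassmannian e) act)"
proof -
  let ?X = "quiver_grassmannian e" and ?S = "subrepresentations e"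
  let ?W = "attracting_set ?X act" and ?F = "fixed_points ?X act"
  let ?E = "\<lambda>U. coordinate_subspaces (all_pivots U)"
  have W: "U \<in> ?W y \<longleftrightarrow> U \<in> ?S \<and> ?E U = y" if y: "y \<in> ?F" for U y
  proof -
    have "?E y = y" using y by (simp add: fixed_points_eq)
    moreover have "all_pivots U = all_pivots y" if "?E U = y"
      using that all_pivots_coordinate_subspaces by metis
    ultimately show ?thesis unfolding attracting_set_eq[OF y] by auto
  qed
  have EF: "?E U \<in> ?F" if "U \<in> ?S" for U using limit_fixed[OF that] .
  have FS: "y \<in> ?S" if "y \<in> ?F" for y using that by (simp add: fixed_points_eq)
  obtain ys where ys: "set ys = ?F" "distinct ys"
    using finite_distinct_list[OF finite_fixed_points] by blast
  \<comment> \<open>With ascending total weight, the chart around a later point meets no cell of an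
    earlier one. Ties are harmless: inside a chart only equal pivots or a strictly larger weight
    occur.\<close>
  define xs where "xs = sort_key total_weight ys"
  have xs: "set xs = ?F" "distinct xs" and sorted: "sorted (map total_weight xs)"
    using ys by (simp_all add: xs_def)
  have "closedin (zariski ?X) (\<Union>y\<in>set (take s xs). ?W y)" if s: "s \<le> length xs" for s
  proof -
    \<comment> \<open>The intended complement: the charts around the remaining fixed points cover
      their cells and avoid all earlier ones.\<close>
    let ?C = "\<Union>y\<in>set (drop s xs). charts e (all_pivots y)"
    have sub: "set (take s xs) \<subseteq> ?F" "set (drop s xs) \<subseteq> ?F"
      using set_take_subset set_drop_subset xs(1) by metis+
    have ch: "openin (zariski (grassmannian_product_variety e)) (charts e (all_pivots y))"
      if "y \<in> ?F" for y
      by (rule openin_charts[OF charts_index[OF FS[OF that]]])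
    then have "openin (zariski (grassmannian_product_variety e)) ?C"
      using sub by (intro openin_Union) auto
    then have op: "openin (zariski ?X) (?C \<inter> ?S)"
      unfolding quiver_grassmannian_def zariski_fsubspace openin_subtopology by blast
    have split: "set (take s xs) \<union> set (drop s xs) = ?F"
      using xs(1) by (metis append_take_drop_id set_append)
    have disj: "set (take s xs) \<inter> set (drop s xs) = {}"
      using xs(2) by (metis append_take_drop_id distinct_append)
    have "(\<Union>y\<in>set (take s xs). ?W y) = ?S - (?C \<inter> ?S)"
    proof (intro equalityI subsetI)
      fix U assume "U \<in> (\<Union>y\<in>set (take s xs). ?W y)"
      then have U: "U \<in> ?S" and EU: "?E U \<in> set (take s xs)"
        using W sub by auto
      have "U \<notin> charts e (all_pivots y)" if y: "y \<in> set (drop s xs)" for y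
      proof
        assume Uy: "U \<in> charts e (all_pivots y)"
        have yF: "y \<in> ?F" using y sub by blast
        have "total_weight (?E U) \<le> total_weight y"
        proof -
          have "sorted (map total_weight (take s xs) @ map total_weight (drop s xs))"
            using sorted by (simp flip: map_append)
          then show ?thesis using EU y unfolding sorted_append by auto
        qed
        moreover have "total_weight (?E U) = total_weight U"
          unfolding total_weight_def
          by (intro sum.cong) (auto simp: coordinate_subspaces_apply all_pivots_apply
              chart_coordinate(2) pivots_subset)
        ultimately have "all_pivots U = all_pivots y"
          using charts_total_weight[OF U FS[OF yF] Uy] by auto
        then have "?E U = y" using yF by (simp add: fixed_points_eq)
        with EU y disj show False by blast
      qed
      with U show "U \<in> ?S - (?C \<inter> ?S)" by blast
    next
      fix U assume U: "U \<in> ?S - (?C \<inter> ?S)"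
      have "U \<in> charts e (all_pivots (?E U))"
        using U unfolding all_pivots_coordinate_subspaces
        by (auto simp: charts_def all_pivots_apply chart_pivots_sub subrepresentations_def)
      then have "?E U \<notin> set (drop s xs)" using U by blast
      then have "?E U \<in> set (take s xs)" using split EF U by blast
      then show "U \<in> (\<Union>y\<in>set (take s xs). ?W y)" using W sub U by blast
    qed
    moreover have "?S - (?S - (?C \<inter> ?S)) = ?C \<inter> ?S" by blast
    ultimately show ?thesis using op by (simp add: closedin_def)
  qed
  moreover have "(\<Union>y\<in>?F. ?W y) = points ?X"
    using W EF by auto
  moreover have "disjoint_family_on ?W ?F"
    using W by (auto simp: disjoint_family_on_def)
  ultimately show ?thesis
    unfolding alpha_partition_def using xs by blast
qed

section \<open>Cells\<close>

text \<open>
  A cell is parametrised by the rows of the reduced basis that are not images of other rows: if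
  \<open>step a k l\<close> with \<open>k\<close> a pivot then the basis vector with pivot \<open>l\<close> is taken to be the
  image of the one with pivot \<open>k\<close>. The resulting basis is affine linear in the parameters, but in
  general not reduced.
\<close>

context
  fixes e :: "'i \<Rightarrow> int" and I :: "'i \<Rightarrow> nat set"
  assumes I: "\<And>i. i \<in> verts Q \<Longrightarrow> I i \<subseteq> basis_index i \<and> int (card (I i)) = e i"
    and I_step: "\<And>a k l. \<lbrakk>step a k l; k \<in> I (tail Q a)\<rbrakk> \<Longrightarrow> l \<in> I (head Q a)"
begin

lemma finite_pivot_set: "i \<in> verts Q \<Longrightarrow> finite (I i)"
  using I[of i] finite_subset[of "I i" "basis_index i"] by simp

text \<open>The pair \<open>p\<close> of an arrow and an index names a pivot over the tail whose
  image is \<open>q\<close>. Predecessors in the coefficient quiver that are not pivots do not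
  count.\<close>

definition pred :: "'i \<times> nat \<Rightarrow> 'a \<times> nat \<Rightarrow> bool" where
  "pred q p \<longleftrightarrow> step (fst p) (snd p) (snd q) \<and> head Q (fst p) = fst q \<and> snd p \<in> I (tail Q (fst p))"

text \<open>The free entries of a reduced row: later positions that are not pivots, taken only in
  rows that are not forced to be images. Their number is the dimension of the cell.\<close>

definition cell_params :: "('i \<times> nat \<times> nat) set" where
  "cell_params = {(i, k, l). i \<in> verts Q \<and> k \<in> I i \<and> (\<nexists>p. pred (i, k) p) \<and>
     l \<in> basis_index i \<and> k < l \<and> l \<notin> I i}"

definition param_index :: "'i \<times> nat \<times> nat \<Rightarrow> nat" where
  "param_index = (SOME h. bij_betw h cell_params {0..<card cell_params})"

definition start_vector :: "(nat \<Rightarrow> complex) \<Rightarrow> 'i \<Rightarrow> nat \<Rightarrow> 'v" where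
  "start_vector t i k = (\<Sum>l\<in>basis_index i. scale (if l = k then 1
     else if k < l \<and> l \<notin> I i then t (param_index (i, k, l)) else 0) (b i l))"

text \<open>The recursion uses \<open>wfrec\<close> since its termination is a fact about the
  coefficient quiver, \<open>wf_step\<close>. The choice by \<open>SOME\<close> is unambiguous, as
  \<open>step_unique\<close> leaves at most one predecessor.\<close>

definition generator :: "(nat \<Rightarrow> complex) \<Rightarrow> 'i \<times> nat \<Rightarrow> 'v" where
  "generator t = wfrec {((tail Q a, k), (head Q a, l)) | a k l. step a k l}
     (\<lambda>g q. if \<exists>p. pred q p
        then let p = (SOME p. pred q p) in f (fst p) (g (tail Q (fst p), snd p))
        else start_vector t (fst q) (snd q))"

definition cell_map :: "(nat \<Rightarrow> complex) \<Rightarrow> 'i \<Rightarrow> 'v set" where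
  "cell_map t = frame_span e (frame_of e I (\<lambda>i k. generator t (i, k)))"

lemma bij_param_index: "bij_betw param_index cell_params {..<card cell_params}"
proof -
  have "cell_params \<subseteq> (\<Union>i\<in>verts Q. {i} \<times> basis_index i \<times> basis_index i)"
    using I by (auto simp: cell_params_def)
  moreover have "finite (\<Union>i\<in>verts Q. {i} \<times> basis_index i \<times> basis_index i)" by simp
  ultimately have "finite cell_params" by (rule finite_subset)
  then have "\<exists>h. bij_betw h cell_params {0..<card cell_params}" by (rule ex_bij_betw_finite_nat)
  then show ?thesis unfolding param_index_def lessThan_atLeast0 by (rule someI_ex)
qed

lemma param_index_cases:
  assumes "m < card cell_params"
  obtains i k l where "(i, k, l) \<in> cell_params" "param_index (i, k, l) = m"
proof -
  have "m \<in> param_index ` cell_params"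
    using assms bij_betw_imp_surj_on[OF bij_param_index] by simp
  then show thesis using that by auto
qed

lemma generator_start:
  assumes "\<nexists>p. pred (i, k) p"
  shows "generator t (i, k) = start_vector t i k"
  unfolding generator_def by (subst wfrec[OF wf_step]) (use assms in simp)

lemma generator_step:
  assumes st: "step a k l" and k: "k \<in> I (tail Q a)"
  shows "generator t (head Q a, l) = f a (generator t (tail Q a, k))"
proof -
  let ?R = "{((tail Q a, k), (head Q a, l)) | a k l. step a k l}"
  have p: "pred (head Q a, l) (a, k)" using assms by (simp add: pred_def)
  have "p = (a, k)" if "pred (head Q a, l) p" for p
    using step_unique[OF _ st, of "fst p" "snd p"] that by (cases p) (simp add: pred_def)
  then have some: "(SOME p. pred (head Q a, l) p) = (a, k)" using p by (intro some_equality)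
  have "((tail Q a, k), (head Q a, l)) \<in> ?R" using st by blast
  then show ?thesis
    unfolding generator_def
    by (subst wfrec[OF wf_step]) (use p in \<open>auto simp: some cut_apply\<close>)
qed

text \<open>Every pivot is reached by finitely many steps from a pivot without predecessor; this is
  \<open>wf_step\<close> in the form matching the recursion.\<close>

lemma generator_induct [consumes 2, case_names start step]:
  assumes "i \<in> verts Q" "k \<in> I i"
    and start: "\<And>i k. \<lbrakk>i \<in> verts Q; k \<in> I i; \<nexists>p. pred (i, k) p\<rbrakk> \<Longrightarrow> P i k"
    and step: "\<And>a k l. \<lbrakk>step a k l; k \<in> I (tail Q a); P (tail Q a) k\<rbrakk> \<Longrightarrow> P (head Q a) l"
  shows "P i k"
proof -
  have "fst q \<in> verts Q \<Longrightarrow> snd q \<in> I (fst q) \<Longrightarrow> P (fst q) (snd q)" for q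
    using wf_step
  proof (induction q rule: wf_induct_rule)
    case (less q)
    show ?case
    proof (cases "\<exists>p. pred q p")
      case False
      then show ?thesis using start[of "fst q" "snd q"] less.prems by simp
    next
      case True
      then obtain p where p: "pred q p" by blast
      then have st: "step (fst p) (snd p) (snd q)" "head Q (fst p) = fst q" "snd p \<in> I (tail Q (fst p))"
        by (auto simp: pred_def)
      have "((tail Q (fst p), snd p), q) \<in> {((tail Q a, k), (head Q a, l)) | a k l. step a k l}"
        using st(1,2) by (cases q) force
      moreover have "tail Q (fst p) \<in> verts Q" using st(1) by (simp add: step_def)
      ultimately have "P (tail Q (fst p)) (snd p)" using less.IH[of "(tail Q (fst p), snd p)"] st(3) by simp
      then show ?thesis using step[OF st(1,3)] st(2) by simp
    qed
  qed
  from this[of "(i, k)"] show ?thesis using assms(1,2) by simp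
qed

lemma c_start_vector:
  assumes "i \<in> verts Q" "l \<in> basis_index i"
  shows "c i (start_vector t i k) l =
    (if l = k then 1 else if k < l \<and> l \<notin> I i then t (param_index (i, k, l)) else 0)"
  unfolding start_vector_def using c_basis_sum[OF assms(1) subset_refl assms(2)] assms(2) by simp

lemma start_vector_in_V: "i \<in> verts Q \<Longrightarrow> start_vector t i k \<in> V i"
  unfolding start_vector_def by (intro sum_in_V scale_in_V b_in_V)

text \<open>Start vectors have the right pivot by construction, and \<open>lead_f\<close> carries it
  along each step.\<close>

lemma lead_generator:
  assumes "i \<in> verts Q" "k \<in> I i"
  shows "lead i k (generator t (i, k))"
  using assms
proof (induction rule: generator_induct)
  case (start i k)
  have "k \<in> basis_index i" using I[OF start(1)] start(2) by blast
  then show ?case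
    using start by (auto simp: generator_start lead_def c_start_vector start_vector_in_V)
next
  case (step a k l)
  then show ?case using lead_f[OF step(3,1)] by (simp add: generator_step)
qed

text \<open>An arrow acts by a constant matrix, so polynomial entries of a row give polynomial
  entries of its image.\<close>

lemma generator_polynomial:
  assumes "i \<in> verts Q" "k \<in> I i" "l \<in> basis_index i"
  shows "(\<lambda>t. c i (generator t (i, k)) l) \<in> polynomial_functions {(\<lambda>x. x m) | m. m < card cell_params}"
  using assms
proof (induction arbitrary: l rule: generator_induct)
  case (start i k)
  have "(\<lambda>t. c i (generator t (i, k)) l) = (\<lambda>t. if l = k then 1
      else if k < l \<and> l \<notin> I i then t (param_index (i, k, l)) else 0)"
    using start by (simp add: generator_start c_start_vector)
  also have "\<dots> \<in> polynomial_functions {(\<lambda>x. x m) | m. m < card cell_params}"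
  proof (cases "l = k \<or> \<not> (k < l \<and> l \<notin> I i)")
    case True
    then show ?thesis by (cases "l = k") (auto simp: polynomial_functions.const)
  next
    case False
    then have "(i, k, l) \<in> cell_params" using start by (simp add: cell_params_def)
    then have "param_index (i, k, l) < card cell_params" using bij_betwE[OF bij_param_index] by blast
    then have "(\<lambda>t. t (param_index (i, k, l))) \<in> polynomial_functions {(\<lambda>x. x m) | m. m < card cell_params}"
      by (intro polynomial_functions.coordinate) blast
    then show ?thesis using False by simp
  qed
  finally show ?case .
next
  case (step a k l l')
  have a: "a \<in> arcs Q" using step(1) by (simp add: step_def)
  have "generator t (tail Q a, k) \<in> V (tail Q a)" for t
    using lead_generator[OF tail_in_verts[OF a] step(2)] by (simp add: lead_def)
  then have "(\<lambda>t. c (head Q a) (generator t (head Q a, l)) l') =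
    (\<lambda>t. \<Sum>m\<in>basis_index (tail Q a). c (tail Q a) (generator t (tail Q a, k)) m *
      c (head Q a) (f a (b (tail Q a) m)) l')"
    using step(1,2) by (simp add: generator_step c_f[OF a])
  also have "\<dots> \<in> polynomial_functions {(\<lambda>x. x m) | m. m < card cell_params}"
    by (intro polynomial_functions_sum polynomial_functions.mult step.IH polynomial_functions.const)
  finally show ?case .
qed

lemma cell_map_facts:
  shows cell_map_frame: "frame_of e I (\<lambda>i k. generator t (i, k)) \<in> frames e"
    and cell_map_apply: "i \<in> verts Q \<Longrightarrow> cell_map t i = span ((\<lambda>k. generator t (i, k)) ` I i)"
    and cell_map_undefined: "i \<notin> verts Q \<Longrightarrow> cell_map t i = undefined"
proof -
  have 1: "finite (I i) \<and> int (card (I i)) = e i" if "i \<in> verts Q" for i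
    using I[OF that] finite_pivot_set[OF that] by simp
  show "frame_of e I (\<lambda>i k. generator t (i, k)) \<in> frames e"
    by (rule frame_of_lead(1)[OF 1 lead_generator])
  have "cell_map t = (\<lambda>i\<in>verts Q. span ((\<lambda>k. generator t (i, k)) ` I i))"
    unfolding cell_map_def by (rule frame_of_lead(2)[OF 1 lead_generator])
  then show "i \<in> verts Q \<Longrightarrow> cell_map t i = span ((\<lambda>k. generator t (i, k)) ` I i)"
    and "i \<notin> verts Q \<Longrightarrow> cell_map t i = undefined" by simp_all
qed

lemma pivots_cell_map: "i \<in> verts Q \<Longrightarrow> pivots i (cell_map t i) = I i"
  by (simp add: cell_map_apply lead_family(3)[OF _ finite_pivot_set lead_generator])

lemma subspace_cell_map: "i \<in> verts Q \<Longrightarrow> subspace (cell_map t i)"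
  by (simp add: cell_map_apply)

lemma cell_map_subset:
  assumes "i \<in> verts Q"
  shows "cell_map t i \<subseteq> V i"
  unfolding cell_map_apply[OF assms]
  using lead_generator[OF assms] by (intro span_minimal subspace_V[OF assms]) (auto simp: lead_def)

lemma chart_cell_map:
  assumes "i \<in> verts Q"
  shows "chart i (I i) (cell_map t i)"
  using chart_pivots[OF assms subspace_cell_map[OF assms] cell_map_subset[OF assms]]
  unfolding pivots_cell_map[OF assms] .

lemma generator_in_cell_map:
  "\<lbrakk>i \<in> verts Q; k \<in> I i\<rbrakk> \<Longrightarrow> generator t (i, k) \<in> cell_map t i"
  by (simp add: cell_map_apply span_base)

text \<open>An arrow sends a generator to zero if it kills the basis vector of its pivot, by
  \<open>lead_f_zero\<close>, and otherwise to another generator, by construction. Then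
  \<open>I_step\<close> keeps the new pivot in the index set.\<close>

lemma cell_map_subrepresentation: "cell_map t \<in> subrepresentations e"
proof (rule subrepresentationI)
  show "subspace (cell_map t i)" "cell_map t i \<subseteq> V i" if "i \<in> verts Q" for i
    using that by (simp_all add: subspace_cell_map cell_map_subset)
  show "int (dim (cell_map t i)) = e i" if "i \<in> verts Q" for i
    using chart_dim[OF that chart_cell_map[OF that] finite_pivot_set[OF that]] I[OF that] by simp
  show "cell_map t i = undefined" if "i \<notin> verts Q" for i by (rule cell_map_undefined[OF that])
  fix a x assume a: "a \<in> arcs Q" and x: "x \<in> cell_map t (tail Q a)"
  let ?i = "tail Q a" and ?j = "head Q a"
  have i: "?i \<in> verts Q" and j: "?j \<in> verts Q" using a by auto
  obtain r where r: "x = (\<Sum>k\<in>I ?i. scale (r k) (generator t (?i, k)))"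
    using x unfolding cell_map_apply[OF i] span_image_eq[OF finite_pivot_set[OF i]] by blast
  have gV: "generator t (?i, k) \<in> V ?i" if "k \<in> I ?i" for k
    using lead_generator[OF i that] by (simp add: lead_def)
  have "f a x = (\<Sum>k\<in>I ?i. f a (scale (r k) (generator t (?i, k))))"
    unfolding r using a i gV by (intro f_sum scale_in_V)
  also have "\<dots> \<in> cell_map t ?j"
  proof (rule subspace_sum[OF subspace_cell_map[OF j]])
    fix k assume k: "k \<in> I ?i"
    then have kB: "k \<in> basis_index ?i" using I[OF i] by blast
    have "f a (generator t (?i, k)) \<in> cell_map t ?j"
    proof (cases rule: step_cases[OF a kB])
      case 1
      then show ?thesis
        using lead_f_zero[OF lead_generator[OF i k] a] subspace_0[OF subspace_cell_map[OF j]] by simp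
    next
      case (2 l)
      then show ?thesis
        using generator_step[OF 2 k] generator_in_cell_map[OF j I_step[OF 2 k]] by simp
    qed
    then show "f a (scale (r k) (generator t (?i, k))) \<in> cell_map t ?j"
      using map_scale[OF a gV[OF k]] subspace_scale[OF subspace_cell_map[OF j]] by simp
  qed
  finally show "f a x \<in> cell_map t ?j" .
qed

definition cell :: "('i \<Rightarrow> 'v set) set" where
  "cell = {U \<in> subrepresentations e. \<forall>i\<in>verts Q. pivots i (U i) = I i}"

text \<open>Entries are read from the reduced basis, because these are known to be regular on the
  chart at \<open>I\<close>.\<close>

definition cell_coordinates :: "('i \<Rightarrow> 'v set) \<Rightarrow> nat \<Rightarrow> complex" where
  "cell_coordinates U = (\<lambda>m\<in>{..<card cell_params}.
     case the_inv_into cell_params param_index m of (i, k, l) \<Rightarrow> c i (reduced i (I i) (U i) k) l)"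

lemma cell_coordinates_apply:
  assumes "(i, k, l) \<in> cell_params"
  shows "cell_coordinates U (param_index (i, k, l)) = c i (reduced i (I i) (U i) k) l"
  using assms bij_param_index bij_betwE[OF bij_param_index]
  by (simp add: cell_coordinates_def bij_betw_def the_inv_into_f_f)

lemma chart_cell: "\<lbrakk>U \<in> cell; i \<in> verts Q\<rbrakk> \<Longrightarrow> chart i (I i) (U i)"
  using chart_pivots_sub[of U e i] by (auto simp: cell_def)

lemma cell_map_in_cell: "cell_map t \<in> cell"
  using cell_map_subrepresentation by (simp add: cell_def pivots_cell_map)

text \<open>A start vector vanishes at all other pivots, so it is already the reduced vector for its
  pivot, although generators obtained as images need not be.\<close>

lemma cell_coordinates_cell_map:
  assumes t: "t \<in> {..<card cell_params} \<rightarrow>\<^sub>E UNIV"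
  shows "cell_coordinates (cell_map t) = t"
proof
  fix m
  show "cell_coordinates (cell_map t) m = t m"
  proof (cases "m < card cell_params")
    case False
    then show ?thesis using t by (simp add: cell_coordinates_def PiE_def extensional_def)
  next
    case True
    then obtain i k l where p: "(i, k, l) \<in> cell_params" "param_index (i, k, l) = m"
      by (rule param_index_cases)
    then have i: "i \<in> verts Q" "k \<in> I i" "\<nexists>p. pred (i, k) p" and l: "l \<in> basis_index i" "k < l" "l \<notin> I i"
      by (auto simp: cell_params_def)
    have "reduced i (I i) (cell_map t i) k = start_vector t i k"
    proof (rule reduced_eqI[OF i(1) chart_cell_map[OF i(1)] i(2)])
      show "start_vector t i k \<in> cell_map t i"
        using generator_in_cell_map[OF i(1,2)] generator_start[OF i(3)] by metis
      show "c i (start_vector t i k) l = (if l = k then 1 else 0)" if "l \<in> I i" for l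
        using that I[OF i(1)] c_start_vector[OF i(1), of l] by auto
    qed
    then have "cell_coordinates (cell_map t) m = c i (start_vector t i k) l"
      using cell_coordinates_apply[OF p(1)] p(2) by simp
    then show ?thesis using l p(2) c_start_vector[OF i(1) l(1)] by simp
  qed
qed

text \<open>The start vectors for the coordinates of \<open>U\<close> are reduced vectors of
  \<open>U\<close>. Stability under the arrows puts all generators into \<open>U\<close>, and
  \<open>chart_subset_eq\<close> turns the inclusion into equality.\<close>

lemma cell_map_cell_coordinates:
  assumes U: "U \<in> cell"
  shows "cell_map (cell_coordinates U) = U"
proof
  fix i
  let ?t = "cell_coordinates U"
  have US: "U \<in> subrepresentations e" using U by (simp add: cell_def)
  have start_eq: "start_vector ?t i k = reduced i (I i) (U i) k"
    if i: "i \<in> verts Q" and k: "k \<in> I i" and np: "\<nexists>p. pred (i, k) p" for i k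
  proof (rule c_eqI[OF i start_vector_in_V[OF i] reduced_in_V[OF i chart_cell[OF U i] k]])
    have piv: "pivots i (U i) = I i" using U i by (simp add: cell_def)
    fix l assume l: "l \<in> basis_index i"
    have lead: "lead i k (reduced i (I i) (U i) k)"
      using lead_reduced_pivots[OF i subrepresentationD(1,2)[OF US i], of k] k unfolding piv by blast
    show "c i (start_vector ?t i k) l = c i (reduced i (I i) (U i) k) l"
    proof (cases "l \<in> I i")
      case True
      then show ?thesis
        using reduced_props(2)[OF i chart_cell[OF U i] k True] c_start_vector[OF i l] by simp
    next
      case False
      then have "l \<noteq> k" using k by blast
      then consider "l < k" | "k < l" by linarith
      then show ?thesis
      proof cases
        case 1
        then show ?thesis using lead l c_start_vector[OF i l] \<open>l \<noteq> k\<close> by (simp add: lead_def)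
      next
        case 2
        then have "(i, k, l) \<in> cell_params" using i k np l False by (simp add: cell_params_def)
        then show ?thesis
          using 2 False c_start_vector[OF i l] by (simp add: cell_coordinates_apply)
      qed
    qed
  qed
  have gen: "generator ?t (i, k) \<in> U i" if "i \<in> verts Q" "k \<in> I i" for i k
    using that
  proof (induction rule: generator_induct)
    case (start i k)
    then show ?case
      using reduced_props(1)[OF start(1) chart_cell[OF U start(1)] start(2)] start_eq[OF start]
      by (simp add: generator_start[OF start(3)])
  next
    case (step a k l)
    have a: "a \<in> arcs Q" using step(1) by (simp add: step_def)
    show ?case using subrepresentationD(5)[OF US a step(3)] generator_step[OF step(1,2)] by simp
  qed
  show "cell_map ?t i = U i"
  proof (cases "i \<in> verts Q")
    case True
    have "cell_map ?t i \<subseteq> U i"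
      unfolding cell_map_apply[OF True] using gen[OF True] subrepresentationD(1)[OF US True]
      by (intro span_minimal) auto
    then show ?thesis
      by (rule chart_subset_eq[OF True chart_cell_map[OF True] chart_cell[OF U True] finite_pivot_set[OF True]])
  next
    case False
    then show ?thesis using subrepresentationD(4)[OF US] cell_map_undefined by simp
  qed
qed

text \<open>In one direction the generators form a polynomial frame; in the other each coordinate is
  the restriction of a regular function on the open chart at \<open>I\<close>, which contains the
  cell.\<close>

lemma cell_isomorphic_affine_space:
  "variety_isomorphic (fsubspace (quiver_grassmannian e) cell) (affine_space (card cell_params))"
proof -
  let ?n = "card cell_params" and ?X = "quiver_grassmannian e"
  let ?A = "affine_space ?n" and ?Y = "fsubspace ?X cell"
  have pY: "points ?Y = cell" by (auto simp: cell_def)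
  have pA: "points ?A = {..<?n} \<rightarrow>\<^sub>E UNIV" by (simp add: affine_space_def)
  have I': "I i \<subseteq> basis_index i \<and> card (I i) = nat (e i)" if "i \<in> verts Q" for i
    using I[OF that] by auto
  interpret A: function_space ?A
    unfolding affine_space_def by (rule function_space_coordinate_space)
  interpret Y: function_space ?Y
    by (rule function_space.function_space_fsubspace[OF function_space_quiver_grassmannian])
  have "variety_morphism ?A ?X cell_map"
    unfolding affine_space_def cell_map_def
  proof (rule frame_morphism)
    show "frame_of e I (\<lambda>i k. generator t (i, k)) \<in> frames e" for t by (rule cell_map_frame)
    show "frame_span e (frame_of e I (\<lambda>i k. generator t (i, k))) \<in> subrepresentations e" for t
      using cell_map_subrepresentation[of t] by (simp add: cell_map_def)
    fix i s k assume i: "i \<in> verts Q" "s < nat (e i)" and k: "k \<in> basis_index i"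
    have "card (I i) = nat (e i)" using I'[OF i(1)] by blast
    then have "enum (I i) s \<in> I i" by (rule enum_in[OF finite_pivot_set[OF i(1)] _ i(2)])
    then show "(\<lambda>t. c i (frame_of e I (\<lambda>i k. generator t (i, k)) (i, s)) k)
        \<in> polynomial_functions {\<lambda>x. x k | k. k < ?n}"
      unfolding frame_of_apply[where e = e, OF i] by (rule generator_polynomial[OF i(1) _ k])
  qed
  moreover have "cell_map ` points ?A \<subseteq> cell" by (rule image_subsetI) (rule cell_map_in_cell)
  ultimately have "variety_morphism ?A ?Y cell_map"
    by (rule A.variety_morphism_into_fsubspace)
  moreover have "variety_morphism ?Y ?A cell_coordinates"
    unfolding affine_space_def
  proof (rule Y.variety_morphism_into_coordinate_space)
    show "cell_coordinates ` points ?Y \<subseteq> {..<?n} \<rightarrow>\<^sub>E UNIV"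
      unfolding cell_coordinates_def by (intro image_subsetI) (simp only: restrict_PiE_iff UNIV_I, blast)
    fix g :: "(nat \<Rightarrow> complex) \<Rightarrow> complex" assume "g \<in> {\<lambda>x. x k | k. k < ?n}"
    then obtain m where m: "m < ?n" "g = (\<lambda>x. x m)" by blast
    obtain i k l where p: "(i, k, l) \<in> cell_params" "param_index (i, k, l) = m"
      using m(1) by (rule param_index_cases)
    then have i: "i \<in> verts Q" "k \<in> I i" by (auto simp: cell_params_def)
    have "(\<lambda>U. g (cell_coordinates U)) = (\<lambda>U. c i (reduced i (I i) (U i) k) l)"
      using cell_coordinates_apply[OF p(1)] p(2) m(2) by simp
    also have "\<dots> \<in> regular ?Y cell"
    proof (rule regular_fsubspaceI)
      let ?D = "charts e I \<inter> subrepresentations e"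
      show "openin (zariski ?X) ?D"
        unfolding quiver_grassmannian_def zariski_fsubspace openin_subtopology
        using openin_charts[OF I'] by blast
      show "(\<lambda>U. c i (reduced i (I i) (U i) k) l) \<in> regular ?X ?D"
        unfolding quiver_grassmannian_def
        by (rule regular_fsubspaceI[OF openin_charts[OF I'] reduced_coordinate_regular[OF I' i]]) auto
      show "cell \<subseteq> ?D"
        using chart_cell by (auto simp: charts_def cell_def subrepresentations_def)
    qed
    finally show "(\<lambda>U. g (cell_coordinates U)) \<in> regular ?Y (points ?Y)" by (simp only: pY)
  qed
  ultimately show ?thesis
    unfolding variety_isomorphic_def
    using cell_coordinates_cell_map cell_map_cell_coordinates pY pA by blast
qed

end

text \<open>The pivots of a fixed point are closed under steps by \<open>pivots_step\<close>, so its
  attracting set is one of the parametrised cells.\<close>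

lemma affine_paving_attracting_sets:
  "affine_paving (quiver_grassmannian e) (fixed_points (quiver_grassmannian e) act)
     (attracting_set (quiver_grassmannian e) act)"
  unfolding affine_paving_def
proof (intro conjI ballI)
  show "alpha_partition (quiver_grassmannian e) (fixed_points (quiver_grassmannian e) act)
      (attracting_set (quiver_grassmannian e) act)"
    by (rule alpha_partition_attracting_sets)
  fix y assume y: "y \<in> fixed_points (quiver_grassmannian e) act"
  then have yS: "y \<in> subrepresentations e" by (simp add: fixed_points_eq)
  let ?I = "\<lambda>i. pivots i (y i)"
  have "attracting_set (quiver_grassmannian e) act y = cell e ?I"
    unfolding attracting_set_eq[OF y]
  proof -
    have "all_pivots U = all_pivots y \<longleftrightarrow> (\<forall>i\<in>verts Q. pivots i (U i) = ?I i)" for U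
      by (auto simp: all_pivots_def fun_eq_iff restrict_def)
    then show "{U \<in> subrepresentations e. all_pivots U = all_pivots y} = cell e ?I"
      using cell_def[of ?I e] pivots_subset card_pivots[OF yS] pivots_step[OF yS] by simp
  qed
  then show "\<exists>n. variety_isomorphic
      (fsubspace (quiver_grassmannian e) (attracting_set (quiver_grassmannian e) act y)) (affine_space n)"
    using cell_isomorphic_affine_space[of ?I e] pivots_subset card_pivots[OF yS] pivots_step[OF yS]
    by auto
qed

end

theorem theorem4p12:
  fixes Q :: "('i, 'a) pre_digraph"
    and scale :: "complex \<Rightarrow> 'v::ab_group_add \<Rightarrow> 'v"
    and V :: "'i \<Rightarrow> 'v set"
    and f :: "'a \<Rightarrow> 'v \<Rightarrow> 'v"
    and e :: "'i \<Rightarrow> int"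
    and b :: "'i \<Rightarrow> nat \<Rightarrow> 'v"
    and wt :: "'i \<Rightarrow> nat \<Rightarrow> int"
  assumes "quiver_representation Q scale V f"
    and "quiver_representation.straight Q scale V f"
    and "quiver_representation.straightening_basis Q scale V f b"
    and "quiver_representation.normalized Q scale V f b"
    and "quiver_representation.aligned Q scale V f b"
    and "quiver_representation.attractive_grading Q scale V f b wt"
  shows "let X = quiver_representation.quiver_grassmannian Q scale V f e;
             act = quiver_representation.torus_action Q scale V b wt
         in cstar_action (points X) act
            \<and> finite (fixed_points X act)
            \<and> affine_paving X (fixed_points X act) (attracting_set X act)"
proof -
  interpret quiver_representation Q scale V f by (fact assms(1))
  interpret attractive_quiver_representation Q scale V f b wt
  proof
    show "indexed_basis b" using assms(3) by (simp add: straightening_basis_def)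
    show "equioriented_string H"
      if "pre_digraph.max_subgraph (coefficient_quiver b) Digraph_Component.connected H" for H
      using assms(3) that by (simp add: straightening_basis_def)
  qed (fact assms)+
  show ?thesis
    unfolding Let_def
    using cstar_action_subrepresentations finite_fixed_points affine_paving_attracting_sets by simp
qed

end
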